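(* Every 3-CNF theory (respectively, every normal 3-program, every disjunctive 3-program) with $n$ atoms has at most $c^n$ minimal models (respectively, stable models, answer sets), where $c = 1.6701\ldots$.
   Context: A $t$-CNF theory is a finite set of propositional clauses, each containing at most $t$ literals; clauses contain no repeated literal and no pair of complementary literals. A normal program clause has the form $a \leftarrow b_1,\ldots,b_r,\mathbf{not}(c_1),\ldots,\mathbf{not}(c_s)$ and a disjunctive program clause the form $a_1\vee\cdots\vee a_p \leftarrow b_1,\ldots,b_r,\mathbf{not}(c_1),\ldots,\mathbf{not}(c_s)$; a (normal or disjunctive) $t$-program is a finite set of such clauses, each with at most $t$ literals. Models, stable models (Gelfond–Lifschitz) and answer sets (minimal models of the Gelfond–Lifschitz reduct $P^M$) are represented as sets of true atoms; a model is minimal if no proper subset is a model. $n$ is the number of atoms. The constant $c=1.6701\ldots$ is the real number $\tau>1$ for which there is $\alpha\in(0,1)$ (namely $\alpha=0.1950\ldots$) such that $\tau$ is simultaneously the root greater than $1$ of $\tau^{-1+\alpha}+\tau^{-4+3\alpha}+2\tau^{-6+4\alpha}+\tau^{-8+5\alpha}=1$ and of $\tau^{-1}+\tau^{-1-4\alpha}=1$. *)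

theory Defs
  imports Complex_Main
begin

datatype 'a literal = Pos (atom_of: 'a) | Neg (atom_of: 'a)

type_synonym 'a clause = "'a literal set"

definition cnf_theory :: "nat \<Rightarrow> 'a clause set \<Rightarrow> bool" where
  "cnf_theory t T \<longleftrightarrow>
     finite T \<and>
     (\<forall>C\<in>T. finite C \<and> card C \<le> t \<and> (\<forall>a. \<not> (Pos a \<in> C \<and> Neg a \<in> C)))"

definition cnf_atoms :: "'a clause set \<Rightarrow> 'a set" where
  "cnf_atoms T = atom_of ` \<Union>T"

fun true_literal :: "'a set \<Rightarrow> 'a literal \<Rightarrow> bool" where
  "true_literal M (Pos a) \<longleftrightarrow> a \<in> M"
| "true_literal M (Neg a) \<longleftrightarrow> a \<notin> M"

definition cnf_model :: "'a clause set \<Rightarrow> 'a set \<Rightarrow> bool" where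
  "cnf_model T M \<longleftrightarrow> (\<forall>C\<in>T. \<exists>l\<in>C. true_literal M l)"

definition cnf_minimal_model :: "'a clause set \<Rightarrow> 'a set \<Rightarrow> bool" where
  "cnf_minimal_model T M \<longleftrightarrow> cnf_model T M \<and> (\<forall>N. N \<subset> M \<longrightarrow> \<not> cnf_model T N)"

text \<open>
  \<open>Rule {a\<^sub>1, \<dots>, a\<^sub>p} {b\<^sub>1, \<dots>, b\<^sub>r} {c\<^sub>1, \<dots>, c\<^sub>s}\<close> is the program clause
  \<open>a\<^sub>1 \<or> \<dots> \<or> a\<^sub>p \<leftarrow> b\<^sub>1, \<dots>, b\<^sub>r, not(c\<^sub>1), \<dots>, not(c\<^sub>s)\<close>; any of \<open>p\<close>, \<open>r\<close>, \<open>s\<close> may be zero.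
  An atom may occur in more than one of the three components, and each of these occurrences counts
  as a literal.
\<close>

datatype 'a rule = Rule (rule_head: "'a set") (rule_pos: "'a set") (rule_neg: "'a set")

definition disjunctive_program :: "nat \<Rightarrow> 'a rule set \<Rightarrow> bool" where
  "disjunctive_program t P \<longleftrightarrow>
     finite P \<and>
     (\<forall>C\<in>P. finite (rule_head C) \<and> finite (rule_pos C) \<and> finite (rule_neg C) \<and>
             card (rule_head C) + card (rule_pos C) + card (rule_neg C) \<le> t)"

definition normal_program :: "nat \<Rightarrow> 'a rule set \<Rightarrow> bool" where
  "normal_program t P \<longleftrightarrow> disjunctive_program t P \<and> (\<forall>C\<in>P. \<exists>a. rule_head C = {a})"

definition program_atoms :: "'a rule set \<Rightarrow> 'a set" where
  "program_atoms P = (\<Union>C\<in>P. rule_head C \<union> rule_pos C \<union> rule_neg C)"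

definition program_model :: "'a rule set \<Rightarrow> 'a set \<Rightarrow> bool" where
  "program_model P M \<longleftrightarrow>
     (\<forall>C\<in>P. rule_pos C \<subseteq> M \<and> rule_neg C \<inter> M = {} \<longrightarrow> rule_head C \<inter> M \<noteq> {})"

definition reduct :: "'a rule set \<Rightarrow> 'a set \<Rightarrow> 'a rule set" where
  "reduct P M = {Rule (rule_head C) (rule_pos C) {} |C. C \<in> P \<and> rule_neg C \<inter> M = {}}"

definition stable_model :: "'a rule set \<Rightarrow> 'a set \<Rightarrow> bool" where
  "stable_model P M \<longleftrightarrow>
     program_model (reduct P M) M \<and> (\<forall>N. program_model (reduct P M) N \<longrightarrow> M \<subseteq> N)"

definition answer_set :: "'a rule set \<Rightarrow> 'a set \<Rightarrow> bool" where
  "answer_set P M \<longleftrightarrow>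
     program_model (reduct P M) M \<and> (\<forall>N. N \<subset> M \<longrightarrow> \<not> program_model (reduct P M) N)"

definition balanced_root :: "real \<Rightarrow> real \<Rightarrow> bool" where
  "balanced_root \<alpha> \<tau> \<longleftrightarrow>
     0 < \<alpha> \<and> \<alpha> < 1 \<and> 1 < \<tau> \<and>
     \<tau> powr (-1 + \<alpha>) + \<tau> powr (-4 + 3 * \<alpha>) + 2 * \<tau> powr (-6 + 4 * \<alpha>) + \<tau> powr (-8 + 5 * \<alpha>) = 1 \<and>
     \<tau> powr (-1) + \<tau> powr (-1 - 4 * \<alpha>) = 1"

definition c3 :: real where
  "c3 = (THE \<tau>. \<exists>\<alpha>. balanced_root \<alpha> \<tau>)"

text \<open>The description operator in \<^const>\<open>c3\<close> is justified by existence and uniqueness.\<close>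

lemma balanced_root_unique:
  assumes "balanced_root \<alpha> \<tau>" "balanced_root \<beta> \<sigma>"
  shows "\<tau> = \<sigma>"
proof -
  have less: False if A: "balanced_root \<alpha> \<tau>" and B: "balanced_root \<beta> \<sigma>" and lt: "\<tau> < \<sigma>"
    for \<alpha> \<beta> \<tau> \<sigma>
  proof -
    have t: "1 < \<tau>" "0 < \<alpha>" "\<alpha> < 1" and s: "1 < \<sigma>" "0 < \<beta>" "\<beta> < 1"
      using A B by (auto simp: balanced_root_def)
    have mono: "\<sigma> powr y < \<tau> powr x" if "y \<le> x" "y < 0" for x y
    proof -
      have "\<sigma> powr y < \<tau> powr y" using that t lt by (intro powr_less_mono2_neg) auto
      also have "\<dots> \<le> \<tau> powr x" using that t by (intro powr_mono) auto
      finally show ?thesis .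
    qed
    show False
    proof (cases "\<beta> \<le> \<alpha>")
      case True
      have "\<sigma> powr (-1 + \<beta>) < \<tau> powr (-1 + \<alpha>)" "\<sigma> powr (-4 + 3*\<beta>) < \<tau> powr (-4 + 3*\<alpha>)"
        "\<sigma> powr (-6 + 4*\<beta>) < \<tau> powr (-6 + 4*\<alpha>)" "\<sigma> powr (-8 + 5*\<beta>) < \<tau> powr (-8 + 5*\<alpha>)"
        using True t s by (auto intro!: mono)
      then show False using A B unfolding balanced_root_def by linarith
    next
      case False
      have "\<sigma> powr (-1) < \<tau> powr (-1)" "\<sigma> powr (-1 - 4*\<beta>) < \<tau> powr (-1 - 4*\<alpha>)"
        using False t s by (intro mono; simp)+
      then show False using A B unfolding balanced_root_def by linarith
    qed
  qed
  show ?thesis using less[OF assms] less[OF assms(2,1)] by (cases \<tau> \<sigma> rule: linorder_cases) auto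
qed

text \<open>
  With \<open>u = \<tau>\<^sup>\<alpha>\<close> the second equation reads \<open>\<tau> = 1 + u\<^sup>-\<^sup>4\<close>, and the first one becomes a
  rational equation in \<open>u\<close>.
\<close>

lemma balanced_root_exists: "\<exists>\<alpha> \<tau>. balanced_root \<alpha> \<tau> \<and> 1.6701 < \<tau> \<and> \<tau> < 1.6702"
proof -
  define T :: "real \<Rightarrow> real" where "T u = 1 + 1 / u^4" for u
  define h :: "real \<Rightarrow> real" where
    "h u = u / T u + u^3 / T u^4 + 2 * u^4 / T u^6 + u^5 / T u^8" for u
  have Tpos: "T u \<noteq> 0" for u
  proof -
    have "0 \<le> 1 / u^4" by simp
    then show ?thesis unfolding T_def by linarith
  qed
  have "continuous_on {1.10523..1.10525} T"
    unfolding T_def by (intro continuous_intros) auto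
  then have cont: "continuous_on {1.10523..1.10525} h"
    unfolding h_def using Tpos by (intro continuous_intros) auto
  define g :: "real \<Rightarrow> real \<Rightarrow> real" where
    "g u t = u / t + u^3 / t^4 + 2 * u^4 / t^6 + u^5 / t^8" for u t
  have g_eq: "g (a / k) (b / k) = (a * b^7 + a^3 * k * b^4 + 2 * a^4 * k^2 * b^2 + a^5 * k^3) / b^8"
    if "b > 0" "k > 0" for a b k
    unfolding g_def using that by (simp add: field_simps power_numeral_reduce)
  have g_le: "g (a / k) (b / k) \<le> 1"
    if "a * b^7 + a^3 * k * b^4 + 2 * a^4 * k^2 * b^2 + a^5 * k^3 \<le> b^8" "b > 0" "k > 0" for a b k
    using that by (simp add: g_eq)
  have g_ge: "1 \<le> g (a / k) (b / k)"
    if "b^8 \<le> a * b^7 + a^3 * k * b^4 + 2 * a^4 * k^2 * b^2 + a^5 * k^3" "b > 0" "k > 0" for a b k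
    using that by (simp add: g_eq)
  have g_mono: "g u t \<le> g u s" if "0 < s" "s \<le> t" "0 \<le> u" for u s t
    unfolding g_def using that
    by (intro add_mono divide_left_mono power_mono mult_pos_pos zero_less_power) auto
  have "1.670176 \<le> T 1.10523" "T 1.10525 \<le> 1.670129"
    unfolding T_def by (simp_all add: field_simps)
  moreover have "0 < T 1.10525" unfolding T_def by (intro add_pos_pos) auto
  ultimately have "g 1.10523 (T 1.10523) \<le> g 1.10523 1.670176"
      "g 1.10525 1.670129 \<le> g 1.10525 (T 1.10525)"
    by (auto intro!: g_mono)
  moreover have "g (1105230 / 1000000) (1670176 / 1000000) \<le> 1"
    by (rule g_le) simp_all
  moreover have "1 \<le> g (1105250 / 1000000) (1670129 / 1000000)"
    by (rule g_ge) simp_all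
  moreover have "h u = g u (T u)" for u by (simp add: h_def g_def)
  ultimately have "h 1.10523 \<le> 1" "1 \<le> h 1.10525" by simp_all
  from IVT'[OF this(1,2) _ cont] obtain u where u: "1.10523 \<le> u" "u \<le> 1.10525" "h u = 1"
    by auto
  have T_mono: "T w \<le> T v" if "0 < v" "v \<le> w" for v w
    unfolding T_def using that
    by (intro add_mono divide_left_mono power_mono mult_pos_pos zero_less_power) auto
  have "T 1.10525 \<le> T u" "T u \<le> T 1.10523" using u by (auto intro!: T_mono)
  moreover have "1.6701 < T 1.10525" "T 1.10523 < 1.6702"
    unfolding T_def by (simp_all add: field_simps)
  ultimately have Tb: "1.6701 < T u" "T u < 1.6702" by linarith+
  define \<alpha> where "\<alpha> = ln u / ln (T u)"
  have pw: "T u powr (of_nat k * \<alpha>) = u ^ k" for k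
  proof -
    have "of_nat k * \<alpha> * ln (T u) = of_nat k * ln u" unfolding \<alpha>_def using Tb by auto
    then have "T u powr (of_nat k * \<alpha>) = exp (of_nat k * ln u)"
      using Tb by (simp add: powr_def)
    also have "\<dots> = u ^ k" using u by (simp add: exp_of_nat_mult)
    finally show ?thesis .
  qed
  have neg: "T u powr (- of_nat k + of_nat j * \<alpha>) = u ^ j / T u ^ k" for k j
  proof -
    have "T u powr (- of_nat k) = 1 / T u ^ k"
      using Tb by (simp only: powr_minus_divide) (subst powr_realpow, auto)
    then show ?thesis by (simp only: powr_add pw) simp
  qed
  have "1 < u" "u < T u" using u(1,2) Tb(1) by simp_all
  then have "0 < ln u" "ln u < ln (T u)" by auto
  then have "0 < \<alpha>" "\<alpha> < 1" unfolding \<alpha>_def by auto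
  moreover have "T u powr (-1 + \<alpha>) + T u powr (-4 + 3 * \<alpha>) + 2 * T u powr (-6 + 4 * \<alpha>)
      + T u powr (-8 + 5 * \<alpha>) = 1"
    using neg[of 1 1] neg[of 4 3] neg[of 6 4] neg[of 8 5] u(3) by (simp add: h_def)
  moreover have "T u powr (-1) + T u powr (-1 - 4 * \<alpha>) = 1"
  proof -
    have "T u powr (-1 - 4 * \<alpha>) = 1 / (T u * u^4)"
      using pw[of 4] Tb by (simp add: powr_diff powr_minus field_simps)
    moreover have "T u powr (-1) = 1 / T u" using Tb by (simp add: powr_minus field_simps)
    moreover have "1 / T u + 1 / (T u * u^4) = (1 + 1 / u^4) / T u"
      by (simp add: add_divide_distrib)
    moreover have "\<dots> = 1" using Tpos by (simp add: T_def[symmetric])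
    ultimately show ?thesis by simp
  qed
  ultimately show ?thesis using Tb unfolding balanced_root_def
    by (intro exI[of _ \<alpha>] exI[of _ "T u"]) auto
qed

lemma c3_eqI: "balanced_root \<alpha> \<tau> \<Longrightarrow> c3 = \<tau>"
  unfolding c3_def by (rule the_equality) (blast, metis balanced_root_unique)

end

theory Submission
  imports Defs
begin

text \<open>
  Answer sets and stable models of a program are minimal models of its clausal form, so only minimal
  models of a 3-CNF theory have to be counted. If \<open>T\<close> has \<open>n\<close> atoms and contains \<open>k\<close> 2-clauses without
  common atoms, it has at most \<open>\<tau>\<close> to the power \<open>n - \<alpha> * k\<close> minimal models, by induction on \<open>n\<close>: one
  branches over partial assignments, adds to the theory the 2-clauses known to hold in a branch, and uses
  that every true atom of a minimal model is the only true literal of some clause.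

  The two equations for \<open>\<tau>\<close> are the two tight branchings. An isolated 2-clause \<open>a \<or> b\<close> whose atom \<open>a\<close>
  occurs in two more clauses \<open>a \<or> x \<or> y\<close>, \<open>a \<or> z \<or> w\<close> is treated by making \<open>a\<close> true, or making it
  false and branching further on the two new 2-clauses, each of which joins two old ones; this is the first
  equation. If there are no 2-clauses, an atom \<open>a\<close> with four clauses meeting only in \<open>a\<close> gives four
  disjoint 2-clauses as soon as \<open>a\<close> is false; this is the second equation. Otherwise the theory
  reduces to a 3-uniform hypergraph all of whose vertex links have matching number at most 3, and the
  few remaining shapes of such a link are branched on individually.
\<close>

section \<open>Clauses and minimal models\<close>

text \<open>The obstacle is interference. A 2-clause created in a branch is worth the factor
  \<open>v\<close> only if it avoids the 2-clauses already counted, and fixing an atom of a counted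
  clause loses that clause, a factor \<open>u = 1 / v\<close>. The worst clash of one new clause
  \<open>{x, y}\<close> is with an old \<open>{x, z}\<close>: \<open>x\<close> true loses one
  clause, \<open>x\<close> false forces \<open>y\<close> and \<open>z\<close> and loses at most two,
  so the new clause is worth only \<open>phi = t * u + t^3 * u^2\<close>. Two new clauses are worth
  \<open>phi^2\<close>, and the first equation for tau is just
  \<open>t * u + t^2 * u * phi^2 = 1\<close>. The value \<open>phi^2\<close> is missed only when
  both new clauses form a 4-cycle with two old ones; then they are the only possible justifications
  of \<open>a\<close>, and the branch with both atoms of the isolated clause true becomes small
  enough to compensate. All other branchings have slack and are settled by interval bounds for
  \<open>t\<close>, \<open>u\<close> and \<open>v\<close>. In the hypergraph part the slack is
  small. Where a branching on the link of \<open>a\<close> alone is too expensive, hyperedges that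
  avoid \<open>a\<close> but meet a neighbour of \<open>a\<close> supply the missing factor; they
  exist because every vertex lies on at least three hyperedges.\<close>

fun flip :: "'a literal \<Rightarrow> 'a literal" where
  "flip (Pos a) = Neg a"
| "flip (Neg a) = Pos a"

lemma atom_of_flip [simp]: "atom_of (flip l) = atom_of l"
  by (cases l) auto

lemma true_literal_flip [simp]: "true_literal M (flip l) \<longleftrightarrow> \<not> true_literal M l"
  by (cases l) auto

lemma flip_flip [simp]: "flip (flip l) = l"
  by (cases l) auto

lemma flip_neq [simp]: "flip l \<noteq> l" "l \<noteq> flip l"
  by (cases l; simp)+

lemma atom_of_eq_iff: "atom_of l = atom_of m \<longleftrightarrow> l = m \<or> l = flip m"
  by (cases l; cases m) auto

lemma true_literal_cong: "(atom_of l \<in> M \<longleftrightarrow> atom_of l \<in> N) \<Longrightarrow> true_literal M l = true_literal N l"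
  by (cases l) auto

definition holds :: "'a set \<Rightarrow> 'a clause \<Rightarrow> bool" where
  "holds M C \<longleftrightarrow> (\<exists>l\<in>C. true_literal M l)"

lemma holds_pair [simp]: "holds M {x, y} \<longleftrightarrow> true_literal M x \<or> true_literal M y"
  by (auto simp: holds_def)

definition two_clause :: "'a clause \<Rightarrow> bool" where
  "two_clause C \<longleftrightarrow> (\<exists>x y. C = {x, y} \<and> atom_of x \<noteq> atom_of y)"

lemma two_clauseE:
  assumes "two_clause C"
  obtains x y where "C = {x, y}" "atom_of x \<noteq> atom_of y"
  using assms by (auto simp: two_clause_def)

lemma two_clauseE_at:
  assumes "two_clause C" "a \<in> atom_of ` C"
  obtains x y where "C = {x, y}" "atom_of x \<noteq> atom_of y" "atom_of x = a"
proof -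
  obtain x y where C: "C = {x, y}" "atom_of x \<noteq> atom_of y" using assms(1) by (rule two_clauseE)
  then have "atom_of x = a \<or> atom_of y = a" using assms(2) by auto
  then show thesis using that[of x y] that[of y x] C by (auto simp: insert_commute)
qed

lemma two_clause_pair [simp]: "two_clause {x, y} \<longleftrightarrow> atom_of x \<noteq> atom_of y"
  unfolding two_clause_def by (metis doubleton_eq_iff)

section \<open>Matchings of 2-clauses\<close>

definition matching :: "'a clause set \<Rightarrow> bool" where
  "matching K \<longleftrightarrow> finite K \<and> (\<forall>C\<in>K. two_clause C) \<and>
     (\<forall>C\<in>K. \<forall>D\<in>K. C \<noteq> D \<longrightarrow> atom_of ` C \<inter> atom_of ` D = {})"

lemma matching_subset: "matching K \<Longrightarrow> K' \<subseteq> K \<Longrightarrow> matching K'"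
  unfolding matching_def using finite_subset[of K' K] by blast

lemma matching_disjoint:
  "matching K \<Longrightarrow> C \<in> K \<Longrightarrow> D \<in> K \<Longrightarrow> C \<noteq> D \<Longrightarrow> atom_of ` C \<inter> atom_of ` D = {}"
  by (simp add: matching_def)

text \<open>These are the clauses of a matching that are lost when the atoms of \<open>X\<close> are
  fixed; each loss costs a factor \<open>u\<close>.\<close>

definition touched :: "'a clause set \<Rightarrow> 'a set \<Rightarrow> 'a clause set" where
  "touched K X = {C \<in> K. atom_of ` C \<inter> X \<noteq> {}}"

lemma touched_Un: "touched K (X \<union> Y) = touched K X \<union> touched K Y"
  by (auto simp: touched_def)

lemma touched_subset: "touched K X \<subseteq> K"
  by (auto simp: touched_def)

lemma touched_clause:
  assumes "matching K" "E \<in> K" "X \<subseteq> atom_of ` E"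
  shows "touched K X \<subseteq> {E}"
proof
  fix C assume "C \<in> touched K X"
  then have "C \<in> K" "atom_of ` C \<inter> atom_of ` E \<noteq> {}" using assms(3) by (auto simp: touched_def)
  then show "C \<in> {E}" using assms(1,2) unfolding matching_def by blast
qed

lemma card_touched_le:
  assumes K: "matching K" and "finite X"
  shows "card (touched K X) \<le> card X"
  using \<open>finite X\<close>
proof (induction X rule: finite_induct)
  case empty
  then show ?case by (simp add: touched_def)
next
  case (insert x X)
  have "card (touched K {x}) \<le> 1"
  proof (cases "touched K {x} = {}")
    case False
    then obtain E where "E \<in> K" "x \<in> atom_of ` E" by (auto simp: touched_def)
    then have "touched K {x} \<subseteq> {E}" using touched_clause[OF K, of E "{x}"] by simp
    then show ?thesis using card_mono[of "{E}"] by fastforce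
  qed simp
  moreover have "touched K (insert x X) = touched K {x} \<union> touched K X"
    using touched_Un[of K "{x}" X] by simp
  ultimately show ?case
    using insert card_Un_le[of "touched K {x}" "touched K X"] by simp
qed

text \<open>Fixing both atoms of one matching clause loses that clause only once. This is what makes
  branching on the two literals of a counted clause cheap.\<close>

lemma card_touched_clause_le:
  assumes K: "matching K" and E: "E \<in> K" and X: "X \<subseteq> atom_of ` E \<union> Y" and Y: "finite Y"
  shows "card (touched K X) \<le> 1 + card Y"
proof -
  have fin: "finite K" using K by (simp add: matching_def)
  have "touched K X \<subseteq> touched K (atom_of ` E) \<union> touched K Y"
    using X by (auto simp: touched_def)
  also have "\<dots> \<subseteq> {E} \<union> touched K Y" using touched_clause[OF K E] by blast
  finally have "card (touched K X) \<le> card ({E} \<union> touched K Y)"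
    using fin by (intro card_mono) (auto intro: finite_subset[OF touched_subset])
  also have "\<dots> \<le> 1 + card (touched K Y)" using card_Un_le[of "{E}"] by simp
  also have "\<dots> \<le> 1 + card Y" using card_touched_le[OF K Y] by simp
  finally show ?thesis .
qed

section \<open>Minimal models, their witnesses and simplification\<close>

lemma cnf_atoms_finite:
  assumes "cnf_theory t T"
  shows "finite (cnf_atoms T)"
  using assms by (auto simp: cnf_theory_def cnf_atoms_def)

lemma cnf_model_iff: "cnf_model T M \<longleftrightarrow> (\<forall>C\<in>T. holds M C)"
  by (simp add: cnf_model_def holds_def)

lemma minimal_model_holds: "cnf_minimal_model T M \<Longrightarrow> C \<in> T \<Longrightarrow> holds M C"
  by (auto simp: cnf_minimal_model_def cnf_model_iff)

lemma minimal_model_subset_atoms: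
  assumes "cnf_minimal_model T M"
  shows "M \<subseteq> cnf_atoms T"
proof -
  have "cnf_model T (M \<inter> cnf_atoms T)"
    unfolding cnf_model_def
  proof
    fix C assume C: "C \<in> T"
    then obtain l where l: "l \<in> C" "true_literal M l"
      using assms by (auto simp: cnf_minimal_model_def cnf_model_def)
    then have "atom_of l \<in> cnf_atoms T" using C by (auto simp: cnf_atoms_def)
    then have "true_literal (M \<inter> cnf_atoms T) l" using l true_literal_cong[of l M "M \<inter> cnf_atoms T"] by auto
    then show "\<exists>l\<in>C. true_literal (M \<inter> cnf_atoms T) l" using l by blast
  qed
  then have "\<not> M \<inter> cnf_atoms T \<subset> M" using assms by (auto simp: cnf_minimal_model_def)
  then show ?thesis by blast
qed

lemma finite_minimal_models:
  assumes "cnf_theory t T"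
  shows "finite {M. cnf_minimal_model T M}"
proof (rule finite_subset)
  show "{M. cnf_minimal_model T M} \<subseteq> Pow (cnf_atoms T)"
    using minimal_model_subset_atoms by blast
  show "finite (Pow (cnf_atoms T))" using cnf_atoms_finite[OF assms] by simp
qed

text \<open>By minimality some clause fails in \<open>M - {a}\<close>. Deleting \<open>a\<close>
  makes no literal false except \<open>Pos a\<close>, so this was the only true literal of the
  clause.\<close>

lemma minimal_model_witness:
  assumes M: "cnf_minimal_model T M" and a: "a \<in> M"
  obtains D where "Pos a \<notin> D" "insert (Pos a) D \<in> T" "\<And>l. l \<in> D \<Longrightarrow> \<not> true_literal M l"
proof -
  have "\<not> cnf_model T (M - {a})" using M a unfolding cnf_minimal_model_def by blast
  then obtain C where C: "C \<in> T" "\<And>l. l \<in> C \<Longrightarrow> \<not> true_literal (M - {a}) l"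
    by (auto simp: cnf_model_def)
  obtain l where l: "l \<in> C" "true_literal M l"
    using minimal_model_holds[OF M C(1)] by (auto simp: holds_def)
  have other: "\<not> true_literal M m" if "m \<in> C" "m \<noteq> Pos a" for m
    using C(2)[OF that(1)] that(2) by (cases m) auto
  then have "l = Pos a" using l by blast
  then have "insert (Pos a) (C - {Pos a}) \<in> T" using C l by (simp add: insert_absorb)
  then show thesis using other by (intro that[of "C - {Pos a}"]) auto
qed

text \<open>
  The theory constructed here is the simplification of \<open>T \<union> K\<close> by the literals \<open>ls\<close>. Adding clauses
  that hold in a minimal model keeps it minimal, so it is enough that \<open>K\<close> holds in the models counted.
\<close>

lemma minimal_models_simplify:
  assumes T: "cnf_theory 3 T" and K: "matching K"
    and ls: "atom_of ` set ls \<subseteq> cnf_atoms T"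
    and KV: "\<And>C. C \<in> K \<Longrightarrow> atom_of ` C \<subseteq> cnf_atoms T - atom_of ` set ls"
    and S: "\<And>M. M \<in> S \<Longrightarrow> cnf_minimal_model T M"
    and Sls: "\<And>M l. M \<in> S \<Longrightarrow> l \<in> set ls \<Longrightarrow> true_literal M l"
    and SK: "\<And>M C. M \<in> S \<Longrightarrow> C \<in> K \<Longrightarrow> holds M C"
  obtains T' where "cnf_theory 3 T'" "K \<subseteq> T'" "cnf_atoms T' \<subseteq> cnf_atoms T - atom_of ` set ls"
    "card S \<le> card {M. cnf_minimal_model T' M}"
proof -
  define A where "A = atom_of ` set ls"
  define T' where "T' = (\<lambda>C. C - flip ` set ls) ` {C \<in> T \<union> K. C \<inter> set ls = {}}"
  have rest: "atom_of l \<notin> A" if "l \<notin> set ls" "l \<notin> flip ` set ls" for l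
  proof
    assume "atom_of l \<in> A"
    then obtain m where "m \<in> set ls" "atom_of l = atom_of m" unfolding A_def by blast
    then show False using that atom_of_eq_iff[of l m] by blast
  qed
  have finK: "finite K" and twoK: "\<And>C. C \<in> K \<Longrightarrow> two_clause C"
    using K by (auto simp: matching_def)
  have cl: "finite C \<and> card C \<le> 3 \<and> (\<forall>a. \<not> (Pos a \<in> C \<and> Neg a \<in> C))" if "C \<in> T \<union> K" for C
  proof (cases "C \<in> T")
    case True
    then show ?thesis using T by (auto simp: cnf_theory_def)
  next
    case False
    then have "two_clause C" using that twoK by blast
    then obtain x y where "C = {x, y}" "atom_of x \<noteq> atom_of y" by (rule two_clauseE)
    then show ?thesis by (auto simp: card_insert_if)
  qed
  have cnf: "cnf_theory 3 T'"
    unfolding cnf_theory_def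
  proof (intro conjI ballI)
    show "finite T'" using T finK by (auto simp: T'_def cnf_theory_def)
    fix C' assume "C' \<in> T'"
    then obtain C where C: "C \<in> T \<union> K" "C' \<subseteq> C" by (auto simp: T'_def)
    show "finite C'" using cl[OF C(1)] C(2) finite_subset by blast
    show "card C' \<le> 3" using cl[OF C(1)] card_mono[OF _ C(2)] by linarith
    show "\<forall>a. \<not> (Pos a \<in> C' \<and> Neg a \<in> C')" using cl[OF C(1)] C(2) by blast
  qed
  have KT': "K \<subseteq> T'"
  proof
    fix C assume C: "C \<in> K"
    have "atom_of l \<notin> A" if "l \<in> C" for l using KV[OF C] that by (auto simp: A_def)
    then have "C \<inter> set ls = {}" "C - flip ` set ls = C" by (fastforce simp: A_def)+
    then show "C \<in> T'" unfolding T'_def using C by (intro image_eqI[of _ _ C]) simp_all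
  qed
  have atoms: "cnf_atoms T' \<subseteq> cnf_atoms T - A"
  proof
    fix a assume "a \<in> cnf_atoms T'"
    then obtain C l where "C \<in> T \<union> K" "C \<inter> set ls = {}" "l \<in> C" "l \<notin> flip ` set ls" "a = atom_of l"
      by (auto simp: cnf_atoms_def T'_def)
    then show "a \<in> cnf_atoms T - A"
      using rest[of l] KV[of C] by (auto simp: cnf_atoms_def)
  qed
  \<comment> \<open>The literals in \<open>ls\<close> determine \<open>M\<close> on
    \<open>A\<close>, hence removing \<open>A\<close> is injective on \<open>S\<close>.\<close>
  have MA: "M \<inter> A = {a. Pos a \<in> set ls}" if "M \<in> S" for M
  proof -
    have "a \<in> M \<longleftrightarrow> Pos a \<in> set ls" if a: "a \<in> A" for a
    proof -
      obtain l where l: "l \<in> set ls" "atom_of l = a" using a by (auto simp: A_def)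
      then have "l = Pos a \<or> l = Neg a" by (metis literal.exhaust_sel)
      then show ?thesis using l(1) Sls[OF \<open>M \<in> S\<close>, of l] Sls[OF \<open>M \<in> S\<close>, of "Pos a"] by auto
    qed
    moreover have "a \<in> A" if "Pos a \<in> set ls" for a using that by (force simp: A_def)
    ultimately show ?thesis by blast
  qed
  have min: "cnf_minimal_model T' (M - A)" if M: "M \<in> S" for M
    unfolding cnf_minimal_model_def
  proof (intro conjI allI impI)
    show "cnf_model T' (M - A)"
      unfolding cnf_model_def
    proof
      fix C' assume "C' \<in> T'"
      then obtain C where C: "C \<in> T \<union> K" "C \<inter> set ls = {}" "C' = C - flip ` set ls"
        by (auto simp: T'_def)
      obtain l where l: "l \<in> C" "true_literal M l"
        using C(1) SK[OF M] minimal_model_holds[OF S[OF M]] by (auto simp: holds_def)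
      have "l \<notin> flip ` set ls" using Sls[OF M] l by auto
      then have "atom_of l \<notin> A" using rest C(2) l(1) by blast
      then have "true_literal (M - A) l" using l(2) true_literal_cong[of l M "M - A"] by auto
      then show "\<exists>l\<in>C'. true_literal (M - A) l" using l(1) C(3) \<open>l \<notin> flip ` set ls\<close> by blast
    qed
    fix N assume N: "N \<subset> M - A"
    show "\<not> cnf_model T' N"
    proof
      assume mod: "cnf_model T' N"
      \<comment> \<open>A smaller model of the simplified theory, completed by the fixed part
        \<open>M \<inter> A\<close>, would be a model of \<open>T\<close> properly below
        \<open>M\<close>.\<close>
      have "cnf_model T (N \<union> (M \<inter> A))"
        unfolding cnf_model_def
      proof
        fix C assume C: "C \<in> T"
        show "\<exists>l\<in>C. true_literal (N \<union> (M \<inter> A)) l"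
        proof (cases "C \<inter> set ls = {}")
          case False
          then obtain l where l: "l \<in> C" "l \<in> set ls" by blast
          then have "atom_of l \<in> A" "true_literal M l" using Sls[OF M] by (auto simp: A_def)
          then have "true_literal (N \<union> (M \<inter> A)) l"
            using true_literal_cong[of l M "N \<union> (M \<inter> A)"] N by auto
          then show ?thesis using l by blast
        next
          case True
          then have "C - flip ` set ls \<in> T'" using C by (auto simp: T'_def)
          then obtain l where l: "l \<in> C" "l \<notin> flip ` set ls" "true_literal N l"
            using mod by (auto simp: cnf_model_def)
          then have "atom_of l \<notin> A" using rest True by blast
          then have "true_literal (N \<union> (M \<inter> A)) l"
            using true_literal_cong[of l N "N \<union> (M \<inter> A)"] l by auto
          then show ?thesis using l by blast
        qed
      qed
      moreover have "N \<union> (M \<inter> A) \<subset> M" using N by blast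
      ultimately show False using S[OF M] by (auto simp: cnf_minimal_model_def)
    qed
  qed
  have "inj_on (\<lambda>M. M - A) S"
  proof (rule inj_onI)
    fix M N assume "M \<in> S" "N \<in> S" "M - A = N - A"
    then show "M = N" using MA[of M] MA[of N] by blast
  qed
  then have "card S \<le> card {M. cnf_minimal_model T' M}"
    using finite_minimal_models[OF cnf] min by (intro card_inj_on_le[of "\<lambda>M. M - A"]) auto
  then show thesis using that cnf KT' atoms unfolding A_def by blast
qed

section \<open>Weights\<close>

text \<open>
  Here \<open>t = 1 / \<tau>\<close>, \<open>u = \<tau> powr \<alpha>\<close> and \<open>v = 1 / u\<close>: fixing an atom costs a factor \<open>t\<close>, every 2-clause
  of the matching is worth a factor \<open>v\<close>.
\<close>

locale weights =
  fixes t u v :: real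
  assumes t_lower: "0.5987 < t" and t_upper: "t < 0.59877"
    and u_lower: "1.1052 < u" and u_upper: "u < 1.1053"
    and uv: "u * v = 1"
    and root1: "t * u + t^4 * u^3 + 2 * (t^6 * u^4) + t^8 * u^5 = 1"
    and root2: "t + t * v^4 = 1"
begin

lemma t_pos: "0 < t" and u_pos: "0 < u"
  using t_lower u_lower by simp_all

lemma v_eq: "v = 1 / u"
  using uv u_pos by (simp add: field_simps)

lemma v_pos: "0 < v" and v_upper: "v < 0.90482" and v_lower: "0.9047 < v"
  using u_pos u_lower u_upper by (simp_all add: v_eq field_simps)

text \<open>Most branchings with slack lead to sums of monomials in \<open>t\<close> and
  \<open>u\<close>, or in \<open>t\<close> and \<open>v\<close>, with positive coefficients. They
  are decided by evaluating at the upper ends of the intervals.\<close>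

lemma tu_le: "t^i * u^j \<le> 0.59877^i * 1.1053^j"
  using t_pos u_pos t_upper u_upper by (intro mult_mono power_mono) auto

lemma tv_le: "t^i * v^j \<le> 0.59877^i * 0.90482^j"
  using t_pos v_pos t_upper v_upper by (intro mult_mono power_mono) auto

lemma t_le: "t^i \<le> 0.59877^i"
  using t_pos t_upper by (intro power_mono) auto

text \<open>The guaranteed worth of one new 2-clause \<open>{x, y}\<close>, attained at a clash with
  \<open>{x, z}\<close> in the matching: \<open>t * u\<close> for \<open>x\<close> true,
  \<open>t^3 * u^2\<close> for \<open>x\<close> false, which forces \<open>y\<close> and
  \<open>z\<close>.\<close>

definition phi :: real where
  "phi = t * u + t^3 * u^2"

lemma phi_lower: "0.9238 < phi"
proof -
  have "0.5987 * 1.1052 < t * u"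
    using t_lower u_lower by (intro mult_strict_mono) auto
  moreover have "0.5987^3 * 1.1052^2 < t^3 * u^2"
    using t_lower u_lower by (intro mult_strict_mono power_strict_mono) auto
  ultimately show ?thesis unfolding phi_def by (simp add: power_numeral_reduce)
qed

lemma phi_upper: "phi < 0.9242"
  using tu_le[of 1 1] tu_le[of 3 2] unfolding phi_def by (simp add: power_numeral_reduce)

lemma phi_sq_lower: "0.8534 < phi^2"
proof -
  have "0.9238^2 < phi^2" using phi_lower by (intro power_strict_mono) auto
  then show ?thesis by (simp add: power2_eq_square)
qed

text \<open>Expanding \<open>phi^2\<close> recovers the first equation for tau. Read as a branching
  on a clause \<open>a \<or> b\<close>: \<open>a\<close> true costs \<open>t * u\<close>;
  \<open>a\<close> false and \<open>b\<close> true costs \<open>t^2 * u\<close> and leaves two new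
  clauses, worth \<open>phi\<close> each.\<close>

lemma phi_sq_root: "t * u + t^2 * u * phi^2 = 1"
proof -
  have "t * u + t^2 * u * phi^2 = t * u + t^4 * u^3 + 2 * (t^6 * u^4) + t^8 * u^5"
    unfolding phi_def by (simp add: power2_eq_square algebra_simps power_numeral_reduce)
  then show ?thesis using root1 by simp
qed

end

section \<open>Counting minimal models by branching\<close>

text \<open>One step of the induction on the number of atoms. Since \<open>1 / t\<close> is tau and
  \<open>v\<close> is tau to the power \<open>-\<alpha>\<close>, \<open>IH\<close> is the
  strengthened bound for all smaller theories, with an arbitrary matching among their
  clauses.\<close>

locale branching = weights t u v for t u v +
  fixes T :: "'a clause set"
  assumes cnf: "cnf_theory 3 T"
    and IH: "\<And>(T' :: 'a clause set) K. cnf_theory 3 T' \<Longrightarrow> card (cnf_atoms T') < card (cnf_atoms T) \<Longrightarrow>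
      matching K \<Longrightarrow> K \<subseteq> T' \<Longrightarrow>
      real (card {M. cnf_minimal_model T' M}) \<le> (1 / t)^card (cnf_atoms T') * v^card K"
begin

section \<open>Shares of the target bound and states of a branch\<close>

abbreviation V :: "'a set" where "V \<equiv> cnf_atoms T"

abbreviation mm :: "'a set \<Rightarrow> bool" where "mm \<equiv> cnf_minimal_model T"

text \<open>\<open>x\<close> is the share that a branch takes of tau to the power \<open>n\<close>.
  A branching on a theory with matching \<open>K\<close> succeeds once its shares add up to at most
  \<open>v^card K\<close>.\<close>

definition bnd :: "('a set \<Rightarrow> bool) \<Rightarrow> real \<Rightarrow> bool" where
  "bnd P x \<longleftrightarrow> real (card {M. mm M \<and> P M}) \<le> (1 / t)^card V * x"

lemma fin_mm [simp]: "finite {M. mm M \<and> P M}"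
  using finite_minimal_models[OF cnf] by (rule rev_finite_subset) auto

lemma W_nonneg: "0 \<le> (1 / t)^card V"
  using t_pos by simp

lemma bnd_mono:
  assumes "bnd Q x" "\<And>M. mm M \<Longrightarrow> P M \<Longrightarrow> Q M" "x \<le> y"
  shows "bnd P y"
proof -
  have "card {M. mm M \<and> P M} \<le> card {M. mm M \<and> Q M}"
    using assms(2) by (intro card_mono) auto
  moreover have "(1 / t)^card V * x \<le> (1 / t)^card V * y"
    using assms(3) W_nonneg by (rule mult_left_mono)
  ultimately show ?thesis using assms(1) unfolding bnd_def by linarith
qed

lemma bnd_cases:
  assumes "bnd Q x" "bnd R y" "\<And>M. mm M \<Longrightarrow> P M \<Longrightarrow> Q M \<or> R M" "x + y \<le> z"
  shows "bnd P z"
proof -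
  have "card {M. mm M \<and> P M} \<le> card ({M. mm M \<and> Q M} \<union> {M. mm M \<and> R M})"
    using assms(3) by (intro card_mono) auto
  also have "\<dots> \<le> card {M. mm M \<and> Q M} + card {M. mm M \<and> R M}" by (rule card_Un_le)
  finally have "real (card {M. mm M \<and> P M}) \<le> (1 / t)^card V * (x + y)"
    using assms(1,2) unfolding bnd_def by (simp add: distrib_left)
  also have "\<dots> \<le> (1 / t)^card V * z" using assms(4) W_nonneg by (rule mult_left_mono)
  finally show ?thesis unfolding bnd_def .
qed

lemma bnd_empty:
  assumes "\<And>M. mm M \<Longrightarrow> \<not> P M" "0 \<le> x"
  shows "bnd P x"
proof -
  have "{M. mm M \<and> P M} = {}" using assms(1) by blast
  then show ?thesis unfolding bnd_def using assms(2) W_nonneg by (simp only: card.empty) simp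
qed

lemma bnd_UN:
  assumes "finite I" "\<And>i. i \<in> I \<Longrightarrow> bnd (P i) x" "\<And>M. mm M \<Longrightarrow> Q M \<Longrightarrow> \<exists>i\<in>I. P i M"
  shows "bnd Q (real (card I) * x)"
proof -
  have "card {M. mm M \<and> Q M} \<le> card (\<Union>i\<in>I. {M. mm M \<and> P i M})"
    using assms(1,3) by (intro card_mono) auto
  also have "\<dots> \<le> (\<Sum>i\<in>I. card {M. mm M \<and> P i M})"
    using assms(1) by (rule card_UN_le)
  finally have "real (card {M. mm M \<and> Q M}) \<le> (\<Sum>i\<in>I. real (card {M. mm M \<and> P i M}))"
    by (metis of_nat_mono of_nat_sum)
  also have "\<dots> \<le> (\<Sum>i\<in>I. (1 / t)^card V * x)"
    using assms(2) unfolding bnd_def by (intro sum_mono) auto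
  finally show ?thesis unfolding bnd_def by (simp add: mult.left_commute)
qed

text \<open>What is known in the branch \<open>P\<close>: fixed literals \<open>ls\<close> and a
  matching \<open>K\<close> of clauses on the remaining atoms. \<open>K\<close> may contain clauses
  that are not in \<open>T\<close>, because \<open>minimal_models_simplify\<close> adds
  them.\<close>

definition state :: "('a set \<Rightarrow> bool) \<Rightarrow> 'a literal list \<Rightarrow> 'a clause set \<Rightarrow> bool" where
  "state P ls K \<longleftrightarrow> matching K \<and> distinct (map atom_of ls) \<and> atom_of ` set ls \<subseteq> V \<and>
     (\<forall>C\<in>K. atom_of ` C \<subseteq> V - atom_of ` set ls) \<and>
     (\<forall>M. mm M \<longrightarrow> P M \<longrightarrow> (\<forall>l\<in>set ls. true_literal M l) \<and> (\<forall>C\<in>K. holds M C))"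

definition val :: "'a literal list \<Rightarrow> 'a clause set \<Rightarrow> real" where
  "val ls K = t^length ls * v^card K"

lemma val_pos: "0 < val ls K"
  using t_pos v_pos by (simp add: val_def)

lemma state_holds: "state P ls K \<Longrightarrow> C \<in> K \<Longrightarrow> mm M \<Longrightarrow> P M \<Longrightarrow> holds M C"
  by (auto simp: state_def)

text \<open>At least one fixed literal is required so that the induction hypothesis applies to the
  simplified theory. Atoms that disappear from it in addition only improve the bound, as
  \<open>1 / t > 1\<close>.\<close>

lemma state_bnd:
  assumes st: "state P ls K" and ne: "ls \<noteq> []"
  shows "bnd P (val ls K)"
proof -
  obtain T' where T': "cnf_theory 3 T'" "K \<subseteq> T'" "cnf_atoms T' \<subseteq> V - atom_of ` set ls"
    "card {M. mm M \<and> P M} \<le> card {M. cnf_minimal_model T' M}"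
    using st by (elim minimal_models_simplify[OF cnf, of K ls "{M. mm M \<and> P M}", rotated -1])
      (auto simp: state_def)
  have sub: "atom_of ` set ls \<subseteq> V" and dist: "distinct (map atom_of ls)" and K: "matching K"
    using st by (auto simp: state_def)
  have finV: "finite V" by (rule cnf_atoms_finite[OF cnf])
  have "card (atom_of ` set ls) = length ls"
    using distinct_card[OF dist] by simp
  then have "card (V - atom_of ` set ls) = card V - length ls" "length ls \<le> card V"
    using sub finV by (simp_all add: card_Diff_subset card_mono finite_subset) (metis card_mono)
  moreover have "card (cnf_atoms T') \<le> card (V - atom_of ` set ls)"
    using T'(3) finV by (intro card_mono) auto
  ultimately have le: "card (cnf_atoms T') + length ls \<le> card V" by linarith
  then have "card (cnf_atoms T') < card V" using ne by (cases ls) auto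
  then have "real (card {M. mm M \<and> P M}) \<le> (1 / t)^card (cnf_atoms T') * v^card K"
    using IH[OF T'(1) _ K T'(2)] T'(4) by linarith
  also have "\<dots> \<le> (1 / t)^(card V - length ls) * v^card K"
    using le t_pos t_upper v_pos by (intro mult_right_mono power_increasing) auto
  also have "(1 / t)^(card V - length ls) = (1 / t)^card V * t^length ls"
    using le t_pos by (simp add: power_diff power_divide)
  finally show ?thesis by (simp add: bnd_def val_def mult.assoc)
qed

lemma state_extend:
  assumes st: "state P ls K"
    and Q: "\<And>M. mm M \<Longrightarrow> Q M \<Longrightarrow> P M \<and> (\<forall>l\<in>set ms. true_literal M l)"
    and ms: "distinct (map atom_of ms)" "atom_of ` set ms \<subseteq> V - atom_of ` set ls"
  shows "state Q (ms @ ls) (K - touched K (atom_of ` set ms))"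
  unfolding state_def
proof (intro conjI)
  show "matching (K - touched K (atom_of ` set ms))"
    using st matching_subset[of K] by (auto simp: state_def)
  show "distinct (map atom_of (ms @ ls))" using st ms by (auto simp: state_def)
  show "atom_of ` set (ms @ ls) \<subseteq> V" using st ms by (auto simp: state_def)
  show "\<forall>C\<in>K - touched K (atom_of ` set ms). atom_of ` C \<subseteq> V - atom_of ` set (ms @ ls)"
  proof
    fix C assume "C \<in> K - touched K (atom_of ` set ms)"
    then have "atom_of ` C \<subseteq> V - atom_of ` set ls" "atom_of ` C \<inter> atom_of ` set ms = {}"
      using st by (auto simp: state_def touched_def)
    then show "atom_of ` C \<subseteq> V - atom_of ` set (ms @ ls)" by auto
  qed
  show "\<forall>M. mm M \<longrightarrow> Q M \<longrightarrow> (\<forall>l\<in>set (ms @ ls). true_literal M l) \<and>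
      (\<forall>C\<in>K - touched K (atom_of ` set ms). holds M C)"
    using st Q unfolding state_def by auto
qed

text \<open>At most \<open>j\<close> matching clauses are lost, and \<open>u * v = 1\<close> turns
  each loss into a factor \<open>u\<close>; overestimating the loss is harmless because
  \<open>v < 1\<close>.\<close>

lemma val_extend:
  assumes "finite K" "card (touched K X) \<le> j"
  shows "val (ms @ ls) (K - touched K X) \<le> t^length ms * u^j * val ls K"
proof -
  have "card K \<le> card (K - touched K X) + j"
    using assms card_Diff_subset[of "touched K X" K] touched_subset[of K X]
    by (simp add: finite_subset)
  then obtain i where i: "card (K - touched K X) + j = card K + i"
    using le_Suc_ex by (metis add.commute)
  have "v^card (K - touched K X) = v^card (K - touched K X) * (u * v)^j" by (simp add: uv)
  also have "\<dots> = u^j * v^(card K + i)"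
    by (simp add: power_mult_distrib i[symmetric] power_add mult_ac)
  also have "\<dots> \<le> u^j * v^card K"
    using v_pos v_upper u_pos by (intro mult_left_mono power_decreasing) auto
  finally have "t^(length ms + length ls) * v^card (K - touched K X)
      \<le> t^(length ms + length ls) * (u^j * v^card K)"
    using t_pos by (intro mult_left_mono) auto
  then show ?thesis by (simp add: val_def power_add mult_ac)
qed

lemma bnd_extend:
  assumes st: "state P ls K"
    and Q: "\<And>M. mm M \<Longrightarrow> Q M \<Longrightarrow> P M \<and> (\<forall>l\<in>set ms. true_literal M l)"
    and ms: "distinct (map atom_of ms)" "atom_of ` set ms \<subseteq> V - atom_of ` set ls" "ms \<noteq> []"
    and j: "card (touched K (atom_of ` set ms)) \<le> j"
  shows "bnd Q (t^length ms * u^j * val ls K)"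
proof -
  have "finite K" using st by (auto simp: state_def matching_def)
  then show ?thesis
    using state_bnd[OF state_extend[OF st Q ms(1,2)]] ms(3) val_extend[OF _ j]
    by (auto intro: bnd_mono)
qed

lemma state_insert:
  assumes st: "state P ls K" and D: "two_clause D" "atom_of ` D \<subseteq> V - atom_of ` set ls"
    "touched K (atom_of ` D) = {}" "\<And>M. mm M \<Longrightarrow> P M \<Longrightarrow> holds M D"
  shows "state P ls (insert D K)" and "val ls (insert D K) = v * val ls K"
proof -
  have fin: "finite K" using st by (auto simp: state_def matching_def)
  have dis: "atom_of ` C \<inter> atom_of ` D = {}" if "C \<in> K" for C
    using D(3) that by (auto simp: touched_def)
  have "matching (insert D K)"
    using st D(1) fin dis unfolding state_def matching_def by (auto simp: Int_commute)
  then show "state P ls (insert D K)"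
    using st D unfolding state_def by auto
  have "D \<notin> K" using dis[of D] D(1) by (auto simp: two_clause_def)
  then show "val ls (insert D K) = v * val ls K" using fin by (simp add: val_def)
qed

text \<open>In contrast to the clauses of a state, \<open>D\<close> may share atoms with
  \<open>K\<close>. The lemmas below determine what such a clause still gains.\<close>

definition new_clause :: "('a set \<Rightarrow> bool) \<Rightarrow> 'a literal list \<Rightarrow> 'a clause set \<Rightarrow> 'a clause \<Rightarrow> bool" where
  "new_clause P ls K D \<longleftrightarrow> two_clause D \<and> atom_of ` D \<subseteq> V - atom_of ` set ls \<and> D \<notin> K \<and>
     (\<forall>M. mm M \<longrightarrow> P M \<longrightarrow> holds M D)"

text \<open>Branch on the common literal \<open>x\<close>. If it is false, \<open>y\<close> and
  \<open>z\<close> are both forced, and the three fixed atoms touch at most two clauses of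
  \<open>K\<close>, since two of them lie in \<open>{x, z}\<close>.\<close>

lemma same_clash:
  assumes st: "state P ls K" and E: "{x, z} \<in> K" and D: "new_clause P ls K {x, y}"
  shows "bnd P (phi * val ls K)"
proof -
  have K: "matching K" and EV: "atom_of x \<in> V - atom_of ` set ls" "atom_of z \<in> V - atom_of ` set ls"
    using st E by (auto simp: state_def)
  have xz: "atom_of x \<noteq> atom_of z" using K E by (auto simp: matching_def)
  have yV: "atom_of y \<in> V - atom_of ` set ls" and xy: "atom_of x \<noteq> atom_of y" "y \<noteq> z"
    using D E by (auto simp: new_clause_def)
  have xyM: "true_literal M x \<or> true_literal M y" "true_literal M x \<or> true_literal M z"
    if "mm M" "P M" for M
    using D state_holds[OF st E] that by (auto simp: new_clause_def)
  have 1: "bnd (\<lambda>M. P M \<and> true_literal M x) (t^length [x] * u^1 * val ls K)"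
    using EV card_touched_le[OF K, of "{atom_of x}"] by (intro bnd_extend[OF st]) auto
  have 2: "bnd (\<lambda>M. P M \<and> \<not> true_literal M x) (t^3 * u^2 * val ls K)"
  proof (cases "atom_of y = atom_of z")
    case True
    then have "y = flip z" using xy by (simp add: atom_of_eq_iff)
    then show ?thesis using xyM t_pos u_pos val_pos[of ls K] by (intro bnd_empty) auto
  next
    case False
    have "card (touched K {atom_of x, atom_of y, atom_of z}) \<le> 1 + card {atom_of y}"
      by (rule card_touched_clause_le[OF K E]) auto
    then have "bnd (\<lambda>M. P M \<and> \<not> true_literal M x) (t^length [flip x, y, z] * u^2 * val ls K)"
      using EV yV False xy xz xyM by (intro bnd_extend[OF st]) auto
    then show ?thesis by (simp add: eval_nat_numeral)
  qed
  show ?thesis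
    by (rule bnd_cases[OF 1 2]) (auto simp: phi_def algebra_simps)
qed

text \<open>Either value of \<open>x\<close> forces a second literal, so this clash is very
  favourable: by \<open>opposite_clash_le\<close> the factor is even below
  \<open>phi^2\<close>.\<close>

lemma opposite_clash:
  assumes st: "state P ls K" and E: "{flip x, z} \<in> K" and D: "new_clause P ls K {x, y}"
  shows "bnd P ((t^2 * u + t^2 * u^2) * val ls K)"
proof -
  have K: "matching K" and EV: "atom_of x \<in> V - atom_of ` set ls" "atom_of z \<in> V - atom_of ` set ls"
    using st E by (auto simp: state_def)
  have xz: "atom_of x \<noteq> atom_of z" using K E by (auto simp: matching_def)
  have yV: "atom_of y \<in> V - atom_of ` set ls" and xy: "atom_of x \<noteq> atom_of y"
    using D E by (auto simp: new_clause_def)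
  have xyM: "true_literal M x \<or> true_literal M y" "\<not> true_literal M x \<or> true_literal M z"
    if "mm M" "P M" for M
    using D state_holds[OF st E] that by (auto simp: new_clause_def)
  have "card (touched K {atom_of x, atom_of z}) \<le> 1 + card ({} :: 'a set)"
    by (rule card_touched_clause_le[OF K E]) auto
  then have "bnd (\<lambda>M. P M \<and> true_literal M x) (t^length [x, z] * u^1 * val ls K)"
    using EV xz xyM by (intro bnd_extend[OF st]) auto
  then have 1: "bnd (\<lambda>M. P M \<and> true_literal M x) (t^2 * u * val ls K)"
    by (simp add: eval_nat_numeral)
  have "bnd (\<lambda>M. P M \<and> \<not> true_literal M x) (t^length [flip x, y] * u^2 * val ls K)"
    using EV yV xy xyM card_touched_le[OF K, of "{atom_of x, atom_of y}"]
    by (intro bnd_extend[OF st]) auto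
  then have 2: "bnd (\<lambda>M. P M \<and> \<not> true_literal M x) (t^2 * u^2 * val ls K)"
    by (simp add: eval_nat_numeral)
  show ?thesis
    by (rule bnd_cases[OF 1 2]) (auto simp: algebra_simps)
qed

lemma opposite_clash_le: "t^2 * u + t^2 * u^2 < 0.8534"
  using tu_le[of 2 1] tu_le[of 2 2] by (simp add: power_numeral_reduce)

lemma clash_cases:
  assumes K: "matching K" and x: "E \<in> K" "atom_of x \<in> atom_of ` E"
  obtains z where "E = {x, z}" | z where "E = {flip x, z}"
proof -
  have "two_clause E" using K x by (auto simp: matching_def)
  then obtain w z where "E = {w, z}" "atom_of w = atom_of x"
    using x(2) by (rule two_clauseE_at)
  then show thesis using that atom_of_eq_iff[of w x] by blast
qed

text \<open>If \<open>D\<close> avoids \<open>K\<close>, it joins the matching and gains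
  \<open>v\<close>, which is smaller than \<open>phi\<close>. Otherwise one of the two kinds of
  clash applies.\<close>

lemma one_new_clause:
  assumes st: "state P ls K" and ne: "ls \<noteq> []" and D: "new_clause P ls K D"
  shows "bnd P (phi * val ls K)"
proof (cases "touched K (atom_of ` D) = {}")
  case True
  have "bnd P (v * val ls K)"
    using state_insert[OF st, of D] state_bnd[of P ls "insert D K"] ne D True
    by (auto simp: new_clause_def)
  then show ?thesis
    using v_upper phi_lower val_pos[of ls K] by (elim bnd_mono) auto
next
  case False
  then obtain E a where E: "E \<in> K" "a \<in> atom_of ` E" "a \<in> atom_of ` D" by (auto simp: touched_def)
  have K: "matching K" using st by (auto simp: state_def)
  have "two_clause D" using D by (auto simp: new_clause_def)
  then obtain x y where xy: "D = {x, y}" "atom_of x = a" using E(3) by (rule two_clauseE_at)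
  have "atom_of x \<in> atom_of ` E" using xy E by simp
  with K E(1) show ?thesis
  proof (cases rule: clash_cases)
    case (1 z)
    then show ?thesis using same_clash[OF st] E(1) D xy by blast
  next
    case (2 z)
    then have "bnd P ((t^2 * u + t^2 * u^2) * val ls K)" using opposite_clash[OF st] E(1) D xy by blast
    then show ?thesis
      using opposite_clash_le phi_lower val_pos[of ls K] by (elim bnd_mono) auto
  qed
qed


section \<open>Two new 2-clauses against a matching\<close>

lemma bnd_le_phi_sq:
  assumes "bnd P (x * val ls K)" "x \<le> 0.8534"
  shows "bnd P (phi^2 * val ls K)"
  using assms phi_sq_lower val_pos[of ls K] by (elim bnd_mono) auto

lemma opposite_clash_phi_sq:
  assumes "state P ls K" "{flip x, z} \<in> K" "new_clause P ls K {x, y}"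
  shows "bnd P (phi^2 * val ls K)"
  using opposite_clash[OF assms] opposite_clash_le by (auto intro: bnd_le_phi_sq less_imp_le)

lemma phi_sq_eq: "phi * (t * u) + phi * (t^3 * u^2) = phi^2"
  by (simp add: phi_def power2_eq_square algebra_simps)

text \<open>The cost of a recurring branching below \<open>phi^2\<close>: one literal is fixed and a
  new clause survives, or three literals are fixed at the loss of a single matching clause.\<close>

lemma half_phi_le: "phi * (t * u) + t^3 * u \<le> 0.8534"
proof -
  have "phi * (t * u) \<le> 0.9242 * (0.59877 * 1.1053)"
    using phi_upper phi_lower t_upper u_upper t_pos u_pos by (intro mult_mono) auto
  then show ?thesis using tu_le[of 3 1] by (simp add: power_numeral_reduce)
qed

lemma new_clause_extend:
  assumes D: "new_clause P ls K D" and Q: "\<And>M. mm M \<Longrightarrow> Q M \<Longrightarrow> P M"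
    and ms: "atom_of ` D \<inter> atom_of ` set ms = {}" and K': "K' \<subseteq> K"
  shows "new_clause Q (ms @ ls) K' D"
  using assms unfolding new_clause_def by fastforce

lemma one_new_clause_extend:
  assumes st: "state P ls K"
    and Q: "\<And>M. mm M \<Longrightarrow> Q M \<Longrightarrow> P M \<and> (\<forall>l\<in>set ms. true_literal M l)"
    and ms: "distinct (map atom_of ms)" "atom_of ` set ms \<subseteq> V - atom_of ` set ls" "ms \<noteq> []"
    and j: "card (touched K (atom_of ` set ms)) \<le> j"
    and D: "new_clause P ls K D" "atom_of ` D \<inter> atom_of ` set ms = {}"
  shows "bnd Q (phi * (t^length ms * u^j) * val ls K)"
proof -
  have fin: "finite K" using st by (auto simp: state_def matching_def)
  have "bnd Q (phi * val (ms @ ls) (K - touched K (atom_of ` set ms)))"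
  proof (rule one_new_clause[OF state_extend[OF st Q ms(1,2)]])
    show "new_clause Q (ms @ ls) (K - touched K (atom_of ` set ms)) D"
      using Q by (intro new_clause_extend[OF D(1) _ D(2)]) auto
  qed (use ms(3) in auto)
  moreover have "phi * val (ms @ ls) (K - touched K (atom_of ` set ms))
      \<le> phi * (t^length ms * u^j * val ls K)"
    using val_extend[OF fin j] phi_lower by (intro mult_left_mono) auto
  ultimately show ?thesis by (auto intro: bnd_mono simp: mult_ac)
qed

text \<open>\<open>D\<close> joins the matching with gain \<open>v \<le> phi\<close>;
  \<open>D'\<close> is then handled as a single new clause against the enlarged matching.\<close>

lemma two_new_clauses_untouched:
  assumes st: "state P ls K" and ne: "ls \<noteq> []"
    and D: "new_clause P ls K D" and D': "new_clause P ls K D'" and "D \<noteq> D'"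
    and un: "touched K (atom_of ` D) = {}"
  shows "bnd P (phi^2 * val ls K)"
proof -
  have ins: "state P ls (insert D K)" "val ls (insert D K) = v * val ls K"
    using state_insert[OF st, of D] D un by (auto simp: new_clause_def)
  have "new_clause P ls (insert D K) D'" using D' \<open>D \<noteq> D'\<close> by (auto simp: new_clause_def)
  then have "bnd P (phi * (v * val ls K))" using one_new_clause[OF ins(1) ne] ins(2) by simp
  moreover have "phi * v \<le> phi^2" using phi_lower v_upper by (simp add: power2_eq_square)
  ultimately show ?thesis
    using val_pos[of ls K] by (elim bnd_mono) (auto simp: mult.assoc[symmetric] intro!: mult_right_mono)
qed

text \<open>The shared literal \<open>x\<close> is a good branching literal: if it is false,
  \<open>y\<close> and \<open>y'\<close> are both true. The cases say how \<open>x\<close> and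
  \<open>y\<close> lie in \<open>K\<close>.\<close>

lemma two_new_clauses_share:
  assumes st: "state P ls K" and ne: "ls \<noteq> []"
    and D: "new_clause P ls K {x, y}" and D': "new_clause P ls K {x, y'}" and "y \<noteq> y'"
  shows "bnd P (phi^2 * val ls K)"
proof -
  have K: "matching K" using st by (auto simp: state_def)
  have V: "atom_of x \<in> V - atom_of ` set ls" "atom_of y \<in> V - atom_of ` set ls"
    "atom_of y' \<in> V - atom_of ` set ls" "atom_of x \<noteq> atom_of y" "atom_of x \<noteq> atom_of y'"
    using D D' by (auto simp: new_clause_def)
  have M: "true_literal M x \<or> true_literal M y" "true_literal M x \<or> true_literal M y'"
    if "mm M" "P M" for M
    using D D' that by (auto simp: new_clause_def)
  have x1: "bnd (\<lambda>M. P M \<and> true_literal M x) (t^length [x] * u^1 * val ls K)"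
    using V card_touched_le[OF K, of "{atom_of x}"] by (intro bnd_extend[OF st]) auto
  show ?thesis
  proof (cases "atom_of y = atom_of y'")
    case True
    then have "y = flip y'" using \<open>y \<noteq> y'\<close> by (simp add: atom_of_eq_iff)
    then have "bnd P (t * u * val ls K)" using M by (intro bnd_mono[OF x1]) auto
    then show ?thesis using tu_le[of 1 1] by (elim bnd_le_phi_sq) auto
  next
    case yy': False
    show ?thesis
    proof (cases "touched K {atom_of x} = {}")
      case False
      then obtain E where E: "E \<in> K" "atom_of x \<in> atom_of ` E" by (auto simp: touched_def)
      from K E show ?thesis
      proof (cases rule: clash_cases)
        case (2 z)
        then show ?thesis
          using opposite_clash_phi_sq[OF st _ D] E by auto
      next
        case (1 z)
        then have Ez: "{x, z} \<in> K" using E by simp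
        then have z: "atom_of z \<in> V - atom_of ` set ls" "atom_of x \<noteq> atom_of z"
          using st K by (auto simp: state_def matching_def)
        have Mz: "true_literal M x \<or> true_literal M z" if "mm M" "P M" for M
          using state_holds[OF st Ez] that by auto
        have zy: "z \<noteq> y" "z \<noteq> y'" using Ez D D' by (auto simp: new_clause_def)
        have "bnd (\<lambda>M. P M \<and> \<not> true_literal M x) (t^4 * u^3 * val ls K)"
        proof (cases "atom_of z = atom_of y \<or> atom_of z = atom_of y'")
          case True
          then have "z = flip y \<or> z = flip y'" using zy by (simp add: atom_of_eq_iff)
          then show ?thesis
            using M Mz t_pos u_pos val_pos[of ls K] by (intro bnd_empty) (metis true_literal_flip, simp)
        next
          case False
          have "card (touched K {atom_of x, atom_of y, atom_of y', atom_of z})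
              \<le> 1 + card {atom_of y, atom_of y'}"
            by (rule card_touched_clause_le[OF K Ez]) auto
          then have "bnd (\<lambda>M. P M \<and> \<not> true_literal M x)
              (t^length [flip x, y, y', z] * u^3 * val ls K)"
            using V z False yy' M Mz by (intro bnd_extend[OF st]) auto
          then show ?thesis by (simp add: eval_nat_numeral)
        qed
        from x1 this have "bnd P ((t * u + t^4 * u^3) * val ls K)"
          by (rule bnd_cases) (auto simp: algebra_simps)
        then show ?thesis
          using tu_le[of 1 1] tu_le[of 4 3]
          by (elim bnd_le_phi_sq) (auto simp: power_numeral_reduce)
      qed
    next
      case xun: True
      show ?thesis
      proof (cases "touched K {atom_of y} = {}")
        case True
        then have "touched K (atom_of ` {x, y}) = {}" using xun by (auto simp: touched_def)
        moreover have "{x, y} \<noteq> {x, y'}" using \<open>y \<noteq> y'\<close> V by (auto simp: doubleton_eq_iff)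
        ultimately show ?thesis using two_new_clauses_untouched[OF st ne D D'] by blast
      next
        case False
        then obtain E where E: "E \<in> K" "atom_of y \<in> atom_of ` E" by (auto simp: touched_def)
        have Dc: "new_clause P ls K {y, x}" using D by (simp add: insert_commute)
        from K E show ?thesis
        proof (cases rule: clash_cases)
          case (2 z)
          then show ?thesis
            using opposite_clash_phi_sq[OF st _ Dc] E by auto
        next
          case (1 z)
          then have Ez: "{y, z} \<in> K" using E by simp
          then have z: "atom_of z \<in> V - atom_of ` set ls" "atom_of y \<noteq> atom_of z"
            using st K by (auto simp: state_def matching_def)
          have zx: "atom_of z \<noteq> atom_of x" using Ez xun by (auto simp: touched_def)
          have Mz: "true_literal M y \<or> true_literal M z" if "mm M" "P M" for M
            using state_holds[OF st Ez] that by auto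
          \<comment> \<open>Branching is on \<open>y\<close> here. If it is true,
            \<open>{x, y'}\<close> survives as a new clause; if it is false, \<open>x\<close> and
            \<open>z\<close> are forced, and only \<open>{y, z}\<close> is lost because
            \<open>x\<close> is untouched.\<close>
          have "bnd (\<lambda>M. P M \<and> true_literal M y) (phi * (t^length [y] * u^1) * val ls K)"
            using V yy' D' card_touched_le[OF K, of "{atom_of y}"]
            by (intro one_new_clause_extend[OF st]) auto
          moreover have "bnd (\<lambda>M. P M \<and> \<not> true_literal M y) (t^3 * u * val ls K)"
          proof -
            have "touched K {atom_of y, atom_of x, atom_of z} \<subseteq> {E}"
            proof -
              have "touched K {atom_of y, atom_of x, atom_of z} = touched K {atom_of y, atom_of z}"
                using xun by (auto simp: touched_def)
              then show ?thesis
                using touched_clause[OF K E(1), of "{atom_of y, atom_of z}"] 1 by auto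
            qed
            then have "card (touched K {atom_of y, atom_of x, atom_of z}) \<le> 1"
              using card_mono[of "{E}"] by fastforce
            then have "bnd (\<lambda>M. P M \<and> \<not> true_literal M y) (t^length [flip y, x, z] * u^1 * val ls K)"
              using V z zx M Mz by (intro bnd_extend[OF st]) auto
            then show ?thesis by (simp add: eval_nat_numeral)
          qed
          ultimately have "bnd P ((phi * (t * u) + t^3 * u) * val ls K)"
            by (rule bnd_cases) (auto simp: algebra_simps)
          then show ?thesis using half_phi_le by (rule bnd_le_phi_sq)
        qed
      qed
    qed
  qed
qed

text \<open>Both values of \<open>x\<close> force a second literal. If \<open>x\<close> is
  untouched, each branch loses at most one matching clause; otherwise one of the two new clauses has
  an opposite clash with \<open>K\<close>.\<close>

lemma two_new_clauses_share_opposite: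
  assumes st: "state P ls K" and D: "new_clause P ls K {x, y}" and D': "new_clause P ls K {flip x, y'}"
  shows "bnd P (phi^2 * val ls K)"
proof -
  have K: "matching K" using st by (auto simp: state_def)
  have V: "atom_of x \<in> V - atom_of ` set ls" "atom_of y \<in> V - atom_of ` set ls"
    "atom_of y' \<in> V - atom_of ` set ls" "atom_of x \<noteq> atom_of y" "atom_of x \<noteq> atom_of y'"
    using D D' by (auto simp: new_clause_def)
  have M: "true_literal M x \<or> true_literal M y" "\<not> true_literal M x \<or> true_literal M y'"
    if "mm M" "P M" for M
    using D D' that by (auto simp: new_clause_def)
  show ?thesis
  proof (cases "touched K {atom_of x} = {}")
    case False
    then obtain E where E: "E \<in> K" "atom_of x \<in> atom_of ` E" by (auto simp: touched_def)
    from K E show ?thesis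
    proof (cases rule: clash_cases)
      case (2 z)
      then show ?thesis
        using opposite_clash_phi_sq[OF st _ D] E by auto
    next
      case (1 z)
      then show ?thesis
        using opposite_clash[OF st _ D', of z] E opposite_clash_le by (intro bnd_le_phi_sq) auto
    qed
  next
    case True
    then have "touched K {atom_of x, w} = touched K {w}" for w by (auto simp: touched_def)
    then have card1: "card (touched K {atom_of x, w}) \<le> 1" for w
      using card_touched_le[OF K, of "{w}"] by simp
    have "bnd (\<lambda>M. P M \<and> true_literal M x) (t^length [x, y'] * u^1 * val ls K)"
      using V M card1 by (intro bnd_extend[OF st]) auto
    moreover have "bnd (\<lambda>M. P M \<and> \<not> true_literal M x) (t^length [flip x, y] * u^1 * val ls K)"
      using V M card1 by (intro bnd_extend[OF st]) auto
    ultimately have "bnd P (2 * (t^2 * u) * val ls K)"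
      by (rule bnd_cases) (auto simp: power2_eq_square)
    then show ?thesis
      using tu_le[of 2 1] by (elim bnd_le_phi_sq) (auto simp: power_numeral_reduce)
  qed
qed

text \<open>Branch on \<open>x\<close>. With \<open>x\<close> true, \<open>D'\<close> survives. With
  \<open>x\<close> false, \<open>y\<close> and \<open>z\<close> are forced; then either
  \<open>y\<close> is untouched and just one clause is lost, or \<open>D'\<close> avoids
  \<open>z\<close> and survives again. The last assumption excludes exactly what leads to a
  4-cycle.\<close>

lemma two_new_clauses_disjoint:
  assumes st: "state P ls K"
    and D: "new_clause P ls K {x, y}" and D': "new_clause P ls K D'"
    and dis: "atom_of ` {x, y} \<inter> atom_of ` D' = {}" and Ez: "{x, z} \<in> K"
    and yz: "touched K {atom_of y} = {} \<or> atom_of z \<notin> atom_of ` D'"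
  shows "bnd P (phi^2 * val ls K)"
proof -
  have K: "matching K" using st by (auto simp: state_def)
  have V: "atom_of x \<in> V - atom_of ` set ls" "atom_of y \<in> V - atom_of ` set ls"
    "atom_of x \<noteq> atom_of y"
    using D by (auto simp: new_clause_def)
  have z: "atom_of z \<in> V - atom_of ` set ls" "atom_of x \<noteq> atom_of z"
    using st K Ez by (auto simp: state_def matching_def)
  have M: "true_literal M x \<or> true_literal M y" "true_literal M x \<or> true_literal M z"
    if "mm M" "P M" for M
    using D state_holds[OF st Ez] that by (auto simp: new_clause_def)
  have zy: "z \<noteq> y" using D Ez by (auto simp: new_clause_def)
  have x1: "bnd (\<lambda>M. P M \<and> true_literal M x) (phi * (t^length [x] * u^1) * val ls K)"
    using V dis card_touched_le[OF K, of "{atom_of x}"]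
    by (intro one_new_clause_extend[OF st _ _ _ _ _ D']) auto
  show ?thesis
  proof (cases "atom_of y = atom_of z")
    case True
    then have "y = flip z" using zy by (simp add: atom_of_eq_iff)
    then have "bnd P (phi * (t * u) * val ls K)" using M by (intro bnd_mono[OF x1]) auto
    moreover have "0 < t^3 * u" using t_pos u_pos by simp
    ultimately show ?thesis using half_phi_le by (elim bnd_le_phi_sq) linarith
  next
    case ne: False
    show ?thesis
    proof (cases "touched K {atom_of y} = {}")
      case True
      then have "touched K {atom_of x, atom_of y, atom_of z} = touched K {atom_of x, atom_of z}"
        by (auto simp: touched_def)
      then have "touched K {atom_of x, atom_of y, atom_of z} \<subseteq> {{x, z}}"
        using touched_clause[OF K Ez, of "{atom_of x, atom_of z}"] by auto
      then have "card (touched K {atom_of x, atom_of y, atom_of z}) \<le> 1"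
        using card_mono[of "{{x, z}}"] by fastforce
      then have "bnd (\<lambda>M. P M \<and> \<not> true_literal M x) (t^length [flip x, y, z] * u^1 * val ls K)"
        using V z ne M by (intro bnd_extend[OF st]) auto
      then have "bnd (\<lambda>M. P M \<and> \<not> true_literal M x) (t^3 * u * val ls K)"
        by (simp add: eval_nat_numeral)
      from x1 this have "bnd P ((phi * (t * u) + t^3 * u) * val ls K)"
        by (rule bnd_cases) (auto simp: algebra_simps)
      then show ?thesis using half_phi_le by (rule bnd_le_phi_sq)
    next
      case False
      have "card (touched K {atom_of x, atom_of y, atom_of z}) \<le> 1 + card {atom_of y}"
        by (rule card_touched_clause_le[OF K Ez]) auto
      then have "bnd (\<lambda>M. P M \<and> \<not> true_literal M x)
          (phi * (t^length [flip x, y, z] * u^2) * val ls K)"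
        using V z ne M dis yz False by (intro one_new_clause_extend[OF st _ _ _ _ _ D']) auto
      then have "bnd (\<lambda>M. P M \<and> \<not> true_literal M x) (phi * (t^3 * u^2) * val ls K)"
        by (simp add: eval_nat_numeral)
      from x1 this have "bnd P ((phi * (t * u) + phi * (t^3 * u^2)) * val ls K)"
        by (rule bnd_cases) (auto simp: algebra_simps)
      then show ?thesis by (simp only: phi_sq_eq)
    qed
  qed
qed

text \<open>
  The exceptional configuration is a 4-cycle of 2-clauses; there branching only gives a factor that
  is slightly larger than \<open>phi\<^sup>2\<close>.
\<close>

lemma two_new_clauses:
  assumes st: "state P ls K" and ne: "ls \<noteq> []"
    and D: "new_clause P ls K D" and D': "new_clause P ls K D'" and DD': "D \<noteq> D'"
  shows "bnd P (phi^2 * val ls K) \<or>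
    (\<exists>x y z w. D = {x, y} \<and> D' = {z, w} \<and> {x, z} \<in> K \<and> {y, w} \<in> K)"
proof (cases "bnd P (phi^2 * val ls K)")
  case no: False
  have K: "matching K" using st by (auto simp: state_def)
  have two: "two_clause D" "two_clause D'" using D D' by (auto simp: new_clause_def)
  \<comment> \<open>A touched literal of a new clause meets \<open>K\<close> with the same sign,
    since an opposite clash already gives \<open>phi^2\<close>.\<close>
  have partner: "\<exists>z. {x, z} \<in> K"
    if F: "new_clause P ls K {x, y}" and tx: "touched K {atom_of x} \<noteq> {}" for x y
  proof -
    obtain E where E: "E \<in> K" "atom_of x \<in> atom_of ` E" using tx by (auto simp: touched_def)
    from K E show ?thesis
    proof (cases rule: clash_cases)
      case (2 z)
      then show ?thesis
        using opposite_clash_phi_sq[OF st _ F] E no by auto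
    qed (use E in blast)
  qed
  have dis: "atom_of ` D \<inter> atom_of ` D' = {}"
  proof (rule ccontr)
    assume "atom_of ` D \<inter> atom_of ` D' \<noteq> {}"
    then obtain a where a: "a \<in> atom_of ` D" "a \<in> atom_of ` D'" by blast
    obtain x y where x: "D = {x, y}" "atom_of x = a"
      by (rule two_clauseE_at[OF two(1) a(1)])
    obtain x' y' where x': "D' = {x', y'}" "atom_of x' = a"
      by (rule two_clauseE_at[OF two(2) a(2)])
    have "x' = x \<or> x' = flip x" using x(2) x'(2) atom_of_eq_iff[of x' x] by simp
    then show False
      using two_new_clauses_share[OF st ne, of x y y'] two_new_clauses_share_opposite[OF st, of x y y']
        D D' DD' x(1) x'(1) no by auto
  qed
  have "touched K (atom_of ` D) \<noteq> {}"
    using two_new_clauses_untouched[OF st ne D D' DD'] no by blast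
  then obtain a where a: "a \<in> atom_of ` D" "touched K {a} \<noteq> {}" by (auto simp: touched_def)
  obtain x y where xy: "D = {x, y}" "atom_of x = a"
    by (rule two_clauseE_at[OF two(1) a(1)])
  obtain z where z: "{x, z} \<in> K" using partner[of x y] D xy a(2) by auto
  have yt: "touched K {atom_of y} \<noteq> {}" and zD': "atom_of z \<in> atom_of ` D'"
    using two_new_clauses_disjoint[OF st _ D', of x y z] D xy z dis no by auto
  have D2: "new_clause P ls K {y, x}" using D xy by (simp add: insert_commute)
  obtain w where w: "{y, w} \<in> K" using partner[OF D2 yt] by blast
  have wD': "atom_of w \<in> atom_of ` D'"
    using two_new_clauses_disjoint[OF st D2 D' _ w] xy dis no by (auto simp: insert_commute)
  \<comment> \<open>Otherwise the clauses of \<open>K\<close> at \<open>x\<close> and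
    \<open>y\<close> coincide and equal \<open>D\<close>, which is not in \<open>K\<close>.\<close>
  have zw: "atom_of z \<noteq> atom_of w"
  proof
    assume "atom_of z = atom_of w"
    then have "{x, z} = {y, w}" using K z w unfolding matching_def by fastforce
    then have "D \<in> K" using z xy D by (auto simp: doubleton_eq_iff new_clause_def)
    then show False using D by (simp add: new_clause_def)
  qed
  \<comment> \<open>The partners \<open>z\<close> and \<open>w\<close> occur in \<open>D'\<close>
    with the same sign, again because an opposite clash is excluded.\<close>
  have same: "c \<in> D'" if c: "atom_of c \<in> atom_of ` D'" "{b, c} \<in> K" for b c
  proof -
    obtain p q where p: "D' = {p, q}" "atom_of p = atom_of c"
      by (rule two_clauseE_at[OF two(2) c(1)])
    have "p \<noteq> flip c"
    proof
      assume "p = flip c"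
      then have "{flip p, b} \<in> K" using c(2) by (simp add: insert_commute)
      then show False using opposite_clash_phi_sq[OF st _ D'[unfolded p(1)]] no by blast
    qed
    then have "p = c" using p(2) atom_of_eq_iff[of p c] by blast
    then show ?thesis using p(1) by simp
  qed
  have "z \<in> D'" "w \<in> D'" using same zD' wD' z w by blast+
  moreover obtain p q where "D' = {p, q}" by (rule two_clauseE[OF two(2)])
  ultimately have "D' = {z, w}" using zw by auto
  then show ?thesis using xy z w by blast
qed simp


section \<open>Four-cycles, forced literals and overlapping implied clauses\<close>

lemma val_Nil [simp]: "val [] K = v^card K"
  by (simp add: val_def)

text \<open>Satisfying all four clauses of the cycle makes one of the diagonal pairs
  \<open>x, w\<close> and \<open>y, z\<close> true. The factor is about 0.876, whereas
  \<open>phi^2\<close> is about 0.854.\<close>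

lemma four_cycle:
  assumes st: "state P ls K" and D: "new_clause P ls K {x, y}" "new_clause P ls K {z, w}"
    and E: "{x, z} \<in> K" "{y, w} \<in> K"
  shows "bnd P (2 * (t^2 * u^2) * val ls K)"
proof -
  have K: "matching K" using st by (auto simp: state_def)
  have "{x, z} \<noteq> {y, w}" using D E by (auto simp: doubleton_eq_iff new_clause_def)
  then have ne: "atom_of x \<noteq> atom_of w" "atom_of y \<noteq> atom_of z"
    using K E unfolding matching_def by fastforce+
  have V: "atom_of x \<in> V - atom_of ` set ls" "atom_of y \<in> V - atom_of ` set ls"
    "atom_of z \<in> V - atom_of ` set ls" "atom_of w \<in> V - atom_of ` set ls"
    using D by (auto simp: new_clause_def)
  have M: "(true_literal M x \<and> true_literal M w) \<or> (true_literal M y \<and> true_literal M z)"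
    if "mm M" "P M" for M
    using D state_holds[OF st E(1)] state_holds[OF st E(2)] that by (auto simp: new_clause_def)
  have "bnd (\<lambda>M. P M \<and> true_literal M x \<and> true_literal M w) (t^length [x, w] * u^2 * val ls K)"
    using V ne card_touched_le[OF K, of "{atom_of x, atom_of w}"] by (intro bnd_extend[OF st]) auto
  moreover have "bnd (\<lambda>M. P M \<and> true_literal M y \<and> true_literal M z) (t^length [y, z] * u^2 * val ls K)"
    using V ne card_touched_le[OF K, of "{atom_of y, atom_of z}"] by (intro bnd_extend[OF st]) auto
  ultimately show ?thesis
    by (rule bnd_cases) (use M in blast, simp add: power2_eq_square)
qed

text \<open>Covers consequences that are not clauses of \<open>T\<close>, such as a resolvent of a
  2-clause and a 3-clause; these are used in \<open>two_clause_positive\<close>.\<close>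

definition implied :: "'a clause \<Rightarrow> bool" where
  "implied C \<longleftrightarrow> two_clause C \<and> atom_of ` C \<subseteq> V \<and> (\<forall>M. mm M \<longrightarrow> holds M C)"

lemma le_mult_v: "x \<le> 1 \<Longrightarrow> x * v^k \<le> v^k"
  using v_pos by (simp add: mult_left_le_one_le)

lemma forced_literal:
  assumes st: "state (\<lambda>_. True) [] K" and l: "atom_of l \<in> V" "\<And>M. mm M \<Longrightarrow> true_literal M l"
  shows "bnd (\<lambda>_. True) (v^card K)"
proof -
  have K: "matching K" using st by (auto simp: state_def)
  have "bnd (\<lambda>_. True) (t^length [l] * u^1 * val [] K)"
    using l card_touched_le[OF K, of "{atom_of l}"] by (intro bnd_extend[OF st]) auto
  then show ?thesis
    using tu_le[of 1 1] le_mult_v[of "t * u" "card K"] by (elim bnd_mono) auto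
qed

text \<open>Branching on the common atom forces two more literals in one branch, or one more in each
  branch. This pays even if every fixed atom loses a matching clause, so afterwards implied
  2-clauses may be assumed pairwise disjoint.\<close>

lemma implied_share:
  assumes st: "state (\<lambda>_. True) [] K" and C: "implied C" and D: "implied D" and CD: "C \<noteq> D"
    and share: "atom_of ` C \<inter> atom_of ` D \<noteq> {}"
  shows "bnd (\<lambda>_. True) (v^card K)"
proof -
  have K: "matching K" using st by (auto simp: state_def)
  obtain a where a: "a \<in> atom_of ` C" "a \<in> atom_of ` D" using share by blast
  have two: "two_clause C" "two_clause D" using C D by (auto simp: implied_def)
  obtain x y where x: "C = {x, y}" "atom_of x \<noteq> atom_of y" "atom_of x = a"
    by (rule two_clauseE_at[OF two(1) a(1)])
  obtain x' y' where x': "D = {x', y'}" "atom_of x' \<noteq> atom_of y'" "atom_of x' = a"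
    by (rule two_clauseE_at[OF two(2) a(2)])
  have V: "atom_of x \<in> V" "atom_of y \<in> V" "atom_of y' \<in> V"
    using C D x(1) x'(1) by (auto simp: implied_def)
  have M: "true_literal M x \<or> true_literal M y" "true_literal M x' \<or> true_literal M y'" if "mm M" for M
    using C D x(1) x'(1) that by (auto simp: implied_def)
  have "x' = x \<or> x' = flip x" using x(3) x'(3) atom_of_eq_iff[of x' x] by simp
  then show ?thesis
  proof
    assume xx: "x' = x"
    then have "y \<noteq> y'" using CD x(1) x'(1) by auto
    have "bnd (\<lambda>M. true_literal M x) (t^length [x] * u^1 * val [] K)"
      using V card_touched_le[OF K, of "{atom_of x}"] by (intro bnd_extend[OF st]) auto
    moreover have "bnd (\<lambda>M. \<not> true_literal M x) (t^3 * u^3 * val [] K)"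
    proof (cases "atom_of y = atom_of y'")
      case True
      then have "y' = flip y" using \<open>y \<noteq> y'\<close> atom_of_eq_iff[of y' y] by auto
      then show ?thesis
        using M xx t_pos u_pos val_pos[of "[]" K] by (intro bnd_empty) (metis true_literal_flip, simp)
    next
      case False
      have "card {atom_of x, atom_of y, atom_of y'} \<le> 3" by (simp add: card_insert_if)
      then have "card (touched K {atom_of x, atom_of y, atom_of y'}) \<le> 3"
        using card_touched_le[OF K, of "{atom_of x, atom_of y, atom_of y'}"] by simp
      then have "bnd (\<lambda>M. \<not> true_literal M x) (t^length [flip x, y, y'] * u^3 * val [] K)"
        using V M x x' xx False by (intro bnd_extend[OF st]) auto
      then show ?thesis by (simp add: eval_nat_numeral)
    qed
    ultimately have "bnd (\<lambda>_. True) ((t * u + t^3 * u^3) * v^card K)"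
      by (rule bnd_cases) (auto simp: algebra_simps)
    then show ?thesis
      using tu_le[of 1 1] tu_le[of 3 3]
      by (elim bnd_mono) (auto intro!: le_mult_v simp: power_numeral_reduce)
  next
    assume xx: "x' = flip x"
    have c2: "card (touched K {p, q}) \<le> 2" for p q
      using card_touched_le[OF K, of "{p, q}"] card_insert_le_m1[of 2 "{q}" p] by simp
    have "bnd (\<lambda>M. true_literal M x) (t^length [x, y'] * u^2 * val [] K)"
      using V M x x' xx c2 by (intro bnd_extend[OF st]) auto
    moreover have "bnd (\<lambda>M. \<not> true_literal M x) (t^length [flip x, y] * u^2 * val [] K)"
      using V M x c2 by (intro bnd_extend[OF st]) auto
    ultimately have "bnd (\<lambda>_. True) (2 * (t^2 * u^2) * v^card K)"
      by (rule bnd_cases) (auto simp: power2_eq_square)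
    then show ?thesis
      using tu_le[of 2 2]
      by (elim bnd_mono) (auto intro!: le_mult_v simp: power_numeral_reduce)
  qed
qed

section \<open>Theories with a 2-clause\<close>

lemma clauseD:
  assumes "C \<in> T"
  shows "finite C" "card C \<le> 3" "atom_of ` C \<subseteq> V" "inj_on atom_of C"
proof -
  show "finite C" "card C \<le> 3" using cnf assms by (auto simp: cnf_theory_def)
  show "atom_of ` C \<subseteq> V" using assms by (auto simp: cnf_atoms_def)
  have no: "\<not> (Pos a \<in> C \<and> Neg a \<in> C)" for a using cnf assms by (auto simp: cnf_theory_def)
  show "inj_on atom_of C"
  proof (rule inj_onI)
    fix l m assume "l \<in> C" "m \<in> C" "atom_of l = atom_of m"
    then show "l = m" using no by (cases l; cases m) auto
  qed
qed

lemma two_clause_card: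
  assumes "C \<in> T" "D \<subseteq> C" "card D = 2"
  shows "two_clause D"
proof -
  obtain x y where xy: "D = {x, y}" "x \<noteq> y" using assms(3) by (auto simp: card_2_iff)
  then have "atom_of x \<noteq> atom_of y" using clauseD(4)[OF assms(1)] assms(2) by (auto dest: inj_onD)
  then show ?thesis using xy by simp
qed

lemma implied_clause: "C \<in> T \<Longrightarrow> card C = 2 \<Longrightarrow> implied C"
  using two_clause_card[of C C] clauseD(3)[of C] minimal_model_holds[of T] by (auto simp: implied_def)

context
  fixes K1
  defines "K1 \<equiv> {C \<in> T. card C = 2}"
  assumes no_unit: "\<And>C. C \<in> T \<Longrightarrow> 2 \<le> card C"
    and sh: "\<And>C D. implied C \<Longrightarrow> implied D \<Longrightarrow> atom_of ` C \<inter> atom_of ` D \<noteq> {} \<Longrightarrow> C = D"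
begin

lemma K1_implied: "C \<in> K1 \<Longrightarrow> implied C"
  by (simp add: K1_def implied_clause)

text \<open>Disjointness of implied clauses makes the set of all 2-clauses a matching. Proving the
  bound for it settles every smaller matching in \<open>T\<close>.\<close>

lemma K1_state: "state (\<lambda>_. True) [] K1"
proof -
  have "finite K1" using cnf by (simp add: K1_def cnf_theory_def)
  moreover have "two_clause C" if "C \<in> K1" for C using K1_implied[OF that] by (simp add: implied_def)
  ultimately have "matching K1" using K1_implied sh unfolding matching_def by blast
  then show ?thesis using K1_implied by (auto simp: state_def implied_def)
qed

lemma K1_matching: "matching K1"
  using K1_state by (simp add: state_def)

text \<open>Remainders of the clauses with \<open>Pos a\<close> that no 2-clause subsumes. They have
  exactly two literals and lie outside \<open>K1\<close>, so with \<open>a\<close> false each is a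
  new 2-clause; with \<open>a\<close> true they are the candidates for justifying
  \<open>a\<close>.\<close>

definition support :: "'a \<Rightarrow> 'a clause set" where
  "support a = {D. Pos a \<notin> D \<and> insert (Pos a) D \<in> T \<and> \<not> (\<exists>C\<in>K1. C \<subseteq> insert (Pos a) D)}"

lemma supportD:
  assumes D: "D \<in> support a"
  shows "two_clause D" "a \<notin> atom_of ` D" "atom_of ` D \<subseteq> V" "D \<notin> K1"
    "\<And>M. mm M \<Longrightarrow> a \<notin> M \<Longrightarrow> holds M D"
proof -
  let ?C = "insert (Pos a) D"
  have C: "?C \<in> T" "Pos a \<notin> D" "\<not> (\<exists>C\<in>K1. C \<subseteq> ?C)" using D by (auto simp: support_def)
  have fin: "finite D" using clauseD(1)[OF C(1)] by simp
  have "?C \<notin> K1" using C(3) by blast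
  then have "card ?C \<noteq> 2" using C(1) by (simp add: K1_def)
  then have "card ?C = 3" using no_unit[OF C(1)] clauseD(2)[OF C(1)] by linarith
  then have "card D = 2" using C(2) fin by simp
  then show "two_clause D" using two_clause_card[OF C(1)] by blast
  show "a \<notin> atom_of ` D" using clauseD(4)[OF C(1)] C(2) by (auto simp: inj_on_def)
  show "atom_of ` D \<subseteq> V" using clauseD(3)[OF C(1)] by simp
  show "D \<notin> K1" using C(3) by blast
  show "holds M D" if "mm M" "a \<notin> M" for M
    using minimal_model_holds[OF that(1) C(1)] that(2) by (auto simp: holds_def)
qed

lemma K1_unique: "C \<in> K1 \<Longrightarrow> D \<in> K1 \<Longrightarrow> a \<in> atom_of ` C \<Longrightarrow> a \<in> atom_of ` D \<Longrightarrow> C = D"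
  using sh K1_implied by blast

text \<open>A 2-clause inside the witness clause can only be true through \<open>Pos a\<close>,
  hence it would be \<open>E\<close>. The assumption on \<open>E\<close> rules that out, so the
  witness belongs to \<open>support a\<close>.\<close>

lemma support_witness:
  assumes M: "mm M" "a \<in> M" and E: "E \<in> K1" "a \<in> atom_of ` E"
    and other: "\<exists>l\<in>E. l \<noteq> Pos a \<and> (l = Neg a \<or> true_literal M l)"
  obtains D where "D \<in> support a" "\<And>l. l \<in> D \<Longrightarrow> \<not> true_literal M l"
proof -
  obtain D where D: "Pos a \<notin> D" "insert (Pos a) D \<in> T" "\<And>l. l \<in> D \<Longrightarrow> \<not> true_literal M l"
    using minimal_model_witness[OF M] by blast
  have "\<not> (\<exists>C\<in>K1. C \<subseteq> insert (Pos a) D)"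
  proof
    assume "\<exists>C\<in>K1. C \<subseteq> insert (Pos a) D"
    then obtain C where C: "C \<in> K1" "C \<subseteq> insert (Pos a) D" by blast
    obtain l where l: "l \<in> C" "true_literal M l"
      using K1_implied[OF C(1)] M(1) by (auto simp: implied_def holds_def)
    then have "l = Pos a" using C(2) D(3) by blast
    then have "a \<in> atom_of ` C" using l(1) by force
    then have "C = E" using K1_unique[OF C(1) E(1)] E(2) by blast
    obtain m where m: "m \<in> E" "m \<noteq> Pos a" "m = Neg a \<or> true_literal M m" using other by blast
    then have "m \<in> D" using C(2) \<open>C = E\<close> by blast
    then have "m = Neg a" using m(3) D(3) by blast
    then have "m = Pos a" using inj_onD[OF clauseD(4)[OF D(2)], of m "Pos a"] \<open>m \<in> D\<close> by simp
    then show False using m(2) by simp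
  qed
  then show thesis using D that by (auto simp: support_def)
qed

lemma support_new_clause:
  assumes "D \<in> support a" "atom_of ` D \<inter> atom_of ` set ls = {}" "\<And>M. mm M \<Longrightarrow> P M \<Longrightarrow> a \<notin> M" "K \<subseteq> K1"
  shows "new_clause P ls K D"
  using supportD[OF assms(1)] assms(2-) unfolding new_clause_def by blast

text \<open>\<open>a\<close> true forces \<open>y\<close>. Two clauses in \<open>support a\<close>
  make the branch with \<open>a\<close> false cheap; with fewer, \<open>a\<close> true has at most
  one possible justification, which fixes two more literals or excludes the branch.\<close>

lemma two_clause_negative:
  assumes E: "{Neg a, y} \<in> K1"
  shows "bnd (\<lambda>_. True) (v^card K1)"
proof -
  have fin: "finite K1" using K1_matching by (simp add: matching_def)
  have im: "implied {Neg a, y}" using K1_implied[OF E] .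
  then have V: "a \<in> V" "atom_of y \<in> V" "atom_of y \<noteq> a" by (auto simp: implied_def)
  have M: "a \<notin> M \<or> true_literal M y" if "mm M" for M using im that by (auto simp: implied_def)
  have c1: "card (touched K1 {a}) \<le> 1" using card_touched_le[OF K1_matching, of "{a}"] by simp
  show ?thesis
  proof (cases "\<exists>D1\<in>support a. \<exists>D2\<in>support a. D1 \<noteq> D2")
    case True
    then obtain D1 D2 where D: "D1 \<in> support a" "D2 \<in> support a" "D1 \<noteq> D2" by blast
    define K where "K = K1 - touched K1 {a}"
    have st: "state (\<lambda>M. a \<notin> M) [Neg a] K"
      using state_extend[OF K1_state, of "\<lambda>M. a \<notin> M" "[Neg a]"] V by (auto simp: K_def)
    have new: "new_clause (\<lambda>M. a \<notin> M) [Neg a] K D1" "new_clause (\<lambda>M. a \<notin> M) [Neg a] K D2"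
      using supportD(2)[OF D(1)] supportD(2)[OF D(2)]
      by (intro support_new_clause[OF D(1)] support_new_clause[OF D(2)]; force simp: K_def)+
    \<comment> \<open>0.878 exceeds both \<open>phi^2\<close> and the factor of a 4-cycle; there is
      enough slack to treat the two alike.\<close>
    have "bnd (\<lambda>M. a \<notin> M) (0.878 * val [Neg a] K)"
    proof (cases "bnd (\<lambda>M. a \<notin> M) (phi^2 * val [Neg a] K)")
      case True
      have "phi^2 \<le> 0.9242^2" using phi_upper phi_lower by (intro power_mono) auto
      then show ?thesis using True val_pos[of "[Neg a]" K]
        by (elim bnd_mono) (auto simp: power2_eq_square)
    next
      case False
      then obtain x y z w where "D1 = {x, y}" "D2 = {z, w}" "{x, z} \<in> K" "{y, w} \<in> K"
        using two_new_clauses[OF st _ new D(3)] by blast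
      then have "bnd (\<lambda>M. a \<notin> M) (2 * (t^2 * u^2) * val [Neg a] K)"
        using four_cycle[OF st] new by blast
      moreover have "2 * (t^2 * u^2) \<le> 0.878"
        using tu_le[of 2 2] by (simp add: power_numeral_reduce)
      ultimately show ?thesis using val_pos[of "[Neg a]" K] by (elim bnd_mono) auto
    qed
    moreover have "val [Neg a] K \<le> t * u * v^card K1"
      using val_extend[OF fin c1, of "[Neg a]" "[]"] by (simp add: K_def)
    ultimately have "bnd (\<lambda>M. a \<notin> M) (0.878 * (t * u) * v^card K1)"
      by (elim bnd_mono) auto
    moreover have "bnd (\<lambda>M. a \<in> M) (t^length [Pos a, y] * u^1 * val [] K1)"
    proof (rule bnd_extend[OF K1_state])
      show "card (touched K1 (atom_of ` set [Pos a, y])) \<le> 1"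
        using card_touched_clause_le[OF K1_matching E, of "{a, atom_of y}" "{}"] by simp
    qed (use V M in auto)
    ultimately have "bnd (\<lambda>_. True) ((0.878 * (t * u) + t^2 * u) * v^card K1)"
      by (rule bnd_cases) (auto simp: algebra_simps power2_eq_square)
    then show ?thesis
      using tu_le[of 1 1] tu_le[of 2 1]
      by (elim bnd_mono) (auto intro!: le_mult_v simp: power_numeral_reduce)
  next
    case False
    have "bnd (\<lambda>M. a \<in> M) (t^3 * u^3 * v^card K1)"
    proof (cases "support a = {}")
      case True
      have "a \<notin> M" if "mm M" for M
        using support_witness[OF that _ E, of a] True by auto
      then show ?thesis using t_pos u_pos v_pos by (intro bnd_empty) auto
    next
      case False
      then obtain D where D: "D \<in> support a" by blast
      have uniq: "D' = D" if "D' \<in> support a" for D' using \<open>\<not> (\<exists>D1\<in>support a. _ D1)\<close> D that by blast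
      obtain c d where cd: "D = {c, d}" "atom_of c \<noteq> atom_of d" using supportD(1)[OF D] by (rule two_clauseE)
      have cdV: "atom_of c \<in> V" "atom_of d \<in> V" "atom_of c \<noteq> a" "atom_of d \<noteq> a"
        using supportD(2,3)[OF D] cd by auto
      have "card {a, atom_of c, atom_of d} \<le> 3" by (simp add: card_insert_if)
      then have "card (touched K1 {a, atom_of c, atom_of d}) \<le> 3"
        using card_touched_le[OF K1_matching, of "{a, atom_of c, atom_of d}"] by simp
      moreover have "\<not> true_literal M c \<and> \<not> true_literal M d" if "mm M" "a \<in> M" for M
        using support_witness[OF that E] uniq cd(1) by auto
      ultimately have "bnd (\<lambda>M. a \<in> M) (t^length [Pos a, flip c, flip d] * u^3 * val [] K1)"
        using V cdV cd(2) by (intro bnd_extend[OF K1_state]) auto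
      then show ?thesis by (simp add: eval_nat_numeral)
    qed
    moreover have "bnd (\<lambda>M. a \<notin> M) (t^length [Neg a] * u^1 * val [] K1)"
      using V c1 by (intro bnd_extend[OF K1_state]) auto
    ultimately have "bnd (\<lambda>_. True) ((t^3 * u^3 + t * u) * v^card K1)"
      by (rule bnd_cases) (auto simp: algebra_simps)
    then show ?thesis
      using tu_le[of 1 1] tu_le[of 3 3]
      by (elim bnd_mono) (auto intro!: le_mult_v simp: power_numeral_reduce)
  qed
qed

text \<open>With two clauses in \<open>support a\<close>, branching on \<open>a\<close> is the tight
  case of the first equation unless a 4-cycle occurs. In the remaining cases
  \<open>support a\<close> has at most two elements, and the models containing both \<open>a\<close>
  and \<open>b\<close> are bounded by their possible witnesses.\<close>

lemma two_clause_positive: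
  assumes E: "{Pos a, Pos b} \<in> K1"
  shows "bnd (\<lambda>_. True) (v^card K1)"
proof -
  have fin: "finite K1" using K1_matching by (simp add: matching_def)
  have im: "implied {Pos a, Pos b}" using K1_implied[OF E] .
  then have V: "a \<in> V" "b \<in> V" "b \<noteq> a" by (auto simp: implied_def)
  have M: "a \<in> M \<or> b \<in> M" if "mm M" for M using im that by (auto simp: implied_def)
  have c1: "card (touched K1 {a}) \<le> 1" using card_touched_le[OF K1_matching, of "{a}"] by simp
  have cE: "card (touched K1 {a, b}) \<le> 1" "card (touched K1 {b, a}) \<le> 1"
    using card_touched_clause_le[OF K1_matching E, of "{a, b}" "{}"] by (simp_all add: insert_commute)
  \<comment> \<open>\<open>Pos b\<close> would make the clause subsumed by \<open>E\<close>.
    \<open>Neg b\<close> resolves with \<open>E\<close> to an implied clause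
    \<open>{Pos a, d}\<close>, which would share \<open>a\<close> with \<open>E\<close>.\<close>
  have nob: "b \<notin> atom_of ` D" if D: "D \<in> support a" for D
  proof
    assume b: "b \<in> atom_of ` D"
    obtain l d where ld: "D = {l, d}" "atom_of l \<noteq> atom_of d" "atom_of l = b"
      by (rule two_clauseE_at[OF supportD(1)[OF D] b])
    have "\<forall>C\<in>K1. \<not> C \<subseteq> insert (Pos a) D" using D by (simp add: support_def)
    from bspec[OF this E] have "Pos b \<notin> D" by simp
    then have "l = Neg b" using ld(1,3) by (cases l) auto
    have "implied {Pos a, d}"
      unfolding implied_def
    proof (intro conjI allI impI)
      show "two_clause {Pos a, d}" "atom_of ` {Pos a, d} \<subseteq> V"
        using supportD(2,3)[OF D] ld(1) V by auto
      show "holds M {Pos a, d}" if "mm M" for M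
        using supportD(5)[OF D that] M[OF that] ld(1) \<open>l = Neg b\<close> by auto
    qed
    then have "{Pos a, d} = {Pos a, Pos b}" using sh[OF _ im] by auto
    then show False using ld V by (auto simp: doubleton_eq_iff)
  qed
  have wit: "\<exists>D\<in>support a. \<forall>l\<in>D. \<not> true_literal M l" if m: "mm M" "a \<in> M" "b \<in> M" for M
  proof -
    have "\<exists>l\<in>{Pos a, Pos b}. l \<noteq> Pos a \<and> (l = Neg a \<or> true_literal M l)"
      using V(3) m(3) by simp
    then obtain D where "D \<in> support a" "\<And>l. l \<in> D \<Longrightarrow> \<not> true_literal M l"
      using support_witness[OF m(1,2) E] by auto
    then show ?thesis by blast
  qed
  \<comment> \<open>Where exactly one of \<open>a\<close>, \<open>b\<close> is true, both atoms of
    \<open>E\<close> are fixed at the loss of \<open>E\<close> alone. Only the models with both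
    atoms true remain to be bounded.\<close>
  have one: "bnd (\<lambda>M. a \<in> M \<and> b \<notin> M \<or> a \<notin> M) (2 * (t^2 * u) * v^card K1)"
  proof (rule bnd_cases)
    show "bnd (\<lambda>M. a \<in> M \<and> b \<notin> M) (t^length [Pos a, Neg b] * u^1 * val [] K1)"
      using V cE by (intro bnd_extend[OF K1_state]) auto
    show "bnd (\<lambda>M. a \<notin> M) (t^length [Neg a, Pos b] * u^1 * val [] K1)"
      using V cE M by (intro bnd_extend[OF K1_state]) auto
  qed (auto simp: power2_eq_square)
  have both: ?thesis if "bnd (\<lambda>M. a \<in> M \<and> b \<in> M) (x * v^card K1)" "2 * (t^2 * u) + x \<le> 1" for x
  proof -
    have "bnd (\<lambda>_. True) ((2 * (t^2 * u) + x) * v^card K1)"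
      using one that(1) by (rule bnd_cases) (auto simp: algebra_simps)
    then show ?thesis using le_mult_v[OF that(2)] by (elim bnd_mono) auto
  qed
  show ?thesis
  proof (cases "\<exists>D1\<in>support a. \<exists>D2\<in>support a. D1 \<noteq> D2")
    case True
    then obtain D1 D2 where D: "D1 \<in> support a" "D2 \<in> support a" "D1 \<noteq> D2" by blast
    define K where "K = K1 - touched K1 {a, b}"
    have st: "state (\<lambda>M. a \<notin> M) [Neg a, Pos b] K"
      using state_extend[OF K1_state, of "\<lambda>M. a \<notin> M" "[Neg a, Pos b]"] V M by (auto simp: K_def)
    have val: "val [Neg a, Pos b] K \<le> t^2 * u * v^card K1"
      using val_extend[OF fin cE(1), of "[Neg a, Pos b]" "[]"] by (simp add: K_def power2_eq_square)
    have new: "new_clause (\<lambda>M. a \<notin> M) [Neg a, Pos b] K D" if "D \<in> support a" for D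
      using supportD(2)[OF that] nob[OF that] by (intro support_new_clause[OF that]) (auto simp: K_def)
    show ?thesis
    proof (cases "bnd (\<lambda>M. a \<notin> M) (phi^2 * val [Neg a, Pos b] K)")
      case True
      then have "bnd (\<lambda>M. a \<notin> M) (t^2 * u * phi^2 * v^card K1)"
        using mult_left_mono[OF val, of "phi^2"] by (elim bnd_mono) (auto simp: mult_ac)
      moreover have "bnd (\<lambda>M. a \<in> M) (t^length [Pos a] * u^1 * val [] K1)"
        using V c1 by (intro bnd_extend[OF K1_state]) auto
      ultimately have "bnd (\<lambda>_. True) ((t * u + t^2 * u * phi^2) * v^card K1)"
        by (rule bnd_cases) (auto simp: algebra_simps)
      then show ?thesis by (simp add: phi_sq_root)
    next
      case no: False
      have partner: "\<exists>x y z w. D1 = {x, y} \<and> D' = {z, w} \<and> {x, z} \<in> K \<and> {y, w} \<in> K"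
        if "D' \<in> support a" "D' \<noteq> D1" for D'
        using two_new_clauses[OF st _ new[OF D(1)] new[OF that(1)]] that(2) no by auto
      obtain x y z w where c4: "D1 = {x, y}" "D2 = {z, w}" "{x, z} \<in> K" "{y, w} \<in> K"
        using partner[OF D(2)] D(3) by metis
      have K: "matching K" using st by (simp add: state_def)
      \<comment> \<open>The matching partners of the literals of \<open>D1\<close> are unique, so
        \<open>D1\<close> determines the other clause of a 4-cycle; hence \<open>support a\<close>
        is \<open>{D1, D2}\<close>.\<close>
      have uniq: "D' = D2" if D': "D' \<in> support a" "D' \<noteq> D1" for D'
      proof -
        obtain x' y' z' w' where c4': "D1 = {x', y'}" "D' = {z', w'}" "{x', z'} \<in> K" "{y', w'} \<in> K"
          using partner[OF D'] by metis
        have mate: "q = r" if "{p, q} \<in> K" "{p, r} \<in> K" for p q r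
          using K that unfolding matching_def by (fastforce simp: doubleton_eq_iff)
        show ?thesis using c4 c4' mate by (auto simp: doubleton_eq_iff)
      qed
      have D1V: "atom_of x \<in> V - {a, b}" "atom_of y \<in> V - {a, b}" "atom_of x \<noteq> atom_of y"
        using supportD(1-3)[OF D(1)] nob[OF D(1)] c4(1) by auto
      have D2V: "atom_of z \<in> V - {a, b}" "atom_of w \<in> V - {a, b}" "atom_of z \<noteq> atom_of w"
        using supportD(1-3)[OF D(2)] nob[OF D(2)] c4(2) by auto
      have "{x, z} \<noteq> {y, w}" using D1V supportD(4)[OF D(1)] c4 by (auto simp: doubleton_eq_iff K_def)
      from matching_disjoint[OF K c4(3,4) this]
      have sep: "atom_of ` {x, z} \<inter> atom_of ` {y, w} = {}" .
      have EK: "{x, z} \<in> K1" "{y, w} \<in> K1" using c4 by (auto simp: K_def)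
      have neq: "atom_of x \<noteq> atom_of z" "atom_of y \<noteq> atom_of w"
        using EK K1_matching by (auto simp: matching_def)
      have hold: "(true_literal M x \<or> true_literal M z) \<and> (true_literal M y \<or> true_literal M w)" if "mm M" for M
        using K1_implied[OF EK(1)] K1_implied[OF EK(2)] that by (auto simp: implied_def)
      have "touched K1 {a, b, atom_of x, atom_of y, atom_of z, atom_of w}
          \<subseteq> {{Pos a, Pos b}, {x, z}, {y, w}}" (is "?L \<subseteq> ?R")
      proof
        fix C assume "C \<in> ?L"
        then have C: "C \<in> K1" and "a \<in> atom_of ` C \<or> b \<in> atom_of ` C \<or> atom_of x \<in> atom_of ` C \<or>
            atom_of y \<in> atom_of ` C \<or> atom_of z \<in> atom_of ` C \<or> atom_of w \<in> atom_of ` C"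
          by (auto simp: touched_def)
        then show "C \<in> ?R"
          using K1_unique[OF C E, of a] K1_unique[OF C E, of b]
            K1_unique[OF C EK(1), of "atom_of x"] K1_unique[OF C EK(1), of "atom_of z"]
            K1_unique[OF C EK(2), of "atom_of y"] K1_unique[OF C EK(2), of "atom_of w"]
          by (elim disjE) simp_all
      qed
      then have "card ?L \<le> card ?R" by (intro card_mono) auto
      also have "\<dots> \<le> 3" by (simp add: card_insert_if)
      finally have c3: "card (touched K1 {a, b, atom_of x, atom_of y, atom_of z, atom_of w}) \<le> 3" .
      \<comment> \<open>A witness \<open>D1\<close> is entirely false, which forces \<open>z\<close>
        and \<open>w\<close> through the cycle: six literals are fixed, and only \<open>E\<close>
        and the two matching clauses of the cycle are lost.\<close>
      have "bnd (\<lambda>M. a \<in> M \<and> b \<in> M \<and> \<not> true_literal M x \<and> \<not> true_literal M y)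
          (t^length [Pos a, Pos b, flip x, flip y, z, w] * u^3 * val [] K1)"
        using V D1V D2V neq sep hold c3 by (intro bnd_extend[OF K1_state]) auto
      moreover have "{a, b, atom_of z, atom_of w, atom_of x, atom_of y}
          = {a, b, atom_of x, atom_of y, atom_of z, atom_of w}" by auto
      then have "bnd (\<lambda>M. a \<in> M \<and> b \<in> M \<and> \<not> true_literal M z \<and> \<not> true_literal M w)
          (t^length [Pos a, Pos b, flip z, flip w, x, y] * u^3 * val [] K1)"
        using V D1V D2V neq sep hold c3 by (intro bnd_extend[OF K1_state]) auto
      ultimately have "bnd (\<lambda>M. a \<in> M \<and> b \<in> M) (2 * (t^6 * u^3) * v^card K1)"
      proof (rule bnd_cases)
        fix M assume "mm M" "a \<in> M \<and> b \<in> M"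
        then obtain D' where "D' \<in> support a" "\<forall>l\<in>D'. \<not> true_literal M l" using wit by blast
        moreover have "D' = D1 \<or> D' = D2" using uniq calculation(1) by blast
        ultimately show "a \<in> M \<and> b \<in> M \<and> \<not> true_literal M x \<and> \<not> true_literal M y \<or>
            a \<in> M \<and> b \<in> M \<and> \<not> true_literal M z \<and> \<not> true_literal M w"
          using c4(1,2) \<open>a \<in> M \<and> b \<in> M\<close> by auto
      qed (simp add: eval_nat_numeral)
      then show ?thesis
        using tu_le[of 2 1] tu_le[of 6 3] by (elim both) (simp add: power_numeral_reduce)
    qed
  next
    case False
    have "bnd (\<lambda>M. a \<in> M \<and> b \<in> M) (t^4 * u^3 * v^card K1)"
    proof (cases "support a = {}")
      case True
      then show ?thesis using wit t_pos u_pos v_pos by (intro bnd_empty) auto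
    next
      case nonempty: False
      then obtain D where D: "D \<in> support a" by blast
      have uniq: "D' = D" if "D' \<in> support a" for D' using False D that by blast
      obtain c d where cd: "D = {c, d}" "atom_of c \<noteq> atom_of d" using supportD(1)[OF D] by (rule two_clauseE)
      have cdV: "atom_of c \<in> V - {a, b}" "atom_of d \<in> V - {a, b}"
        using supportD(2,3)[OF D] nob[OF D] cd by auto
      have "card (touched K1 {a, b, atom_of c, atom_of d}) \<le> 1 + card {atom_of c, atom_of d}"
        by (rule card_touched_clause_le[OF K1_matching E]) auto
      moreover have "\<not> true_literal M c \<and> \<not> true_literal M d" if "mm M" "a \<in> M" "b \<in> M" for M
        using wit[OF that] uniq cd(1) by auto
      ultimately have "bnd (\<lambda>M. a \<in> M \<and> b \<in> M)
          (t^length [Pos a, Pos b, flip c, flip d] * u^3 * val [] K1)"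
        using V cdV cd(2) by (intro bnd_extend[OF K1_state]) auto
      then show ?thesis by (simp add: eval_nat_numeral)
    qed
    then show ?thesis
      using tu_le[of 2 1] tu_le[of 4 3] by (elim both) (simp add: power_numeral_reduce)
  qed
qed

lemma some_two_clause:
  assumes "K1 \<noteq> {}"
  shows "bnd (\<lambda>_. True) (v^card K1)"
proof -
  obtain E where E: "E \<in> K1" using assms by blast
  then have "two_clause E" using K1_matching by (simp add: matching_def)
  then obtain x y where xy: "E = {x, y}" by (rule two_clauseE)
  show ?thesis
  proof (cases x)
    case (Neg a)
    then show ?thesis using two_clause_negative E xy by simp
  next
    case x: (Pos a)
    show ?thesis
    proof (cases y)
      case (Neg b)
      then show ?thesis using two_clause_negative[of b x] E xy by (simp add: insert_commute)
    next
      case (Pos b)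
      then show ?thesis using two_clause_positive E xy x by simp
    qed
  qed
qed

end


section \<open>Several 2-clauses without a matching\<close>

lemma touched_empty [simp]: "touched {} X = {}"
  by (simp add: touched_def)

lemma matching_empty [simp]: "matching {}"
  by (simp add: matching_def)

lemma state_Nil:
  assumes "distinct (map atom_of ls)" "atom_of ` set ls \<subseteq> V"
    "\<And>M. mm M \<Longrightarrow> P M \<Longrightarrow> \<forall>l\<in>set ls. true_literal M l"
  shows "state P ls {}"
  using assms by (simp add: state_def)

lemma val_empty [simp]: "val ls {} = t^length ls"
  by (simp add: val_def)

lemma one_clause:
  assumes "state P ls {}" "ls \<noteq> []" "new_clause P ls {} D"
  shows "bnd P (v * t^length ls)"
proof -
  have "state P ls {D}" "val ls {D} = v * t^length ls"
    using state_insert[OF assms(1), of D] assms(3) by (auto simp: new_clause_def)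
  then show ?thesis using state_bnd[of P ls "{D}"] assms(2) by simp
qed

text \<open>Without a matching nothing can be lost. Two clauses on disjoint atoms give
  \<open>v^2\<close>, and overlapping ones are better: \<open>t + t^3\<close> or
  \<open>2 * t^2\<close>.\<close>

lemma two_clauses:
  assumes st: "state P ls {}" and ne: "ls \<noteq> []"
    and D: "new_clause P ls {} D" and D': "new_clause P ls {} D'" and DD': "D \<noteq> D'"
  shows "bnd P (v^2 * t^length ls)"
proof (cases "atom_of ` D \<inter> atom_of ` D' = {}")
  case True
  have ins: "state P ls {D}" "val ls {D} = v * t^length ls"
    using state_insert[OF st, of D] D by (auto simp: new_clause_def)
  have "touched {D} (atom_of ` D') = {}" using True by (auto simp: touched_def)
  then have "state P ls {D', D}" "val ls {D', D} = v * (v * t^length ls)"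
    using state_insert[OF ins(1), of D'] ins(2) D' by (auto simp: new_clause_def)
  then show ?thesis using state_bnd[OF _ ne, of P "{D', D}"] by (simp add: power2_eq_square mult.assoc)
next
  case False
  then obtain a where a: "a \<in> atom_of ` D" "a \<in> atom_of ` D'" by blast
  have two: "two_clause D" "two_clause D'" using D D' by (auto simp: new_clause_def)
  obtain x y where x: "D = {x, y}" "atom_of x \<noteq> atom_of y" "atom_of x = a"
    by (rule two_clauseE_at[OF two(1) a(1)])
  obtain x' y' where x': "D' = {x', y'}" "atom_of x' \<noteq> atom_of y'" "atom_of x' = a"
    by (rule two_clauseE_at[OF two(2) a(2)])
  have V: "atom_of x \<in> V - atom_of ` set ls" "atom_of y \<in> V - atom_of ` set ls"
    "atom_of y' \<in> V - atom_of ` set ls"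
    using D D' x(1) x'(1) by (auto simp: new_clause_def)
  have M: "true_literal M x \<or> true_literal M y" "true_literal M x' \<or> true_literal M y'"
    if "mm M" "P M" for M
    using D D' x(1) x'(1) that by (auto simp: new_clause_def)
  have vv: "0.8184 \<le> v^2"
    using power_mono[of "0.9047" v 2] v_lower by (simp add: power2_eq_square)
  have fin: ?thesis if "bnd P (r * t^length ls)" "r \<le> 0.8184" for r
    using that(1)
  proof (rule bnd_mono)
    show "r * t^length ls \<le> v^2 * t^length ls"
      using that(2) vv t_pos by (intro mult_right_mono) auto
  qed auto
  have "x' = x \<or> x' = flip x" using x(3) x'(3) atom_of_eq_iff[of x' x] by simp
  then show ?thesis
  proof
    assume xx: "x' = x"
    then have "y \<noteq> y'" using DD' x(1) x'(1) by auto
    have "bnd (\<lambda>M. P M \<and> true_literal M x) (t^length [x] * u^0 * val ls {})"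
      using V by (intro bnd_extend[OF st]) auto
    moreover have "bnd (\<lambda>M. P M \<and> \<not> true_literal M x) (t^3 * t^length ls)"
    proof (cases "atom_of y = atom_of y'")
      case True
      then have "y' = flip y" using \<open>y \<noteq> y'\<close> atom_of_eq_iff[of y' y] by auto
      then show ?thesis
        using M xx t_pos by (intro bnd_empty) (metis true_literal_flip, simp)
    next
      case False
      then have "bnd (\<lambda>M. P M \<and> \<not> true_literal M x) (t^length [flip x, y, y'] * u^0 * val ls {})"
        using V M x x' xx by (intro bnd_extend[OF st]) auto
      then show ?thesis by (simp add: eval_nat_numeral)
    qed
    ultimately have "bnd P ((t + t^3) * t^length ls)"
      by (rule bnd_cases) (auto simp: algebra_simps)
    then show ?thesis
      using t_upper t_le[of 3] by (elim fin) (simp add: power_numeral_reduce)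
  next
    assume xx: "x' = flip x"
    have "bnd (\<lambda>M. P M \<and> true_literal M x) (t^length [x, y'] * u^0 * val ls {})"
      using V M x x' xx by (intro bnd_extend[OF st]) auto
    moreover have "bnd (\<lambda>M. P M \<and> \<not> true_literal M x) (t^length [flip x, y] * u^0 * val ls {})"
      using V M x by (intro bnd_extend[OF st]) auto
    ultimately have "bnd P (2 * t^2 * t^length ls)"
      by (rule bnd_cases) (auto simp: power2_eq_square)
    then show ?thesis
      using t_le[of 2] by (elim fin) (simp add: power_numeral_reduce)
  qed
qed

text \<open>The worst case for three 2-clauses: two of them share a literal \<open>c\<close>. If
  \<open>c\<close> is true a third clause remains, if it is false two further literals are forced.
  This exceeds \<open>v^3\<close> for disjoint clauses.\<close>

definition phi3 :: real where
  "phi3 = t * v + t^3"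

lemma phi3_lower: "0.754 \<le> phi3"
proof -
  have "0.5987 * 0.9047 \<le> t * v" "0.5987^3 \<le> t^3"
    using t_lower v_lower by (intro mult_mono power_mono; simp)+
  then show ?thesis by (simp add: phi3_def power_numeral_reduce)
qed

lemma three_clauses:
  assumes st: "state P ls {}" and ne: "ls \<noteq> []"
    and DD: "\<And>D. D \<in> DD \<Longrightarrow> new_clause P ls {} D" and card: "3 \<le> card DD"
    and common: "\<And>c. \<exists>D\<in>DD. c \<notin> D"
  shows "bnd P (phi3 * t^length ls)"
proof -
  have fin: ?thesis if "bnd P (r * t^length ls)" "r \<le> 0.754" for r
    using that(1)
  proof (rule bnd_mono)
    show "r * t^length ls \<le> phi3 * t^length ls"
      using that(2) phi3_lower t_pos by (intro mult_right_mono) auto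
  qed auto
  have two: "two_clause D" if "D \<in> DD" for D using DD[OF that] by (simp add: new_clause_def)
  have V: "atom_of l \<in> V - atom_of ` set ls" if "D \<in> DD" "l \<in> D" for D l
    using DD[OF that(1)] that(2) by (auto simp: new_clause_def)
  have hold: "true_literal M x \<or> true_literal M y" if "{x, y} \<in> DD" "mm M" "P M" for x y M
    using DD[OF that(1)] that(2,3) by (auto simp: new_clause_def)
  show ?thesis
  proof (cases "\<exists>c d e. {c, d} \<in> DD \<and> {flip c, e} \<in> DD")
    case True
    then obtain c d e where cde: "{c, d} \<in> DD" "{flip c, e} \<in> DD" by blast
    have W: "atom_of c \<in> V - atom_of ` set ls" "atom_of d \<in> V - atom_of ` set ls"
      "atom_of e \<in> V - atom_of ` set ls" "atom_of c \<noteq> atom_of d" "atom_of c \<noteq> atom_of e"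
      using V cde two[OF cde(1)] two[OF cde(2)] by auto
    have "bnd (\<lambda>M. P M \<and> true_literal M c) (t^length [c, e] * u^0 * val ls {})"
      using W hold[OF cde(2)] by (intro bnd_extend[OF st]) auto
    moreover have "bnd (\<lambda>M. P M \<and> \<not> true_literal M c) (t^length [flip c, d] * u^0 * val ls {})"
      using W hold[OF cde(1)] by (intro bnd_extend[OF st]) auto
    ultimately have "bnd P (2 * t^2 * t^length ls)"
      by (rule bnd_cases) (auto simp: power2_eq_square)
    then show ?thesis using t_le[of 2] by (elim fin) (simp add: power_numeral_reduce)
  next
    case no_opposite: False
    show ?thesis
    proof (cases "\<exists>c d e. {c, d} \<in> DD \<and> {c, e} \<in> DD \<and> d \<noteq> e")
      case True
      then obtain c d e where cde: "{c, d} \<in> DD" "{c, e} \<in> DD" "d \<noteq> e" by blast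
      have W: "atom_of c \<in> V - atom_of ` set ls" "atom_of d \<in> V - atom_of ` set ls"
        "atom_of e \<in> V - atom_of ` set ls" "atom_of c \<noteq> atom_of d" "atom_of c \<noteq> atom_of e"
        using V cde two[OF cde(1)] two[OF cde(2)] by auto
      have h: "true_literal M d \<and> true_literal M e" if "mm M" "P M" "\<not> true_literal M c" for M
        using hold[OF cde(1)] hold[OF cde(2)] that by blast
      obtain D where D: "D \<in> DD" "c \<notin> D" using common by blast
      obtain x y where xy: "D = {x, y}" using two[OF D(1)] by (rule two_clauseE)
      \<comment> \<open>The third clause avoids the atom of \<open>c\<close> altogether, so it is
        still available after \<open>c\<close> is made true.\<close>
      have "flip c \<notin> D" using no_opposite cde(1) D(1) xy by (auto simp: insert_commute)
      then have cD: "atom_of c \<notin> atom_of ` D" using D(2) by (auto simp: atom_of_eq_iff)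
      have stc: "state (\<lambda>M. P M \<and> true_literal M c) (c # ls) {}"
        using state_extend[OF st, of "\<lambda>M. P M \<and> true_literal M c" "[c]"] W by auto
      have "new_clause (\<lambda>M. P M \<and> true_literal M c) (c # ls) {} D"
        using new_clause_extend[OF DD[OF D(1)], of "\<lambda>M. P M \<and> true_literal M c" "[c]" "{}"] cD by simp
      then have "bnd (\<lambda>M. P M \<and> true_literal M c) (v * (t * t^length ls))"
        using one_clause[OF stc] by simp
      moreover have "bnd (\<lambda>M. P M \<and> \<not> true_literal M c) (t^3 * t^length ls)"
      proof (cases "atom_of d = atom_of e")
        case True
        then have "e = flip d" using \<open>d \<noteq> e\<close> atom_of_eq_iff[of e d] by auto
        then show ?thesis using h t_pos by (intro bnd_empty) auto
      next
        case False
        then have "bnd (\<lambda>M. P M \<and> \<not> true_literal M c) (t^length [flip c, d, e] * u^0 * val ls {})"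
          using W h by (intro bnd_extend[OF st]) auto
        then show ?thesis by (simp add: eval_nat_numeral)
      qed
      ultimately show ?thesis
        by (rule bnd_cases) (auto simp: phi3_def algebra_simps)
    next
      case no_same: False
      have dis: "atom_of ` D \<inter> atom_of ` D' = {}" if D: "D \<in> DD" "D' \<in> DD" "D \<noteq> D'" for D D'
      proof (rule ccontr)
        assume "atom_of ` D \<inter> atom_of ` D' \<noteq> {}"
        then obtain a where a: "a \<in> atom_of ` D" "a \<in> atom_of ` D'" by blast
        obtain x y where x: "D = {x, y}" "atom_of x = a" by (rule two_clauseE_at[OF two[OF D(1)] a(1)])
        obtain x' y' where x': "D' = {x', y'}" "atom_of x' = a"
          by (rule two_clauseE_at[OF two[OF D(2)] a(2)])
        have "x' = x \<or> x' = flip x" using x(2) x'(2) atom_of_eq_iff[of x' x] by simp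
        then show False using no_opposite no_same D x(1) x'(1) by blast
      qed
      obtain K where K: "K \<subseteq> DD" "card K = 3" using obtain_subset_with_card_n[OF card] by blast
      then have "finite K" using card.infinite by force
      then have "matching K"
        using dis two K(1) unfolding matching_def by (meson subsetD)
      moreover have "atom_of ` C \<subseteq> V - atom_of ` set ls" "\<And>M. mm M \<Longrightarrow> P M \<Longrightarrow> holds M C" if "C \<in> K" for C
        using DD[of C] that K(1) by (auto simp: new_clause_def)
      ultimately have "state P ls K" using st by (simp add: state_def)
      from state_bnd[OF this ne] have "bnd P (v^3 * t^length ls)" using K(2) by (simp add: val_def mult.commute)
      then show ?thesis using tv_le[of 0 3] by (elim fin) (simp add: power_numeral_reduce)
    qed
  qed
qed

end

section \<open>Theories with 3-clauses only\<close>

locale branching3 = branching t u v T for t u v and T :: "'a clause set" +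
  assumes all3: "\<And>C. C \<in> T \<Longrightarrow> card C = 3"
begin

text \<open>The counterpart of \<open>support\<close> without 2-clauses: a new clause each if
  \<open>a\<close> is false, the possible justifications if \<open>a\<close> is true.\<close>

definition link :: "'a \<Rightarrow> 'a clause set" where
  "link a = {D. Pos a \<notin> D \<and> insert (Pos a) D \<in> T}"

lemma finite_link: "finite (link a)"
proof (rule finite_subset)
  show "link a \<subseteq> (\<lambda>C. C - {Pos a}) ` T"
  proof
    fix D assume "D \<in> link a"
    then show "D \<in> (\<lambda>C. C - {Pos a}) ` T"
      by (intro image_eqI[of _ _ "insert (Pos a) D"]) (auto simp: link_def)
  qed
  show "finite ((\<lambda>C. C - {Pos a}) ` T)" using cnf by (simp add: cnf_theory_def)
qed

lemma remove_literal:
  assumes C: "C \<in> T" and l: "l \<in> C"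
  shows "two_clause (C - {l})" "atom_of l \<notin> atom_of ` (C - {l})" "atom_of ` (C - {l}) \<subseteq> V"
proof -
  have "card (C - {l}) = 2" using all3[OF C] l clauseD(1)[OF C] by simp
  then show "two_clause (C - {l})" using two_clause_card[OF C] by blast
  show "atom_of l \<notin> atom_of ` (C - {l})" using clauseD(4)[OF C] l by (auto simp: inj_on_def)
  show "atom_of ` (C - {l}) \<subseteq> V" using clauseD(3)[OF C] by auto
qed

lemma linkD:
  assumes "D \<in> link a"
  shows "two_clause D" "a \<notin> atom_of ` D" "atom_of ` D \<subseteq> V" "a \<in> V"
    "\<And>M. mm M \<Longrightarrow> a \<notin> M \<Longrightarrow> holds M D"
proof -
  have D: "Pos a \<notin> D" "insert (Pos a) D \<in> T" using assms by (auto simp: link_def)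
  then show "two_clause D" "a \<notin> atom_of ` D" "atom_of ` D \<subseteq> V"
    using remove_literal[OF D(2), of "Pos a"] by auto
  show "a \<in> V" using clauseD(3)[OF D(2)] by auto
  show "holds M D" if "mm M" "a \<notin> M" for M
    using minimal_model_holds[OF that(1) D(2)] that(2) by (auto simp: holds_def)
qed

lemma link_witness:
  assumes "mm M" "a \<in> M"
  shows "\<exists>D\<in>link a. \<forall>l\<in>D. \<not> true_literal M l"
proof -
  obtain D where "Pos a \<notin> D" "insert (Pos a) D \<in> T" "\<And>l. l \<in> D \<Longrightarrow> \<not> true_literal M l"
    by (rule minimal_model_witness[OF assms]) (rule that)
  then show ?thesis by (intro bexI[of _ D]) (auto simp: link_def)
qed

lemma state_neg: "a \<in> V \<Longrightarrow> state (\<lambda>M. a \<notin> M) [Neg a] {}"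
  and state_pos: "a \<in> V \<Longrightarrow> state (\<lambda>M. a \<in> M) [Pos a] {}"
  by (simp_all add: state_Nil)

lemma link_new_clause: "D \<in> link a \<Longrightarrow> new_clause (\<lambda>M. a \<notin> M) [Neg a] {} D"
  unfolding new_clause_def using linkD[of D a] by (simp add: subset_Diff_insert)

text \<open>If \<open>a\<close> is true, each of at most two witnesses fixes three literals; if it
  is false, one link clause is gained, and with an empty link no model contains
  \<open>a\<close>.\<close>

lemma link_small:
  assumes a: "a \<in> V" and card: "card (link a) \<le> 2"
  shows "bnd (\<lambda>_. True) 1"
proof -
  have yes: "bnd (\<lambda>M. a \<in> M) (card (link a) * t^3)"
  proof (rule bnd_UN[OF finite_link])
    show "\<exists>D\<in>link a. a \<in> M \<and> (\<forall>l\<in>D. \<not> true_literal M l)" if "mm M" "a \<in> M" for M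
      using link_witness[OF that] that(2) by blast
    fix D assume D: "D \<in> link a"
    obtain x y where xy: "D = {x, y}" "atom_of x \<noteq> atom_of y" using linkD(1)[OF D] by (rule two_clauseE)
    have "bnd (\<lambda>M. a \<in> M \<and> (\<forall>l\<in>D. \<not> true_literal M l)) (val [Pos a, flip x, flip y] {})"
      using linkD[OF D] xy by (intro state_bnd state_Nil) auto
    then show "bnd (\<lambda>M. a \<in> M \<and> (\<forall>l\<in>D. \<not> true_literal M l)) (t^3)"
      by (simp add: eval_nat_numeral)
  qed
  show ?thesis
  proof (cases "link a = {}")
    case True
    have "bnd (\<lambda>M. a \<notin> M) t" using state_bnd[OF state_neg[OF a]] by simp
    with yes show ?thesis by (rule bnd_cases) (use True t_upper in auto)
  next
    case False
    then obtain D where D: "D \<in> link a" by blast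
    have no: "bnd (\<lambda>M. a \<notin> M) (v * t)"
      using one_clause[OF state_neg[OF a] _ link_new_clause[OF D]] by simp
    have "real (card (link a)) * t^3 \<le> 2 * t^3"
      using card t_pos by (intro mult_right_mono) auto
    moreover have "2 * t^3 + v * t \<le> 1"
      using tv_le[of 1 1] t_le[of 3] by (simp add: power_numeral_reduce mult.commute[of v])
    ultimately show ?thesis by (intro bnd_cases[OF yes no]) auto
  qed
qed

text \<open>Every witness for \<open>a\<close> makes \<open>c\<close> false, so the branch with
  \<open>a\<close> true fixes two literals, and \<open>t + t^2 < 1\<close>.\<close>

lemma link_common:
  assumes a: "a \<in> V" and D: "D \<in> link a" and c: "\<And>D. D \<in> link a \<Longrightarrow> c \<in> D"
  shows "bnd (\<lambda>_. True) 1"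
proof -
  have cV: "atom_of c \<in> V" "atom_of c \<noteq> a" using linkD[OF D] c[OF D] by auto
  have "\<not> true_literal M c" if "mm M" "a \<in> M" for M using link_witness[OF that] c by blast
  then have "bnd (\<lambda>M. a \<in> M) (val [Pos a, flip c] {})"
    using a cV by (intro state_bnd state_Nil) auto
  moreover have "bnd (\<lambda>M. a \<notin> M) (val [Neg a] {})" using state_bnd[OF state_neg[OF a]] by simp
  ultimately show ?thesis
    by (rule bnd_cases) (use t_upper t_le[of 2] in \<open>auto simp: power2_eq_square\<close>)
qed

lemma link_three:
  assumes a: "a \<in> V" and card: "3 \<le> card (link a)" and common: "\<And>c. \<exists>D\<in>link a. c \<notin> D"
  shows "bnd (\<lambda>M. a \<notin> M) (phi3 * t)"
  using three_clauses[OF state_neg[OF a] _ link_new_clause card common] by simp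

text \<open>A negative occurrence yields a 2-clause in the branch where \<open>a\<close> is true,
  while the branch with \<open>a\<close> false gains three link clauses. This reduces the theory to
  positive clauses.\<close>

lemma negative_literal:
  assumes C: "C \<in> T" "Neg a \<in> C" and card: "3 \<le> card (link a)" and common: "\<And>c. \<exists>D\<in>link a. c \<notin> D"
  shows "bnd (\<lambda>_. True) 1"
proof -
  have "atom_of (Neg a) \<in> V" using clauseD(3)[OF C(1)] C(2) by blast
  then have a: "a \<in> V" by simp
  have "holds M (C - {Neg a})" if "mm M" "a \<in> M" for M
    using minimal_model_holds[OF that(1) C(1)] that(2) by (auto simp: holds_def)
  then have "new_clause (\<lambda>M. a \<in> M) [Pos a] {} (C - {Neg a})"
    using remove_literal[OF C] unfolding new_clause_def by auto
  then have "bnd (\<lambda>M. a \<in> M) (v * t)" using one_clause[OF state_pos[OF a]] by simp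
  moreover have "bnd (\<lambda>M. a \<notin> M) (phi3 * t)" using link_three[OF a card common] .
  ultimately show ?thesis
    by (rule bnd_cases)
      (use tv_le[of 1 1] tv_le[of 2 1] t_le[of 4] in
        \<open>auto simp: phi3_def algebra_simps power_numeral_reduce\<close>)
qed

end

section \<open>3-uniform hypergraphs\<close>

locale hypergraph_branching = branching3 t u v T for t u v and T :: "'a clause set" +
  assumes positive: "\<And>C l. C \<in> T \<Longrightarrow> l \<in> C \<Longrightarrow> \<exists>a. l = Pos a"
    and link_card: "\<And>a. a \<in> V \<Longrightarrow> 3 \<le> card (link a)"
    and link_no_common: "\<And>a c. a \<in> V \<Longrightarrow> \<exists>D\<in>link a. c \<notin> D"
begin

text \<open>The link graph of the vertex \<open>a\<close>: \<open>T\<close> is now a 3-uniform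
  hypergraph and its minimal models are the minimal transversals.\<close>

definition G :: "'a \<Rightarrow> 'a set set" where
  "G a = {e. Pos ` e \<in> link a}"

lemma link_eq: "link a = (`) Pos ` G a"
proof
  show "link a \<subseteq> (`) Pos ` G a"
  proof
    fix D assume D: "D \<in> link a"
    have "Pos (atom_of l) = l" if "l \<in> D" for l
      using D that positive[of "insert (Pos a) D" l] by (auto simp: link_def)
    then have "Pos ` atom_of ` D = D" by (force simp: image_image)
    then show "D \<in> (`) Pos ` G a" using D by (intro image_eqI[of _ _ "atom_of ` D"]) (auto simp: G_def)
  qed
qed (auto simp: G_def)

lemma inj_Pos: "inj Pos"
  by (simp add: inj_def)

lemma card_G: "a \<in> V \<Longrightarrow> 3 \<le> card (G a)"
proof -
  have "inj_on ((`) Pos) (G a)" using inj_Pos by (auto simp: inj_on_def inj_image_eq_iff)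
  then have "card (link a) = card (G a)" unfolding link_eq by (rule card_image)
  then show "a \<in> V \<Longrightarrow> 3 \<le> card (G a)" using link_card[of a] by simp
qed

lemma finite_G: "a \<in> V \<Longrightarrow> finite (G a)"
  using card_G[of a] card.infinite[of "G a"] by (cases "finite (G a)") auto

lemma G_no_common: "a \<in> V \<Longrightarrow> \<exists>e\<in>G a. c \<notin> e"
  using link_no_common[of a "Pos c"] unfolding link_eq by auto

lemma G_pair:
  assumes "{c, d} \<in> G a"
  shows "c \<noteq> d" "c \<noteq> a" "d \<noteq> a" "c \<in> V" "d \<in> V" "a \<in> V"
proof -
  have D: "{Pos c, Pos d} \<in> link a" using assms by (simp add: G_def)
  show "c \<noteq> d" "c \<noteq> a" "d \<noteq> a" "c \<in> V" "d \<in> V" "a \<in> V" using linkD(1-4)[OF D] by auto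
qed

lemma G_edge:
  assumes "e \<in> G a"
  obtains c d where "e = {c, d}"
proof -
  have "Pos ` e \<in> link a" using assms by (simp add: G_def)
  then have "two_clause (Pos ` e)" by (rule linkD)
  then obtain x y where "Pos ` e = {x, y}" by (rule two_clauseE)
  then have "atom_of ` Pos ` e = atom_of ` {x, y}" by simp
  then show thesis using that by (simp add: image_image)
qed

lemma G_edge_at:
  assumes "e \<in> G a" "c \<in> e"
  obtains d where "e = {c, d}"
proof -
  obtain x y where xy: "e = {x, y}" using G_edge[OF assms(1)] .
  then have "c = x \<or> c = y" using assms(2) by simp
  then show thesis using that[of x] that[of y] xy by (auto simp: insert_commute)
qed

lemma G_sym:
  assumes "{c, d} \<in> G a"
  shows "{a, d} \<in> G c"
proof -
  have "insert (Pos a) {Pos c, Pos d} \<in> T" using assms by (simp add: G_def link_def)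
  then have "insert (Pos c) {Pos a, Pos d} \<in> T" by (simp add: insert_commute)
  then show ?thesis using G_pair[OF assms] by (simp add: G_def link_def)
qed

lemma G_hit:
  assumes "{c, d} \<in> G a" "mm M" "a \<notin> M"
  shows "c \<in> M \<or> d \<in> M"
  using linkD(5)[of "{Pos c, Pos d}" a M] assms by (simp add: G_def)

lemma G_miss:
  assumes "mm M" "a \<in> M"
  shows "\<exists>e\<in>G a. e \<inter> M = {}"
proof -
  obtain D where D: "D \<in> link a" "\<forall>l\<in>D. \<not> true_literal M l" using link_witness[OF assms] by blast
  then obtain e where "e \<in> G a" "D = Pos ` e" unfolding link_eq by blast
  then show ?thesis using D(2) by (intro bexI[of _ e]) auto
qed

lemma bnd_cover:
  assumes "list_all2 bnd Ps xs" "\<And>M. mm M \<Longrightarrow> Q M \<Longrightarrow> \<exists>P\<in>set Ps. P M" "sum_list xs \<le> z"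
  shows "bnd Q z"
  using assms
proof (induction Ps xs arbitrary: Q z rule: list_all2_induct)
  case Nil
  then show ?case by (intro bnd_empty) auto
next
  case (Cons P Ps x xs)
  have "bnd (\<lambda>M. \<exists>P\<in>set Ps. P M) (sum_list xs)" by (rule Cons.IH) auto
  with Cons.hyps(1) show ?case by (rule bnd_cases) (use Cons.prems in auto)
qed

section \<open>Bounds for partial assignments with remaining 2-clauses\<close>

abbreviation pairs :: "('a \<times> 'a) list \<Rightarrow> 'a list" where
  "pairs es \<equiv> concat (map (\<lambda>(x, y). [x, y]) es)"

definition cube :: "'a list \<Rightarrow> 'a list \<Rightarrow> 'a set \<Rightarrow> bool" where
  "cube ps ns M \<longleftrightarrow> set ps \<subseteq> M \<and> set ns \<inter> M = {}"

lemma cube_simps [simp]: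
  "cube [] [] M" "cube (p # ps) ns M \<longleftrightarrow> p \<in> M \<and> cube ps ns M"
  "cube [] (q # ns) M \<longleftrightarrow> q \<notin> M \<and> cube [] ns M"
  by (auto simp: cube_def)

lemma cube_state:
  assumes "\<And>M. mm M \<Longrightarrow> Q M \<Longrightarrow> cube ps ns M" "distinct (ps @ ns)" "set (ps @ ns) \<subseteq> V"
  shows "state Q (map Pos ps @ map Neg ns) {}"
proof (rule state_Nil)
  have "map atom_of (map Pos ps @ map Neg ns) = ps @ ns" by (simp add: map_idI)
  then show "distinct (map atom_of (map Pos ps @ map Neg ns))" using assms(2) by simp
  show "atom_of ` set (map Pos ps @ map Neg ns) \<subseteq> V" using assms(3) by auto
  show "\<forall>l\<in>set (map Pos ps @ map Neg ns). true_literal M l" if "mm M" "Q M" for M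
    using assms(1)[OF that] by (auto simp: cube_def)
qed

lemma cube_new_clause:
  assumes "{x, y} \<subseteq> V - set (ps @ ns)" "x \<noteq> y" "\<And>M. mm M \<Longrightarrow> Q M \<Longrightarrow> x \<in> M \<or> y \<in> M"
  shows "new_clause Q (map Pos ps @ map Neg ns) {} {Pos x, Pos y}"
  using assms unfolding new_clause_def by (auto simp: image_iff)

lemma bnd_cube:
  assumes Q: "\<And>M. mm M \<Longrightarrow> Q M \<Longrightarrow> cube ps ns M \<and> (\<forall>(x, y)\<in>set es. x \<in> M \<or> y \<in> M)"
    and dist: "distinct (ps @ ns @ pairs es)" and V: "set (ps @ ns @ pairs es) \<subseteq> V" and ne: "ps @ ns \<noteq> []"
  shows "bnd Q (t^(length ps + length ns) * v^length es)"
proof -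
  let ?ls = "map Pos ps @ map Neg ns"
  have "\<exists>K. state Q ?ls K \<and> card K = length es \<and> (\<Union>C\<in>K. atom_of ` C) = set (pairs es)"
    using Q dist V
  proof (induction es)
    case Nil
    have "state Q ?ls {}" using Nil by (intro cube_state) auto
    then show ?case by (intro exI[of _ "{}"]) auto
  next
    case (Cons e es)
    obtain x y where e: "e = (x, y)" by (cases e)
    have "\<exists>K. state Q ?ls K \<and> card K = length es \<and> (\<Union>C\<in>K. atom_of ` C) = set (pairs es)"
    proof (rule Cons.IH)
      show "cube ps ns M \<and> (\<forall>(x, y)\<in>set es. x \<in> M \<or> y \<in> M)" if "mm M" "Q M" for M
        using Cons.prems(1)[OF that] by simp
      show "distinct (ps @ ns @ pairs es)" "set (ps @ ns @ pairs es) \<subseteq> V"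
        using Cons.prems(2,3) e by auto
    qed
    then obtain K where K: "state Q ?ls K" "card K = length es" "(\<Union>C\<in>K. atom_of ` C) = set (pairs es)"
      by blast
    have xy: "x \<noteq> y" "x \<notin> set (pairs es)" "y \<notin> set (pairs es)" "{x, y} \<subseteq> V - set (ps @ ns)"
      using Cons.prems(2,3) e by auto
    have un: "touched K (atom_of ` {Pos x, Pos y}) = {}"
      using xy(2,3) unfolding K(3)[symmetric] by (auto simp: touched_def)
    have "new_clause Q ?ls {} {Pos x, Pos y}"
      using Cons.prems(1) e xy by (intro cube_new_clause) auto
    then have st: "state Q ?ls (insert {Pos x, Pos y} K)"
      using un by (intro state_insert(1)[OF K(1)]) (auto simp: new_clause_def)
    have "{Pos x, Pos y} \<notin> K" using un by (auto simp: touched_def)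
    moreover have "finite K" using K(1) by (auto simp: state_def matching_def)
    ultimately have "card (insert {Pos x, Pos y} K) = length (e # es)" using K(2) by simp
    moreover have "(\<Union>C\<in>insert {Pos x, Pos y} K. atom_of ` C) = set (pairs (e # es))"
      using K(3) e by simp
    ultimately show ?case using st by blast
  qed
  then obtain K where "state Q ?ls K" "card K = length es" by blast
  then show ?thesis using state_bnd[of Q ?ls K] ne by (simp add: val_def)
qed

lemma bnd_two_edges:
  assumes Q: "\<And>M. mm M \<Longrightarrow> Q M \<Longrightarrow> cube ps ns M \<and> (x \<in> M \<or> y \<in> M) \<and> (x' \<in> M \<or> y' \<in> M)"
    and dist: "distinct (ps @ ns)" "set (ps @ ns) \<subseteq> V" "ps @ ns \<noteq> []"
    and e: "{x, y} \<subseteq> V - set (ps @ ns)" "{x', y'} \<subseteq> V - set (ps @ ns)" "x \<noteq> y" "x' \<noteq> y'"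
      "{x, y} \<noteq> {x', y'}"
  shows "bnd Q (t^(length ps + length ns) * v^2)"
proof -
  have "state Q (map Pos ps @ map Neg ns) {}" using Q dist by (intro cube_state) auto
  moreover have "new_clause Q (map Pos ps @ map Neg ns) {} {Pos x, Pos y}"
    using Q e by (intro cube_new_clause) auto
  moreover have "new_clause Q (map Pos ps @ map Neg ns) {} {Pos x', Pos y'}"
    using Q e by (intro cube_new_clause) auto
  moreover have "{Pos x, Pos y} \<noteq> {Pos x', Pos y'}" using e(5) by (auto simp: doubleton_eq_iff)
  ultimately show ?thesis
    using two_clauses[of Q "map Pos ps @ map Neg ns"] dist(3) by (simp add: mult.commute)
qed

text \<open>
  If the vertex \<open>c\<close> is left out, every edge \<open>{c, x, y}\<close> that is not already satisfied shrinks to the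
  2-clause \<open>{x, y}\<close>, or to a unit clause, which is even better.
\<close>

lemma bnd_gain:
  assumes Q: "\<And>M. mm M \<Longrightarrow> Q M \<Longrightarrow> cube ps ns M"
    and dist: "distinct (ps @ ns)" "set (ps @ ns) \<subseteq> V" and c: "c \<in> set ns"
    and e: "{x, y} \<in> G c" "x \<notin> set ps" "y \<notin> set ps"
  shows "bnd Q (t^(length ps + length ns) * v)"
proof -
  have hit: "x \<in> M \<or> y \<in> M" if "mm M" "Q M" for M
    using G_hit[OF e(1) that(1)] Q[OF that] c by (auto simp: cube_def)
  have forced: "bnd Q (t^(length ps + length ns) * v)"
    if zw: "z \<in> set ns" "w \<in> V" "w \<notin> set ps" and zM: "\<And>M. mm M \<Longrightarrow> Q M \<Longrightarrow> z \<in> M \<or> w \<in> M" for z w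
  proof -
    have w: "w \<in> M" if "mm M" "Q M" for M
      using zM[OF that] Q[OF that] zw(1) by (auto simp: cube_def)
    show ?thesis
    proof (cases "w \<in> set ns")
      case True
      have "\<not> Q M" if "mm M" for M
        using w[OF that] Q[OF that] True by (auto simp: cube_def)
      then show ?thesis using t_pos v_pos by (intro bnd_empty) auto
    next
      case False
      have "bnd Q (t^(length (w # ps) + length ns) * v^length ([] :: ('a \<times> 'a) list))"
        using w Q dist zw False by (intro bnd_cube) auto
      moreover have "t * t^(length ps + length ns) \<le> v * t^(length ps + length ns)"
        using t_pos t_upper v_lower by (intro mult_right_mono) auto
      ultimately show ?thesis by (elim bnd_mono) (auto simp: mult_ac)
    qed
  qed
  show ?thesis
  proof (cases "x \<in> set ns \<or> y \<in> set ns")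
    case True
    then show ?thesis using forced[of x y] forced[of y x] hit e G_pair[OF e(1)] by blast
  next
    case False
    have "bnd Q (t^(length ps + length ns) * v^length [(x, y)])"
      using Q hit dist c e(2,3) False G_pair[OF e(1)] by (intro bnd_cube) auto
    then show ?thesis by simp
  qed
qed


section \<open>Branchings for the shapes of a link graph\<close>

definition cube_edges :: "'a list \<Rightarrow> 'a list \<Rightarrow> ('a \<times> 'a) list \<Rightarrow> 'a set \<Rightarrow> bool" where
  "cube_edges ps ns es M \<longleftrightarrow> cube ps ns M \<and> (\<forall>(x, y)\<in>set es. x \<in> M \<or> y \<in> M)"

lemma bnd_cube_edges:
  assumes "distinct (ps @ ns @ pairs es)" "set (ps @ ns @ pairs es) \<subseteq> V" "ps @ ns \<noteq> []"
    "i = length ps + length ns" "j = length es"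
  shows "bnd (cube_edges ps ns es) (t^i * v^j)"
  using bnd_cube[of "cube_edges ps ns es" ps ns es] assms by (auto simp: cube_edges_def)

lemma bnd_cube_edges_two:
  assumes "distinct (ps @ ns)" "set (ps @ ns) \<subseteq> V" "ps @ ns \<noteq> []"
    "{x, y} \<subseteq> V - set (ps @ ns)" "{x', y'} \<subseteq> V - set (ps @ ns)" "x \<noteq> y" "x' \<noteq> y'" "{x, y} \<noteq> {x', y'}"
    "i = length ps + length ns"
  shows "bnd (cube_edges ps ns [(x, y), (x', y')]) (t^i * v^2)"
  unfolding assms(9) using assms by (intro bnd_two_edges) (auto simp: cube_edges_def)

text \<open>If \<open>a\<close> is true, a link edge is missed: then \<open>c\<close> is false, or
  \<open>c\<close> is true and the one edge off the star is missed. If \<open>a\<close> is false,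
  two disjoint clauses are gained.\<close>

lemma star_and_edge:
  assumes cd: "{c, d} \<in> G a" and xy: "{x, y} \<in> G a" and dis: "{c, d} \<inter> {x, y} = {}"
    and rest: "\<And>e. e \<in> G a \<Longrightarrow> c \<in> e \<or> e = {x, y}"
  shows "bnd (\<lambda>_. True) 1"
proof (rule bnd_cover)
  note p = G_pair[OF cd] G_pair[OF xy] dis
  have "bnd (cube_edges [] [a] [(c, d), (x, y)]) (t^1 * v^2)" by (rule bnd_cube_edges) (use p in auto)
  moreover have "bnd (cube_edges [a] [c] []) (t^2 * v^0)" by (rule bnd_cube_edges) (use p in auto)
  moreover have "bnd (cube_edges [a, c] [x, y] []) (t^4 * v^0)" by (rule bnd_cube_edges) (use p in auto)
  ultimately show "list_all2 bnd [cube_edges [] [a] [(c, d), (x, y)], cube_edges [a] [c] [], cube_edges [a, c] [x, y] []]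
      [t^1 * v^2, t^2 * v^0, t^4 * v^0]" by simp
  show "sum_list [t^1 * v^2, t^2 * v^0, t^4 * v^0] \<le> 1"
    using tv_le[of 1 2] tv_le[of 2 0] tv_le[of 4 0] by (simp add: power_divide)
  fix M assume M: "mm M"
  show "\<exists>P\<in>set [cube_edges [] [a] [(c, d), (x, y)], cube_edges [a] [c] [], cube_edges [a, c] [x, y] []]. P M"
  proof (cases "a \<in> M")
    case True
    obtain e where "e \<in> G a" "e \<inter> M = {}" using G_miss[OF M True] by blast
    then show ?thesis using True rest[of e] by (cases "c \<in> M") (auto simp: cube_edges_def)
  next
    case False
    then show ?thesis using G_hit[OF cd M] G_hit[OF xy M] by (simp add: cube_edges_def)
  qed
qed

text \<open>With \<open>a\<close> false, \<open>c\<close> false forces its three neighbours, and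
  \<open>c\<close> true leaves two edges off \<open>c\<close> as clauses. If only one edge avoids
  \<open>c\<close>, the link is a star and an edge.\<close>

lemma degree_three:
  assumes c: "{c, d} \<in> G a" "{c, e} \<in> G a" "{c, f} \<in> G a" and def: "d \<noteq> e" "d \<noteq> f" "e \<noteq> f"
  shows "bnd (\<lambda>_. True) 1"
proof -
  have a: "a \<in> V" using G_pair[OF c(1)] by blast
  obtain r where r: "r \<in> G a" "c \<notin> r" using G_no_common[OF a] by blast
  obtain x y where xy: "r = {x, y}" using G_edge[OF r(1)] .
  show ?thesis
  proof (cases "\<exists>r'\<in>G a. c \<notin> r' \<and> r' \<noteq> r")
    case False
    have "\<exists>d. {c, d} \<in> G a \<and> d \<notin> {x, y}" using c def by (cases "d \<in> {x, y}"; cases "e \<in> {x, y}") auto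
    then obtain d where "{c, d} \<in> G a" "d \<notin> {x, y}" by blast
    then show ?thesis using False r xy by (intro star_and_edge[of c d a x y]) auto
  next
    case True
    then obtain r' where r': "r' \<in> G a" "c \<notin> r'" "r' \<noteq> r" by blast
    obtain x' y' where xy': "r' = {x', y'}" using G_edge[OF r'(1)] .
    have rr: "{x, y} \<in> G a" "{x', y'} \<in> G a" using r(1) r'(1) xy xy' by auto
    note p = G_pair[OF c(1)] G_pair[OF c(2)] G_pair[OF c(3)] G_pair[OF rr(1)] G_pair[OF rr(2)]
    let ?Ps = "[cube_edges [a] [] [], cube_edges [c] [a] [(x, y), (x', y')], cube_edges [d, e, f] [a, c] []]"
    show ?thesis
    proof (rule bnd_cover)
      have "bnd (cube_edges [a] [] []) (t^1 * v^0)" by (rule bnd_cube_edges) (use p in auto)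
      moreover have "bnd (cube_edges [c] [a] [(x, y), (x', y')]) (t^2 * v^2)"
        by (rule bnd_cube_edges_two) (use p r r' xy xy' in auto)
      moreover have "bnd (cube_edges [d, e, f] [a, c] []) (t^5 * v^0)" by (rule bnd_cube_edges) (use p def in auto)
      ultimately show "list_all2 bnd ?Ps [t^1 * v^0, t^2 * v^2, t^5 * v^0]" by simp
      show "sum_list [t^1 * v^0, t^2 * v^2, t^5 * v^0] \<le> 1"
        using tv_le[of 1 0] tv_le[of 2 2] tv_le[of 5 0] by (simp add: power_divide)
      fix M assume M: "mm M"
      show "\<exists>P\<in>set ?Ps. P M"
        using G_hit[OF c(1) M] G_hit[OF c(2) M] G_hit[OF c(3) M] G_hit[OF rr(1) M] G_hit[OF rr(2) M]
        by (cases "a \<in> M"; cases "c \<in> M") (simp_all add: cube_edges_def)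
    qed
  qed
qed

text \<open>If \<open>a\<close> is false, at least two of \<open>c\<close>, \<open>d\<close>,
  \<open>e\<close> are true; if \<open>a\<close> is true, an edge is missed and at most one of them
  is.\<close>

lemma triangle:
  assumes G: "G a = {{c, d}, {c, e}, {d, e}}"
  shows "bnd (\<lambda>_. True) 1"
proof (rule bnd_cover)
  have cde: "{c, d} \<in> G a" "{c, e} \<in> G a" "{d, e} \<in> G a" using G by auto
  note p = G_pair[OF cde(1)] G_pair[OF cde(2)] G_pair[OF cde(3)]
  let ?Ps = "[cube_edges [c, d] [a] [], cube_edges [a] [c, d] [], cube_edges [c, e] [a, d] [], cube_edges [a, c] [d, e] [],
    cube_edges [d, e] [a, c] [], cube_edges [a, d] [c, e] []]"
  have "bnd (cube_edges [c, d] [a] []) (t^3 * v^0)" by (rule bnd_cube_edges) (use p in auto)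
  moreover have "bnd (cube_edges [a] [c, d] []) (t^3 * v^0)" by (rule bnd_cube_edges) (use p in auto)
  moreover have "bnd (cube_edges [c, e] [a, d] []) (t^4 * v^0)" by (rule bnd_cube_edges) (use p in auto)
  moreover have "bnd (cube_edges [a, c] [d, e] []) (t^4 * v^0)" by (rule bnd_cube_edges) (use p in auto)
  moreover have "bnd (cube_edges [d, e] [a, c] []) (t^4 * v^0)" by (rule bnd_cube_edges) (use p in auto)
  moreover have "bnd (cube_edges [a, d] [c, e] []) (t^4 * v^0)" by (rule bnd_cube_edges) (use p in auto)
  ultimately show "list_all2 bnd ?Ps [t^3 * v^0, t^3 * v^0, t^4 * v^0, t^4 * v^0, t^4 * v^0, t^4 * v^0]"
    by simp
  show "sum_list [t^3 * v^0, t^3 * v^0, t^4 * v^0, t^4 * v^0, t^4 * v^0, t^4 * v^0] \<le> 1"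
    using tv_le[of 3 0] tv_le[of 4 0] by (simp add: power_divide)
  fix M assume M: "mm M"
  have "\<not> (c \<in> M \<and> d \<in> M \<or> c \<in> M \<and> e \<in> M \<or> d \<in> M \<and> e \<in> M)" if a: "a \<in> M"
    using G_miss[OF M a] unfolding G by auto
  then show "\<exists>P\<in>set ?Ps. P M"
    using G_hit[OF cde(1) M] G_hit[OF cde(2) M] G_hit[OF cde(3) M]
    by (cases "a \<in> M"; cases "c \<in> M"; cases "d \<in> M"; cases "e \<in> M") (simp_all add: cube_edges_def)
qed

text \<open>Every edge meets \<open>{p, q}\<close>, so \<open>a\<close>, \<open>p\<close> and
  \<open>q\<close> are never all true.\<close>

lemma two_stars:
  assumes G: "G a = {{p, p1}, {p, p2}, {q, q1}, {q, q2}}"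
    and ne: "p1 \<noteq> p2" "q1 \<noteq> q2" "p \<noteq> q" "q \<noteq> p1" "q \<noteq> p2" "p \<noteq> q1" "p \<noteq> q2"
  shows "bnd (\<lambda>_. True) 1"
proof (rule bnd_cover)
  have e: "{p, p1} \<in> G a" "{p, p2} \<in> G a" "{q, q1} \<in> G a" "{q, q2} \<in> G a" using G by auto
  note p = G_pair[OF e(1)] G_pair[OF e(2)] G_pair[OF e(3)] G_pair[OF e(4)] ne
  let ?Ps = "[cube_edges [a] [p] [], cube_edges [a, p] [q] [], cube_edges [p, q] [a] [], cube_edges [p, q1, q2] [a, q] [],
    cube_edges [p1, p2] [a, p] []]"
  have "bnd (cube_edges [a] [p] []) (t^2 * v^0)" by (rule bnd_cube_edges) (use p in auto)
  moreover have "bnd (cube_edges [a, p] [q] []) (t^3 * v^0)" by (rule bnd_cube_edges) (use p in auto)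
  moreover have "bnd (cube_edges [p, q] [a] []) (t^3 * v^0)" by (rule bnd_cube_edges) (use p in auto)
  moreover have "bnd (cube_edges [p, q1, q2] [a, q] []) (t^5 * v^0)" by (rule bnd_cube_edges) (use p in auto)
  moreover have "bnd (cube_edges [p1, p2] [a, p] []) (t^4 * v^0)" by (rule bnd_cube_edges) (use p in auto)
  ultimately show "list_all2 bnd ?Ps [t^2 * v^0, t^3 * v^0, t^3 * v^0, t^5 * v^0, t^4 * v^0]" by simp
  show "sum_list [t^2 * v^0, t^3 * v^0, t^3 * v^0, t^5 * v^0, t^4 * v^0] \<le> 1"
    using tv_le[of 2 0] tv_le[of 3 0] tv_le[of 4 0] tv_le[of 5 0] by (simp add: power_divide)
  fix M assume M: "mm M"
  have "p \<notin> M \<or> q \<notin> M" if a: "a \<in> M"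
    using G_miss[OF M a] unfolding G by auto
  then show "\<exists>P\<in>set ?Ps. P M"
    using G_hit[OF e(1) M] G_hit[OF e(2) M] G_hit[OF e(3) M] G_hit[OF e(4) M]
    by (cases "a \<in> M"; cases "p \<in> M"; cases "q \<in> M") (simp_all add: cube_edges_def)
qed

text \<open>Here \<open>f = d\<close> is allowed: the first three edges form a path or a triangle.\<close>

lemma path_and_edge:
  assumes G: "G a = {{c, d}, {c, e}, {e, f}, {g, h}}"
    and ne: "d \<noteq> e" "f \<noteq> c" "{g, h} \<inter> {c, d, e, f} = {}"
  shows "bnd (\<lambda>_. True) 1"
proof -
  have E: "{c, d} \<in> G a" "{c, e} \<in> G a" "{e, f} \<in> G a" "{g, h} \<in> G a" using G by auto
  note p = G_pair[OF E(1)] G_pair[OF E(2)] G_pair[OF E(3)] G_pair[OF E(4)] ne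
  have b1: "bnd (cube_edges [c] [a] [(e, f), (g, h)]) (t^2 * v^2)" by (rule bnd_cube_edges) (use p in auto)
  have b2: "bnd (cube_edges [d, e] [a, c] [(g, h)]) (t^4 * v^1)" by (rule bnd_cube_edges) (use p in auto)
  have b3: "bnd (cube_edges [a, c] [g, h] [(e, f)]) (t^4 * v^1)" by (rule bnd_cube_edges) (use p in auto)
  have b4: "bnd (cube_edges [a, d, e] [c, g, h] []) (t^6 * v^0)" by (rule bnd_cube_edges) (use p in auto)
  let ?Ps = "[cube_edges [c] [a] [(e, f), (g, h)], cube_edges [d, e] [a, c] [(g, h)], cube_edges [a, c] [g, h] [(e, f)],
    cube_edges [a, d, e] [c, g, h] [], cube [a] [c, d], cube [a, d] [c, e], cube [a, c] [e, f]]"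
  have cover: "\<exists>P\<in>set ?Ps. P M" if M: "mm M" for M
  proof -
    have "{c, d} \<inter> M = {} \<or> {c, e} \<inter> M = {} \<or> {e, f} \<inter> M = {} \<or> {g, h} \<inter> M = {}" if a: "a \<in> M"
      using G_miss[OF M a] unfolding G by auto
    then show ?thesis
      using G_hit[OF E(1) M] G_hit[OF E(2) M] G_hit[OF E(3) M] G_hit[OF E(4) M]
      by (cases "a \<in> M"; cases "c \<in> M"; cases "d \<in> M"; cases "e \<in> M"; cases "f \<in> M")
        (simp_all add: cube_edges_def)
  qed
  \<comment> \<open>0.4274 is what \<open>b1\<close> to \<open>b4\<close> leave over. The plain
    shares \<open>t^3\<close>, \<open>t^4\<close>, \<open>t^4\<close> of the other three cubes add
    up to about 0.472, so hyperedges that avoid \<open>a\<close> have to help.\<close>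
  have fin: ?thesis if "bnd (cube [a] [c, d]) x" "bnd (cube [a, d] [c, e]) y" "bnd (cube [a, c] [e, f]) z"
    "x + y + z \<le> 0.4274" for x y z
  proof (rule bnd_cover[OF _ cover])
    show "list_all2 bnd ?Ps [t^2 * v^2, t^4 * v^1, t^4 * v^1, t^6 * v^0, x, y, z]"
      using b1 b2 b3 b4 that(1-3) by simp
    show "sum_list [t^2 * v^2, t^4 * v^1, t^4 * v^1, t^6 * v^0, x, y, z] \<le> 1"
      using tv_le[of 2 2] tv_le[of 4 1] tv_le[of 6 0] that(4) by (simp add: power_divide mult.commute[of v])
  qed
  have plain: "bnd (cube ps ns) (t^i * v^0)"
    if "distinct (ps @ ns)" "set (ps @ ns) \<subseteq> V" "ps @ ns \<noteq> []" "i = length ps + length ns" for ps ns i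
    using bnd_cube_edges[of ps ns "[]" i 0] that by (simp add: cube_edges_def[abs_def])
  \<comment> \<open>At most two hyperedges through \<open>b\<close> contain \<open>a\<close>, but at
    least three pass through \<open>b\<close>.\<close>
  have third: "\<exists>x y. {x, y} \<in> G b \<and> a \<notin> {x, y}"
    if b: "b \<in> V" and G2: "\<And>w. {b, w} \<in> G a \<Longrightarrow> w = m \<or> w = n" for b m n
  proof (rule ccontr)
    assume no: "\<nexists>x y. {x, y} \<in> G b \<and> a \<notin> {x, y}"
    have "G b \<subseteq> {{a, m}, {a, n}}"
    proof
      fix r assume r: "r \<in> G b"
      then have "a \<in> r" using no by (metis G_edge)
      then obtain w where w: "r = {a, w}" using G_edge_at[OF r] by blast
      then have "{b, w} \<in> G a" using G_sym[of a w b] r by simp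
      then show "r \<in> {{a, m}, {a, n}}" using G2 w by blast
    qed
    then have "card (G b) \<le> card {{a, m}, {a, n}}" by (intro card_mono) auto
    also have "\<dots> \<le> 2" by (simp add: card_insert_if)
    finally show False using card_G[OF b] by simp
  qed
  show ?thesis
  \<comment> \<open>A hyperedge \<open>{c, d, x}\<close> forces \<open>x\<close> once
    \<open>c\<close> and \<open>d\<close> are false. If there is none, the hyperedge at
    \<open>c\<close> off \<open>a\<close> avoids \<open>d\<close> as well and is not satisfied by
    making \<open>d\<close> true.\<close>
  proof (cases "\<exists>x. {d, x} \<in> G c \<and> x \<noteq> a")
    case True
    then obtain x where x: "{d, x} \<in> G c" "x \<noteq> a" by blast
    have "bnd (cube [a, x] [c, d]) (t^4 * v^0)" by (rule plain) (use p x G_pair[OF x(1)] in auto)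
    moreover have "cube [a, x] [c, d] M" if "mm M" "cube [a] [c, d] M" for M
      using G_hit[OF x(1) that(1)] that(2) by auto
    ultimately have "bnd (cube [a] [c, d]) (t^4 * v^0)" by (rule bnd_mono) auto
    moreover have "bnd (cube [a, d] [c, e]) (t^4 * v^0)" by (rule plain) (use p in auto)
    moreover have "bnd (cube [a, c] [e, f]) (t^4 * v^0)" by (rule plain) (use p in auto)
    ultimately show ?thesis by (rule fin) (use tv_le[of 4 0] in \<open>simp add: power_divide mult.commute[of v]\<close>)
  next
    case no_d: False
    obtain x y where xy: "{x, y} \<in> G c" "a \<notin> {x, y}"
      using third[of c d e] p G by (auto simp: doubleton_eq_iff)
    have dxy: "d \<notin> {x, y}" using no_d xy by (auto simp: insert_commute)
    have 1: "bnd (cube [a] [c, d]) (t^3 * v^1)"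
      using bnd_gain[of "cube [a] [c, d]" "[a]" "[c, d]" c x y] p xy by (auto simp: eval_nat_numeral)
    obtain m n where mn: "{m, n} \<in> G e" "a \<notin> {m, n}"
      using third[of e c f] p G by (auto simp: doubleton_eq_iff)
    show ?thesis
    \<comment> \<open>A hyperedge at \<open>e\<close> containing \<open>c\<close> is satisfied where
      \<open>c\<close> is true, but it forces its third vertex in the cube where \<open>c\<close>
      and \<open>e\<close> are both false.\<close>
    proof (cases "c \<in> {m, n}")
      case False
      have "bnd (cube [a, d] [c, e]) (t^4 * v^1)"
        using bnd_gain[of "cube [a, d] [c, e]" "[a, d]" "[c, e]" c x y] p xy dxy by (auto simp: eval_nat_numeral)
      moreover have "bnd (cube [a, c] [e, f]) (t^4 * v^1)"
        using bnd_gain[of "cube [a, c] [e, f]" "[a, c]" "[e, f]" e m n] p mn False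
        by (auto simp: eval_nat_numeral)
      ultimately show ?thesis
        by (rule fin[OF 1]) (use tv_le[of 3 1] tv_le[of 4 1] in \<open>simp add: power_divide mult.commute[of v]\<close>)
    next
      case True
      then obtain q where q: "{c, q} \<in> G e" "q \<noteq> a" using mn by (auto simp: insert_commute)
      have eq: "{e, q} \<in> G c" using G_sym[OF q(1)] .
      then have "q \<noteq> d" using no_d p by (auto simp: insert_commute)
      then have "bnd (cube [a, d, q] [c, e]) (t^5 * v^0)"
        by (intro plain) (use p q G_pair[OF eq] in auto)
      moreover have "cube [a, d, q] [c, e] M" if "mm M" "cube [a, d] [c, e] M" for M
        using G_hit[OF eq that(1)] that(2) by auto
      ultimately have "bnd (cube [a, d] [c, e]) (t^5 * v^0)" by (rule bnd_mono) auto
      moreover have "bnd (cube [a, c] [e, f]) (t^4 * v^0)" by (rule plain) (use p in auto)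
      ultimately show ?thesis
        by (rule fin[OF 1]) (use tv_le[of 3 1] tv_le[of 4 0] tv_le[of 5 0] in \<open>simp add: power_divide mult.commute[of v]\<close>)
    qed
  qed
qed


text \<open>For \<open>a\<close> true, split by the first missed edge, the earlier edges remaining
  as clauses. The resulting shares suffice only with an extra clause, from a hyperedge off
  \<open>a\<close>, in the first two of these cases.\<close>

lemma three_disjoint_edges:
  assumes G: "G a = {{c, d}, {e, f}, {g, h}}" and dist: "distinct [c, d, e, f, g, h]"
  shows "bnd (\<lambda>_. True) 1"
proof (rule bnd_cover)
  have E: "{c, d} \<in> G a" "{e, f} \<in> G a" "{g, h} \<in> G a" using G by auto
  note p = G_pair[OF E(1)] G_pair[OF E(2)] G_pair[OF E(3)] dist
  have more: "\<exists>r1 r2. r1 \<in> G b \<and> r2 \<in> G b \<and> r1 \<noteq> r2 \<and> a \<notin> r1 \<and> a \<notin> r2"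
    if b: "b \<in> V" and uniq: "\<And>w. {b, w} \<in> G a \<Longrightarrow> w = m" for b m
  proof -
    have "G b - {{a, m}} \<subseteq> {r \<in> G b. a \<notin> r}"
    proof
      fix r assume r: "r \<in> G b - {{a, m}}"
      have "a \<notin> r"
      proof
        assume "a \<in> r"
        then obtain w where w: "r = {a, w}" using G_edge_at[of r b a] r by blast
        then have "{b, w} \<in> G a" using G_sym[of a w b] r by simp
        then show False using uniq w r by blast
      qed
      then show "r \<in> {r \<in> G b. a \<notin> r}" using r by blast
    qed
    then have "card (G b - {{a, m}}) \<le> card {r \<in> G b. a \<notin> r}"
      using finite_G[OF b] by (intro card_mono) auto
    moreover have "card (G b) - 1 \<le> card (G b - {{a, m}})" by (simp add: card_Diff_singleton_if)
    ultimately have "2 \<le> card {r \<in> G b. a \<notin> r}" using card_G[OF b] by linarith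
    then obtain R where "R \<subseteq> {r \<in> G b. a \<notin> r}" "card R = 2" by (meson obtain_subset_with_card_n)
    then show ?thesis by (auto simp: card_2_iff)
  qed
  have b1: "bnd (cube_edges [] [a] [(c, d), (e, f), (g, h)]) (t^1 * v^3)" by (rule bnd_cube_edges) (use p in auto)
  have b2: "bnd (cube [a] [c, d]) (t^3 * v^1)"
  proof -
    obtain r where r: "r \<in> G c" "a \<notin> r"
      using more[of c d] p G by (auto simp: doubleton_eq_iff)
    obtain x y where xy: "r = {x, y}" using G_edge[OF r(1)] .
    then show ?thesis
      using bnd_gain[of "cube [a] [c, d]" "[a]" "[c, d]" c x y] p r by (auto simp: eval_nat_numeral)
  qed
  have b3: "bnd (cube_edges [a] [e, f] [(c, d)]) (t^3 * v^2)"
  proof -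
    \<comment> \<open>Two hyperedges are taken since one of them could be \<open>{e, c, d}\<close>,
      whose clause \<open>{c, d}\<close> is already counted.\<close>
    have "\<exists>r1 r2. r1 \<in> G e \<and> r2 \<in> G e \<and> r1 \<noteq> r2 \<and> a \<notin> r1 \<and> a \<notin> r2"
      by (rule more[of e f]) (use p G in \<open>auto simp: doubleton_eq_iff\<close>)
    then obtain r where r: "r \<in> G e" "a \<notin> r" "r \<noteq> {c, d}" by metis
    obtain x y where xy: "r = {x, y}" using G_edge[OF r(1)] .
    have rxy: "{x, y} \<in> G e" using r(1) xy by simp
    note q = G_pair[OF rxy]
    have forced: ?thesis if w: "{f, w} \<in> G e" "w \<noteq> a" for w
    proof -
      have "bnd (cube_edges [a, w] [e, f] []) (t^4 * v^0)" by (rule bnd_cube_edges) (use p w G_pair[OF w(1)] in auto)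
      moreover have "cube_edges [a, w] [e, f] [] M" if "mm M" "cube_edges [a] [e, f] [(c, d)] M" for M
        using G_hit[OF w(1) that(1)] that(2) by (auto simp: cube_edges_def)
      moreover have "t^4 * v^0 \<le> t^3 * v^2"
      proof -
        have "t \<le> v^2" using power_mono[of "0.9047" v 2] v_lower t_upper by (simp add: power2_eq_square)
        then have "t^3 * t \<le> t^3 * v^2" using t_pos by (intro mult_left_mono) auto
        then show ?thesis by (simp add: eval_nat_numeral mult_ac)
      qed
      ultimately show ?thesis by (rule bnd_mono)
    qed
    show ?thesis
    proof (cases "f \<in> {x, y}")
      case True
      then show ?thesis using forced[of x] forced[of y] rxy r(2) xy by (auto simp: insert_commute)
    next
      case False
      have "bnd (cube_edges [a] [e, f] [(c, d), (x, y)]) (t^3 * v^2)"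
        by (rule bnd_cube_edges_two) (use p q r xy False in auto)
      moreover have "cube_edges [a] [e, f] [(c, d), (x, y)] M" if "mm M" "cube_edges [a] [e, f] [(c, d)] M" for M
        using G_hit[OF rxy that(1)] that(2) by (auto simp: cube_edges_def)
      ultimately show ?thesis by (rule bnd_mono) auto
    qed
  qed
  have b4: "bnd (cube_edges [a] [g, h] [(c, d), (e, f)]) (t^3 * v^2)" by (rule bnd_cube_edges) (use p in auto)
  let ?Ps = "[cube_edges [] [a] [(c, d), (e, f), (g, h)], cube [a] [c, d], cube_edges [a] [e, f] [(c, d)],
    cube_edges [a] [g, h] [(c, d), (e, f)]]"
  show "list_all2 bnd ?Ps [t^1 * v^3, t^3 * v^1, t^3 * v^2, t^3 * v^2]" using b1 b2 b3 b4 by simp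
  show "sum_list [t^1 * v^3, t^3 * v^1, t^3 * v^2, t^3 * v^2] \<le> 1"
    using tv_le[of 1 3] tv_le[of 3 1] tv_le[of 3 2] by (simp add: power_divide mult.commute[of v])
  fix M assume M: "mm M"
  have "{c, d} \<inter> M = {} \<or> {e, f} \<inter> M = {} \<or> {g, h} \<inter> M = {}" if a: "a \<in> M"
    using G_miss[OF M a] unfolding G by auto
  then show "\<exists>P\<in>set ?Ps. P M"
    using G_hit[OF E(1) M] G_hit[OF E(2) M] G_hit[OF E(3) M]
    by (cases "a \<in> M"; cases "c \<in> M"; cases "d \<in> M"; cases "e \<in> M"; cases "f \<in> M")
      (simp_all add: cube_edges_def)
qed

text \<open>The link edges are disjoint. Four of them give \<open>t + t * v^4 = 1\<close>, the tight
  case of the second equation; exactly three need the separate branching above.\<close>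

lemma degree_one:
  assumes a: "a \<in> V" and deg: "\<And>c d e. {c, d} \<in> G a \<Longrightarrow> {c, e} \<in> G a \<Longrightarrow> d = e"
  shows "bnd (\<lambda>_. True) 1"
proof -
  have dis: "r \<inter> r' = {}" if r: "r \<in> G a" "r' \<in> G a" "r \<noteq> r'" for r r'
  proof (rule ccontr)
    assume "r \<inter> r' \<noteq> {}"
    then obtain c where c: "c \<in> r" "c \<in> r'" by blast
    obtain d where d: "r = {c, d}" using G_edge_at[OF r(1) c(1)] .
    obtain e where e: "r' = {c, e}" using G_edge_at[OF r(2) c(2)] .
    show False using deg[of c d e] r d e by simp
  qed
  show ?thesis
  proof (cases "card (G a) = 3")
    case True
    then obtain r1 r2 r3 where r: "G a = {r1, r2, r3}" "r1 \<noteq> r2" "r1 \<noteq> r3" "r2 \<noteq> r3"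
      by (auto simp: card_3_iff)
    then have R: "r1 \<in> G a" "r2 \<in> G a" "r3 \<in> G a" by auto
    obtain c d where cd: "r1 = {c, d}" using G_edge[OF R(1)] .
    obtain e f where ef: "r2 = {e, f}" using G_edge[OF R(2)] .
    obtain g h where gh: "r3 = {g, h}" using G_edge[OF R(3)] .
    have "c \<noteq> d" "e \<noteq> f" "g \<noteq> h" using R G_pair unfolding cd ef gh by blast+
    moreover have "r1 \<inter> r2 = {}" "r1 \<inter> r3 = {}" "r2 \<inter> r3 = {}" using dis R r(2-4) by blast+
    ultimately have "distinct [c, d, e, f, g, h]" unfolding cd ef gh by auto
    then show ?thesis using three_disjoint_edges[of a c d e f g h] r(1) cd ef gh by blast
  next
    case False
    then have "4 \<le> card (G a)" using card_G[OF a] by simp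
    then obtain R where R: "R \<subseteq> G a" "card R = 4" by (meson obtain_subset_with_card_n)
    let ?K = "(`) Pos ` R"
    have Kl: "D \<in> link a" if "D \<in> ?K" for D using that R(1) by (auto simp: G_def)
    have "inj_on ((`) Pos) R" using inj_Pos by (auto simp: inj_on_def inj_image_eq_iff)
    then have cK: "card ?K = 4" using R(2) by (simp add: card_image)
    have "atom_of ` C \<inter> atom_of ` D = {}" if "C \<in> ?K" "D \<in> ?K" "C \<noteq> D" for C D
    proof -
      obtain r r' where "r \<in> R" "C = Pos ` r" "r' \<in> R" "D = Pos ` r'" using \<open>C \<in> ?K\<close> \<open>D \<in> ?K\<close> by blast
      then show ?thesis using dis[of r r'] R(1) \<open>C \<noteq> D\<close> by (auto simp: image_image)
    qed
    moreover have "finite ?K" using cK card.infinite by force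
    moreover have "two_clause D" if "D \<in> ?K" for D using linkD(1)[OF Kl[OF that]] .
    ultimately have "matching ?K" unfolding matching_def by (intro conjI ballI impI)
    moreover have "atom_of ` D \<subseteq> V - {a}" if "D \<in> ?K" for D using linkD(2,3)[OF Kl[OF that]] by auto
    moreover have "holds M D" if "D \<in> ?K" "mm M" "a \<notin> M" for D M
      using linkD(5)[OF Kl[OF that(1)] that(2,3)] .
    ultimately have "state (\<lambda>M. a \<notin> M) [Neg a] ?K" using a by (simp add: state_def)
    then have "bnd (\<lambda>M. a \<notin> M) (t * v^4)" using state_bnd[of "\<lambda>M. a \<notin> M" "[Neg a]" ?K] cK by (simp add: val_def)
    moreover have "bnd (\<lambda>M. a \<in> M) t" using state_bnd[OF state_pos[OF a]] by simp
    ultimately show ?thesis by (rule bnd_cases) (use root2 in auto)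
  qed
qed

context
  fixes a
  assumes deg: "\<And>c d e f. {c, d} \<in> G a \<Longrightarrow> {c, e} \<in> G a \<Longrightarrow> {c, f} \<in> G a \<Longrightarrow> d = e \<or> d = f \<or> e = f"
begin

text \<open>Degrees at most 2 keep \<open>r\<close> away from \<open>c\<close> and \<open>e\<close>.
  If \<open>r\<close> meets an end of the path, the link splits into two stars, with centres
  \<open>c\<close>, \<open>f\<close> or \<open>d\<close>, \<open>e\<close>; otherwise
  \<open>r\<close> is disjoint from the path.\<close>

lemma four_edges:
  assumes G: "G a = {{c, d}, {c, e}, {e, f}, r}" and ne: "d \<noteq> e" "f \<noteq> c"
    and r: "r \<noteq> {c, d}" "r \<noteq> {c, e}" "r \<noteq> {e, f}"
  shows "bnd (\<lambda>_. True) 1"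
proof -
  have E: "{c, d} \<in> G a" "{c, e} \<in> G a" "{e, f} \<in> G a" "r \<in> G a" using G by auto
  note p = G_pair[OF E(1)] G_pair[OF E(2)] G_pair[OF E(3)]
  obtain g h where gh: "r = {g, h}" using G_edge[OF E(4)] .
  have cr: "c \<notin> r"
  proof
    assume "c \<in> r"
    then obtain w where "r = {c, w}" using G_edge_at[OF E(4)] by blast
    then show False using deg[of c d e w] E ne r by auto
  qed
  have er: "e \<notin> r"
  proof
    assume "e \<in> r"
    then obtain w where "r = {e, w}" using G_edge_at[OF E(4)] by blast
    then show False using deg[of e c f w] E ne r by (auto simp: insert_commute)
  qed
  show ?thesis
  proof (cases "f \<in> r")
    case True
    then obtain w where w: "r = {f, w}" using G_edge_at[OF E(4)] by blast
    have "f \<noteq> d"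
    proof
      assume "f = d"
      then show False using deg[of d c e w] E w p cr er by (auto simp: insert_commute)
    qed
    moreover have "G a = {{c, d}, {c, e}, {f, e}, {f, w}}" using G w by (simp add: insert_commute)
    ultimately show ?thesis using two_stars[of a c d e f e w] ne p w cr er by auto
  next
    case fr: False
    show ?thesis
    proof (cases "d \<in> r")
      case True
      then obtain w where w: "r = {d, w}" using G_edge_at[OF E(4)] by blast
      have "f \<noteq> d" using fr True by blast
      moreover have "G a = {{d, c}, {d, w}, {e, c}, {e, f}}" using G w by (auto simp: insert_commute)
      ultimately show ?thesis using two_stars[of a d c w e c f] ne p w cr er by auto
    next
      case False
      then show ?thesis using path_and_edge[OF G[unfolded gh]] ne cr er fr gh by auto
    qed
  qed
qed

text \<open>The case depends on the number of edges off \<open>c\<close>: one gives a star with an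
  edge or a triangle; two give a path with an edge, or both survive a branching on \<open>c\<close>;
  three or more have no common vertex and are used together where \<open>c\<close> is true.\<close>

lemma degree_two:
  assumes cd: "{c, d} \<in> G a" and ce: "{c, e} \<in> G a" and de: "d \<noteq> e"
  shows "bnd (\<lambda>_. True) 1"
proof -
  note p = G_pair[OF cd] G_pair[OF ce] de
  have a: "a \<in> V" using p by blast
  define R where "R = G a - {{c, d}, {c, e}}"
  have finR: "finite R" using finite_G[OF a] by (simp add: R_def)
  have GR: "G a = insert {c, d} (insert {c, e} R)" using cd ce by (auto simp: R_def)
  have "{c, d} \<noteq> {c, e}" using de by (auto simp: doubleton_eq_iff)
  then have cardG: "card (G a) = card R + 2" unfolding GR using finR by (simp add: R_def)
  have cR: "c \<notin> r" if r: "r \<in> R" for r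
  proof
    assume "c \<in> r"
    then obtain w where w: "r = {c, w}" using G_edge_at[of r a c] r by (auto simp: R_def)
    then show False using deg[of c d e w] cd ce r de by (auto simp: R_def)
  qed
  \<comment> \<open>The vertex \<open>x\<close> already has the edge \<open>{c, x}\<close>, so at
    most one edge of \<open>R\<close> contains it.\<close>
  have uniq: "r = r'" if r: "r \<in> R" "r' \<in> R" "x \<in> r" "x \<in> r'" and cx: "{c, x} \<in> G a" for r r' x
  proof -
    obtain w where w: "r = {x, w}" using G_edge_at[of r a x] r by (auto simp: R_def)
    obtain w' where w': "r' = {x, w'}" using G_edge_at[of r' a x] r by (auto simp: R_def)
    have "{x, c} \<in> G a" "{x, w} \<in> G a" "{x, w'} \<in> G a"
      using cx r w w' by (auto simp: R_def insert_commute)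
    then have "c = w \<or> c = w' \<or> w = w'" by (rule deg)
    then show ?thesis using cR[OF r(1)] cR[OF r(2)] w w' by auto
  qed
  consider "card R = 1" | "card R = 2" | "3 \<le> card R" using card_G[OF a] cardG by linarith
  then show ?thesis
  proof cases
    case 1
    then obtain r where r: "R = {r}" by (auto simp: card_1_singleton_iff)
    then have rG: "r \<in> G a" using GR by blast
    obtain x y where xy: "r = {x, y}" using G_edge[OF rG] .
    have cr: "c \<notin> r" using cR r by blast
    have rest: "c \<in> s \<or> s = {x, y}" if "s \<in> G a" for s using that GR r xy by auto
    consider "d \<notin> r" | "e \<notin> r" | "r = {d, e}" using xy de by auto
    then show ?thesis
    proof cases
      case 1
      then show ?thesis using star_and_edge[OF cd _ _ rest] rG xy cr by auto
    next
      case 2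
      then show ?thesis using star_and_edge[OF ce _ _ rest] rG xy cr by auto
    next
      case 3
      then show ?thesis using triangle[of a c d e] GR r by simp
    qed
  next
    case 2
    then obtain r1 r2 where r: "R = {r1, r2}" "r1 \<noteq> r2" by (auto simp: card_2_iff)
    have rG: "r1 \<in> G a" "r2 \<in> G a" using GR r by auto
    have hit: ?thesis if s: "R = {s, s'}" "s \<noteq> s'" and m: "m \<in> s" and G': "{c, k} \<in> G a" "{c, m} \<in> G a" "k \<noteq> m"
      "{{c, d}, {c, e}} = {{c, k}, {c, m}}" for s s' m k
    proof -
      have sG: "s \<in> G a" "s \<in> R" "s' \<in> R" using s GR by auto
      obtain f where f: "s = {m, f}" using G_edge_at[OF sG(1) m] .
      have "G a = {{c, d}, {c, e}} \<union> {s, s'}" using GR s by auto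
      then have "G a = {{c, k}, {c, m}, {m, f}, s'}" using G'(4) f by auto
      moreover have "f \<noteq> c" using cR[OF sG(2)] f by auto
      moreover have "s' \<noteq> {c, k}" "s' \<noteq> {c, m}" using cR[OF sG(3)] by auto
      ultimately show ?thesis using four_edges[of c k m f s'] G'(3) s(2) f by auto
    qed
    show ?thesis
    proof (cases "{d, e} \<inter> r1 = {} \<and> {d, e} \<inter> r2 = {}")
      case False
      have r': "R = {r2, r1}" "r2 \<noteq> r1" using r by auto
      from False consider "d \<in> r1" | "e \<in> r1" | "d \<in> r2" | "e \<in> r2" by blast
      then show ?thesis
        using hit[OF r, of d e] hit[OF r, of e d] hit[OF r', of d e] hit[OF r', of e d] cd ce de
        by cases (auto simp: insert_commute)
    next
      case True
      obtain x y where xy: "r1 = {x, y}" using G_edge[OF rG(1)] .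
      obtain x' y' where xy': "r2 = {x', y'}" using G_edge[OF rG(2)] .
      have G2: "{x, y} \<in> G a" "{x', y'} \<in> G a" using rG xy xy' by auto
      have cr: "c \<notin> r1" "c \<notin> r2" using cR r by auto
      note q = p G_pair[OF G2(1)] G_pair[OF G2(2)]
      let ?Ps = "[cube_edges [a] [] [], cube_edges [c] [a] [(x, y), (x', y')], cube_edges [d, e] [a, c] [(x, y), (x', y')]]"
      show ?thesis
      proof (rule bnd_cover)
        have "bnd (cube_edges [a] [] []) (t^1 * v^0)" by (rule bnd_cube_edges) (use p in auto)
        moreover have "bnd (cube_edges [c] [a] [(x, y), (x', y')]) (t^2 * v^2)"
          by (rule bnd_cube_edges_two) (use q cr r xy xy' in auto)
        moreover have "bnd (cube_edges [d, e] [a, c] [(x, y), (x', y')]) (t^4 * v^2)"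
          by (rule bnd_cube_edges_two) (use q cr r xy xy' True in auto)
        ultimately show "list_all2 bnd ?Ps [t^1 * v^0, t^2 * v^2, t^4 * v^2]" by simp
        show "sum_list [t^1 * v^0, t^2 * v^2, t^4 * v^2] \<le> 1"
          using tv_le[of 1 0] tv_le[of 2 2] tv_le[of 4 2] by (simp add: power_divide)
        fix M assume M: "mm M"
        show "\<exists>P\<in>set ?Ps. P M"
          using G_hit[OF cd M] G_hit[OF ce M] G_hit[OF G2(1) M] G_hit[OF G2(2) M]
          by (cases "a \<in> M"; cases "c \<in> M") (simp_all add: cube_edges_def)
      qed
    qed
  next
    case 3
    then obtain R3 where R3: "R3 \<subseteq> R" "card R3 = 3" by (meson obtain_subset_with_card_n)
    then obtain r1 r2 r3 where r: "R3 = {r1, r2, r3}" "r1 \<noteq> r2" "r1 \<noteq> r3" "r2 \<noteq> r3"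
      by (auto simp: card_3_iff)
    have rR: "r1 \<in> R" "r2 \<in> R" "r3 \<in> R" using R3 r by auto
    have rG: "r1 \<in> G a" "r2 \<in> G a" "r3 \<in> G a" using rR by (auto simp: R_def)
    have no_common: "\<exists>r\<in>R. x \<notin> r" for x
    proof (rule ccontr)
      assume "\<not> (\<exists>r\<in>R. x \<notin> r)"
      then have x: "x \<in> r1" "x \<in> r2" "x \<in> r3" using rR by auto
      obtain w1 where w1: "r1 = {x, w1}" using G_edge_at[OF rG(1) x(1)] .
      obtain w2 where w2: "r2 = {x, w2}" using G_edge_at[OF rG(2) x(2)] .
      obtain w3 where w3: "r3 = {x, w3}" using G_edge_at[OF rG(3) x(3)] .
      show False using deg[of x w1 w2 w3] rG r(2-4) w1 w2 w3 by auto
    qed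
    \<comment> \<open>Each of \<open>d\<close> and \<open>e\<close> lies on at most one edge of
      \<open>R\<close>, so three edges cannot all be hit.\<close>
    have "\<exists>s\<in>R. d \<notin> s \<and> e \<notin> s"
    proof (rule ccontr)
      assume "\<not> (\<exists>s\<in>R. d \<notin> s \<and> e \<notin> s)"
      then have "d \<in> r1 \<or> e \<in> r1" "d \<in> r2 \<or> e \<in> r2" "d \<in> r3 \<or> e \<in> r3" using rR by blast+
      then show False using uniq[OF _ _ _ _ cd] uniq[OF _ _ _ _ ce] rR r(2-4) by metis
    qed
    then obtain s where s: "s \<in> R" "d \<notin> s" "e \<notin> s" by blast
    then have sG: "s \<in> G a" by (simp add: R_def)
    obtain x y where xy: "s = {x, y}" using G_edge[OF sG] .
    have G2: "{x, y} \<in> G a" using sG xy by simp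
    have "bnd (cube [c] [a]) (t^2 * phi3)"
    proof -
      have st: "state (cube [c] [a]) (map Pos [c] @ map Neg [a]) {}" by (rule cube_state) (use p in auto)
      have "bnd (cube [c] [a]) (phi3 * t^length (map Pos [c] @ map Neg [a]))"
      proof (rule three_clauses[OF st, where DD = "(`) Pos ` R"])
        have "inj_on ((`) Pos) R" using inj_Pos by (auto simp: inj_on_def inj_image_eq_iff)
        then show "3 \<le> card ((`) Pos ` R)" using 3 by (simp add: card_image)
        show "\<exists>D\<in>(`) Pos ` R. l \<notin> D" for l
          using no_common[of "atom_of l"] by (cases l) auto
        fix D assume "D \<in> (`) Pos ` R"
        then obtain r where r: "r \<in> R" "D = Pos ` r" by blast
        then have rG: "r \<in> G a" by (simp add: R_def)
        obtain x y where xy: "r = {x, y}" using G_edge[OF rG] .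
        have E: "{x, y} \<in> G a" using rG xy by simp
        have "new_clause (cube [c] [a]) (map Pos [c] @ map Neg [a]) {} {Pos x, Pos y}"
          using G_pair[OF E] cR[OF r(1)] xy G_hit[OF E] by (intro cube_new_clause) auto
        then show "new_clause (cube [c] [a]) (map Pos [c] @ map Neg [a]) {} D" using r(2) xy by simp
      qed simp
      then show ?thesis by (simp add: power2_eq_square mult_ac)
    qed
    moreover have "t^2 * phi3 = t^3 * v^1 + t^5 * v^0"
      by (simp add: phi3_def algebra_simps eval_nat_numeral)
    ultimately have b1: "bnd (cube [c] [a]) (t^3 * v^1 + t^5 * v^0)" by simp
    have b2: "bnd (cube_edges [a] [] []) (t^1 * v^0)" by (rule bnd_cube_edges) (use p in auto)
    have b3: "bnd (cube_edges [d, e] [a, c] [(x, y)]) (t^4 * v^1)"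
      by (rule bnd_cube_edges) (use p s cR[OF s(1)] xy G_pair[OF G2] in auto)
    let ?Ps = "[cube [c] [a], cube_edges [a] [] [], cube_edges [d, e] [a, c] [(x, y)]]"
    show ?thesis
    proof (rule bnd_cover)
      show "list_all2 bnd ?Ps [t^3 * v^1 + t^5 * v^0, t^1 * v^0, t^4 * v^1]" using b1 b2 b3 by simp
      show "sum_list [t^3 * v^1 + t^5 * v^0, t^1 * v^0, t^4 * v^1] \<le> 1"
        using tv_le[of 1 0] tv_le[of 3 1] tv_le[of 5 0] tv_le[of 4 1]
        by (simp add: power_divide mult.commute[of v])
      fix M assume M: "mm M"
      show "\<exists>P\<in>set ?Ps. P M"
        using G_hit[OF cd M] G_hit[OF ce M] G_hit[OF G2 M]
        by (cases "a \<in> M"; cases "c \<in> M") (simp_all add: cube_edges_def)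
    qed
  qed
qed

end

lemma hypergraph_bound:
  assumes a: "a \<in> V"
  shows "bnd (\<lambda>_. True) 1"
proof (cases "\<exists>c d e f. {c, d} \<in> G a \<and> {c, e} \<in> G a \<and> {c, f} \<in> G a \<and> d \<noteq> e \<and> d \<noteq> f \<and> e \<noteq> f")
  case True
  then show ?thesis using degree_three by blast
next
  case no3: False
  show ?thesis
  proof (cases "\<exists>c d e. {c, d} \<in> G a \<and> {c, e} \<in> G a \<and> d \<noteq> e")
    case True
    then show ?thesis using degree_two[of a] no3 by metis
  next
    case False
    then show ?thesis using degree_one[OF a] by blast
  qed
qed

end

section \<open>The bound for minimal models\<close>

context branching
begin

lemma no_two_clause_bound:
  assumes all3: "\<And>C. C \<in> T \<Longrightarrow> card C = 3"
  shows "bnd (\<lambda>_. True) 1"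
proof (cases "V = {}")
  case True
  \<comment> \<open>With no atoms, the empty set is the only candidate and nothing can be branched
    on.\<close>
  have "{M. mm M \<and> True} \<subseteq> {{}}" using minimal_model_subset_atoms[of T] True by blast
  then have "card {M. mm M \<and> True} \<le> card {{} :: 'a set}" by (intro card_mono) auto
  then show ?thesis using True by (simp add: bnd_def)
next
  case V: False
  interpret branching3 t u v T by unfold_locales (rule all3)
  consider (small) a where "a \<in> V" "card (link a) \<le> 2"
    | (common) a c where "a \<in> V" "3 \<le> card (link a)" "\<And>D. D \<in> link a \<Longrightarrow> c \<in> D"
    | (neg) C a where "C \<in> T" "Neg a \<in> C" "3 \<le> card (link a)" "\<And>c. \<exists>D\<in>link a. c \<notin> D"
    | (hyper) "\<And>C l. C \<in> T \<Longrightarrow> l \<in> C \<Longrightarrow> \<exists>a. l = Pos a" "\<And>a. a \<in> V \<Longrightarrow> 3 \<le> card (link a)"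
        "\<And>a c. a \<in> V \<Longrightarrow> \<exists>D\<in>link a. c \<notin> D"
  proof (cases "\<exists>a\<in>V. card (link a) \<le> 2")
    case False
    then have big: "3 \<le> card (link a)" if "a \<in> V" for a using that by fastforce
    show thesis
    proof (cases "\<exists>a\<in>V. \<exists>c. \<forall>D\<in>link a. c \<in> D")
      case False
      then have com: "\<exists>D\<in>link a. c \<notin> D" if "a \<in> V" for a c using that by blast
      show thesis
      proof (cases "\<exists>C\<in>T. \<exists>a. Neg a \<in> C")
        case True
        then obtain C a where C: "C \<in> T" "Neg a \<in> C" by blast
        then have "atom_of (Neg a) \<in> V" using clauseD(3)[OF C(1)] by blast
        then show thesis using neg[OF C] big com by simp
      next
        case False
        have "\<exists>a. l = Pos a" if "C \<in> T" "l \<in> C" for C l using False that by (cases l) auto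
        then show thesis using hyper big com by blast
      qed
    qed (use common big in blast)
  qed (use small in blast)
  then show ?thesis
  proof cases
    case small
    then show ?thesis by (rule link_small)
  next
    case common
    then have "link a \<noteq> {}" by auto
    then obtain D where "D \<in> link a" by blast
    then show ?thesis using link_common[OF common(1)] common(3) by blast
  next
    case neg
    then show ?thesis by (rule negative_literal)
  next
    case hyper
    interpret hypergraph_branching t u v T by unfold_locales (use hyper in auto)
    show ?thesis using V hypergraph_bound by blast
  qed
qed

text \<open>The tests are ordered so that each failure supplies an assumption for the next: no empty
  clause, no unit clause, disjoint implied 2-clauses, and finally only 3-clauses.\<close>

lemma branching_bound:
  assumes K: "matching K" "K \<subseteq> T"
  shows "bnd (\<lambda>_. True) (v^card K)"
proof -
  have st: "state (\<lambda>_. True) [] K"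
    using K clauseD(3) minimal_model_holds[of T] by (auto simp: state_def)
  show ?thesis
  proof (cases "{} \<in> T")
    case True
    then show ?thesis
      using minimal_model_holds[of T _ "{}"] v_pos by (intro bnd_empty) (auto simp: holds_def)
  next
    case nonempty: False
    show ?thesis
    proof (cases "\<exists>C\<in>T. card C = 1")
      case True
      then obtain l where l: "{l} \<in> T" by (auto simp: card_1_singleton_iff)
      show ?thesis
      proof (rule forced_literal[OF st])
        show "atom_of l \<in> V" using clauseD(3)[OF l] by simp
        show "true_literal M l" if "mm M" for M
          using minimal_model_holds[OF that l] by (simp add: holds_def)
      qed
    next
      case False
      have no_unit: "2 \<le> card C" if "C \<in> T" for C
      proof -
        have "card C \<noteq> 0" using clauseD(1)[OF that] nonempty that by auto
        moreover have "card C \<noteq> 1" using False that by blast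
        ultimately show ?thesis by simp
      qed
      show ?thesis
      proof (cases "\<exists>C D. implied C \<and> implied D \<and> C \<noteq> D \<and> atom_of ` C \<inter> atom_of ` D \<noteq> {}")
        case True
        then show ?thesis using implied_share[OF st] by blast
      next
        case False
        then have sh: "C = D" if "implied C" "implied D" "atom_of ` C \<inter> atom_of ` D \<noteq> {}" for C D
          using that by blast
        define K1 where "K1 = {C \<in> T. card C = 2}"
        have finK1: "finite K1" using cnf by (simp add: K1_def cnf_theory_def)
        have KK1: "K \<subseteq> K1"
        proof
          fix C assume C: "C \<in> K"
          then have "two_clause C" using K(1) by (simp add: matching_def)
          then have "card C = 2" by (auto simp: two_clause_def card_insert_if)
          then show "C \<in> K1" using C K(2) by (auto simp: K1_def)
        qed
        show ?thesis
        proof (cases "K1 = {}")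
          case False
          have "bnd (\<lambda>_. True) (v^card K1)"
            using some_two_clause[OF no_unit sh] False by (simp add: K1_def)
          then show ?thesis
            using card_mono[OF finK1 KK1] v_pos v_upper by (elim bnd_mono) (auto intro: power_decreasing)
        next
          case True
          have "card C = 3" if "C \<in> T" for C
          proof -
            have "card C \<noteq> 2" using True that by (auto simp: K1_def)
            then show ?thesis using no_unit[OF that] clauseD(2)[OF that] by simp
          qed
          then show ?thesis using no_two_clause_bound True KK1 by simp
        qed
      qed
    qed
  qed
qed

end

lemma (in weights) minimal_models_bound:
  fixes T :: "'a clause set"
  assumes "cnf_theory 3 T" "matching K" "K \<subseteq> T"
  shows "real (card {M. cnf_minimal_model T M}) \<le> (1 / t)^card (cnf_atoms T) * v^card K"
  using assms
proof (induction "card (cnf_atoms T)" arbitrary: T K rule: less_induct)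
  case less
  interpret branching t u v T by unfold_locales (use less in auto)
  show ?case using branching_bound[OF less.prems(2,3)] by (simp add: bnd_def)
qed

lemma balanced_root_weights:
  assumes bal: "balanced_root \<alpha> \<tau>" and \<tau>: "1.6701 < \<tau>" "\<tau> < 1.6702"
  shows "weights (1 / \<tau>) (\<tau> powr \<alpha>) (1 / \<tau> powr \<alpha>)"
proof -
  let ?t = "1 / \<tau>" and ?u = "\<tau> powr \<alpha>"
  have pow: "\<tau> powr (- real k + real j * \<alpha>) = ?t^k * ?u^j" for k j
  proof -
    have "\<tau> powr (- real k) = ?t^k"
      using \<tau> by (simp only: powr_minus_divide) (subst powr_realpow, auto simp: power_divide)
    moreover have "\<tau> powr (real j * \<alpha>) = ?u^j"
      using \<tau> by (simp add: powr_power mult.commute)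
    ultimately show ?thesis by (simp only: powr_add)
  qed
  have root1: "?t * ?u + ?t^4 * ?u^3 + 2 * (?t^6 * ?u^4) + ?t^8 * ?u^5 = 1"
    using bal pow[of 1 1] pow[of 4 3] pow[of 6 4] pow[of 8 5] by (simp add: balanced_root_def)
  have u0: "0 < ?u" using \<tau> by simp
  have "\<tau> powr (-1 - 4 * \<alpha>) = ?t * (1 / ?u)^4"
  proof -
    have "\<tau> powr (-1 - 4 * \<alpha>) = \<tau> powr (-1) / \<tau> powr (4 * \<alpha>)" by (simp add: powr_diff)
    moreover have "\<tau> powr (4 * \<alpha>) = ?u^4" using \<tau> by (simp add: powr_power mult.commute)
    moreover have "\<tau> powr (-1) = ?t" using \<tau> by (simp add: powr_minus_divide)
    ultimately show ?thesis by (simp add: power_divide)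
  qed
  moreover have "\<tau> powr (-1) = ?t" using \<tau> by (simp add: powr_minus_divide)
  ultimately have root2: "?t + ?t * (1 / ?u)^4 = 1" using bal by (simp add: balanced_root_def)
  \<comment> \<open>The second equation ties \<open>u\<close> to tau by
    \<open>u^4 * (\<tau> - 1) = 1\<close>; the known interval for tau thus yields the interval for
    \<open>u\<close>.\<close>
  then have "(1 / ?u)^4 = \<tau> - 1" using \<tau> by (simp add: field_simps)
  then have u4: "?u^4 * (\<tau> - 1) = 1" using u0 by (simp add: power_divide field_simps)
  have "1.1052 < ?u"
  proof (rule ccontr)
    assume "\<not> 1.1052 < ?u"
    then have "?u^4 * (\<tau> - 1) \<le> 1.1052^4 * 0.6702"
      using u0 \<tau> by (intro mult_mono power_mono) auto
    then show False using u4 by (simp add: power_divide)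
  qed
  moreover have "?u < 1.1053"
  proof (rule ccontr)
    assume "\<not> ?u < 1.1053"
    then have "1.1053^4 * 0.6701 \<le> ?u^4 * (\<tau> - 1)"
      using u0 \<tau> by (intro mult_mono power_mono) auto
    then show False using u4 by (simp add: power_divide)
  qed
  moreover have "0.5987 < ?t" "?t < 0.59877" using \<tau> by (simp_all add: field_simps)
  ultimately show ?thesis using root1 root2 u0 by unfold_locales auto
qed

lemma c3_bounds: "1.6701 < c3" "c3 < 1.6702"
  and c3_minimal_models: "cnf_theory 3 T \<Longrightarrow> real (card {M. cnf_minimal_model T M}) \<le> c3^card (cnf_atoms T)"
proof -
  obtain \<alpha> \<tau> where b: "balanced_root \<alpha> \<tau>" "1.6701 < \<tau>" "\<tau> < 1.6702" using balanced_root_exists by blast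
  have c3: "c3 = \<tau>" using c3_eqI[OF b(1)] .
  interpret weights "1 / \<tau>" "\<tau> powr \<alpha>" "1 / \<tau> powr \<alpha>" by (rule balanced_root_weights[OF b])
  show "1.6701 < c3" "c3 < 1.6702" using b c3 by auto
  show "real (card {M. cnf_minimal_model T M}) \<le> c3^card (cnf_atoms T)" if "cnf_theory 3 T"
    using minimal_models_bound[OF that, of "{}"] c3 by (simp add: matching_def)
qed

section \<open>Programs\<close>

definition rule_clause :: "'a rule \<Rightarrow> 'a clause" where
  "rule_clause C = Pos ` (rule_head C \<union> rule_neg C) \<union> Neg ` rule_pos C"

text \<open>A body atom may recur in the head or under negation. The resulting tautology is excluded
  by \<open>cnf_theory\<close> and holds in every set, so dropping it preserves the models.\<close>

definition program_cnf :: "'a rule set \<Rightarrow> 'a clause set" where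
  "program_cnf P = {D \<in> rule_clause ` P. \<forall>a. \<not> (Pos a \<in> D \<and> Neg a \<in> D)}"

lemma program_cnf_theory:
  assumes "disjunctive_program t P"
  shows "cnf_theory t (program_cnf P)"
  unfolding cnf_theory_def
proof (intro conjI ballI)
  show "finite (program_cnf P)" using assms by (simp add: program_cnf_def disjunctive_program_def)
  fix D assume D: "D \<in> program_cnf P"
  then show "\<forall>a. \<not> (Pos a \<in> D \<and> Neg a \<in> D)" by (simp add: program_cnf_def)
  obtain C where C: "C \<in> P" "D = rule_clause C" using D by (auto simp: program_cnf_def)
  have fin: "finite (rule_head C)" "finite (rule_pos C)" "finite (rule_neg C)"
    "card (rule_head C) + card (rule_pos C) + card (rule_neg C) \<le> t"
    using assms C(1) by (auto simp: disjunctive_program_def)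
  then show "finite D" using C(2) by (simp add: rule_clause_def)
  have "card D \<le> card (Pos ` (rule_head C \<union> rule_neg C)) + card (Neg ` rule_pos C)"
    unfolding C(2) rule_clause_def by (rule card_Un_le)
  also have "\<dots> \<le> card (rule_head C \<union> rule_neg C) + card (rule_pos C)"
    using fin by (intro add_mono card_image_le) auto
  also have "\<dots> \<le> card (rule_head C) + card (rule_neg C) + card (rule_pos C)"
    using card_Un_le by auto
  finally show "card D \<le> t" using fin(4) by simp
qed

lemma program_cnf_atoms: "cnf_atoms (program_cnf P) \<subseteq> program_atoms P"
  unfolding cnf_atoms_def program_cnf_def program_atoms_def rule_clause_def by force

lemma program_model_iff: "program_model P M \<longleftrightarrow> cnf_model (program_cnf P) M"
proof -
  have clause: "holds M (rule_clause C) \<longleftrightarrow>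
      (rule_pos C \<subseteq> M \<and> rule_neg C \<inter> M = {} \<longrightarrow> rule_head C \<inter> M \<noteq> {})" for C
    unfolding holds_def rule_clause_def bex_Un by auto
  have taut: "holds M D" if "Pos a \<in> D" "Neg a \<in> D" for D a
    using that unfolding holds_def by (cases "a \<in> M") force+
  have "cnf_model (program_cnf P) M \<longleftrightarrow> (\<forall>C\<in>P. holds M (rule_clause C))"
    unfolding cnf_model_iff program_cnf_def using taut by blast
  then show ?thesis by (simp add: clause program_model_def)
qed

text \<open>A model \<open>N\<close> of \<open>P\<close> below \<open>M\<close> also satisfies the
  reduct by \<open>M\<close>: a negative body disjoint from \<open>M\<close> is disjoint from
  \<open>N\<close>. Minimality in the reduct thus implies minimality in \<open>P\<close>.\<close>

lemma answer_set_minimal_model: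
  assumes "answer_set P M"
  shows "cnf_minimal_model (program_cnf P) M"
  unfolding cnf_minimal_model_def program_model_iff[symmetric]
proof (intro conjI allI impI)
  have reduct: "program_model (reduct P M) N \<longleftrightarrow>
      (\<forall>C\<in>P. rule_neg C \<inter> M = {} \<and> rule_pos C \<subseteq> N \<longrightarrow> rule_head C \<inter> N \<noteq> {})" for N
    unfolding program_model_def reduct_def by fastforce
  show "program_model P M"
    using assms unfolding answer_set_def reduct by (auto simp: program_model_def)
  fix N assume N: "N \<subset> M"
  show "\<not> program_model P N"
  proof
    assume "program_model P N"
    moreover have "rule_neg C \<inter> N = {}" if "rule_neg C \<inter> M = {}" for C using that N by blast
    ultimately have "program_model (reduct P M) N" unfolding reduct by (simp add: program_model_def)
    then show False using assms N by (auto simp: answer_set_def)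
  qed
qed

lemma stable_model_answer_set: "stable_model P M \<Longrightarrow> answer_set P M"
  unfolding stable_model_def answer_set_def by blast

lemma c3_program_bound:
  assumes P: "disjunctive_program 3 P" and S: "S \<subseteq> {M. answer_set P M}"
  shows "finite S" "real (card S) \<le> c3^card (program_atoms P)"
proof -
  have cnf: "cnf_theory 3 (program_cnf P)" by (rule program_cnf_theory[OF P])
  have sub: "S \<subseteq> {M. cnf_minimal_model (program_cnf P) M}" using S answer_set_minimal_model by blast
  show "finite S" using sub finite_minimal_models[OF cnf] by (rule finite_subset)
  have fin: "finite (program_atoms P)"
    using P by (auto simp: program_atoms_def disjunctive_program_def)
  have "real (card S) \<le> real (card {M. cnf_minimal_model (program_cnf P) M})"
    using card_mono[OF finite_minimal_models[OF cnf] sub] by simp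
  also have "\<dots> \<le> c3^card (cnf_atoms (program_cnf P))" by (rule c3_minimal_models[OF cnf])
  \<comment> \<open>Dropping tautologies may lose atoms of the program; this is harmless because
    \<open>c3 > 1\<close>.\<close>
  also have "\<dots> \<le> c3^card (program_atoms P)"
    using card_mono[OF fin program_cnf_atoms] c3_bounds(1) by (intro power_increasing) auto
  finally show "real (card S) \<le> c3^card (program_atoms P)" .
qed

theorem theorem2p3:
  shows "1.6701 \<le> c3 \<and> c3 < 1.6702 \<and>
    (\<forall>(T :: 'a clause set) n. cnf_theory 3 T \<and> card (cnf_atoms T) = n \<longrightarrow>
       finite {M. cnf_minimal_model T M} \<and> real (card {M. cnf_minimal_model T M}) \<le> c3 ^ n) \<and>
    (\<forall>(P :: 'a rule set) n. normal_program 3 P \<and> card (program_atoms P) = n \<longrightarrow>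
       finite {M. stable_model P M} \<and> real (card {M. stable_model P M}) \<le> c3 ^ n) \<and>
    (\<forall>(P :: 'a rule set) n. disjunctive_program 3 P \<and> card (program_atoms P) = n \<longrightarrow>
       finite {M. answer_set P M} \<and> real (card {M. answer_set P M}) \<le> c3 ^ n)"
proof (intro conjI allI impI; (elim conjE)?)
  show "1.6701 \<le> c3" "c3 < 1.6702" using c3_bounds by simp_all
next
  fix T :: "'a clause set" and n
  assume "cnf_theory 3 T" "card (cnf_atoms T) = n"
  then show "finite {M. cnf_minimal_model T M}" "real (card {M. cnf_minimal_model T M}) \<le> c3^n"
    using finite_minimal_models c3_minimal_models by blast+
next
  fix P :: "'a rule set" and n
  assume P: "normal_program 3 P" "card (program_atoms P) = n"
  have "{M. stable_model P M} \<subseteq> {M. answer_set P M}" using stable_model_answer_set by blast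
  from c3_program_bound[OF _ this] P
  show "finite {M. stable_model P M}" "real (card {M. stable_model P M}) \<le> c3^n"
    by (auto simp: normal_program_def)
next
  fix P :: "'a rule set" and n
  assume "disjunctive_program 3 P" "card (program_atoms P) = n"
  then show "finite {M. answer_set P M}" "real (card {M. answer_set P M}) \<le> c3^n"
    using c3_program_bound[of P "{M. answer_set P M}"] by auto
qed

end
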